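(* Let $G$ be a finite group, $k$ a field of characteristic zero, $V$ a cyclic left $kG$-module with character $\chi$, and let $\chi_I$ be the ideal part of $\chi$. Put $N=\operatorname{Ker}(\chi-\chi_I)$. Then a permutation $\pi\in\operatorname{Sym}(G)$ of the set $G$ lies in $\operatorname{Sym}(G,V)$ if and only if the following two conditions hold: (i) $\chi_I\big(\pi(g)^{-1}\pi(h)\big)=\chi_I(g^{-1}h)$ for all $g,h\in G$, and (ii) $\pi(gN)=\pi(1)gN$ (as sets) for all $g\in G$.
   Context: $\operatorname{Gens}(V)=\{v\in V : V=kGv\}$, where $kGv$ is the $k$-span of the orbit $Gv$; $V$ is cyclic if $\operatorname{Gens}(V)\ne\emptyset$. For $v\in V$, $\operatorname{Sym}(G,v)$ is the set of all permutations $\pi$ of the set $G$ for which there is $A\in\operatorname{GL}(V)$ with $A(gv)=\pi(g)v$ for all $g\in G$, and $\operatorname{Sym}(G,V)=\bigcap_{v\in\operatorname{Gens}(V)}\operatorname{Sym}(G,v)$. Fix an algebraically closed field containing $k$ (e.g. $\mathbb{C}$ if $k\subseteq\mathbb{C}$) and let $\operatorname{Irr}(G)$ be the set of irreducible characters of $G$ over it. Write $\chi=\sum_{\psi\in\operatorname{Irr}(G)}m_\psi\psi$; since $V$ is cyclic, $m_\psi\le\psi(1)$ for all $\psi$. The ideal part of $\chi$ is $\chi_I=\sum_{\psi\in\operatorname{Irr}(G),\ m_\psi=\psi(1)}\psi(1)\psi$. For a character $\theta$, $\operatorname{Ker}(\theta)=\{g\in G:\theta(g)=\theta(1)\}$;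 in particular $\operatorname{Ker}(0)=G$. *)

theory Defs
  imports
    "HOL-Algebra.Group_Action"
    "HOL-Algebra.Coset"
    "HOL-Combinatorics.Permutations"
    "HOL-Computational_Algebra.Polynomial"
    "Jordan_Normal_Form.VS_Connect"
begin

text \<open>The basis is arbitrary; the value does not depend on it. In infinite dimension the sum
  is \<open>0\<close>, but cyclic representations of finite groups are finite-dimensional.\<close>

definition (in vector_space) lin_trace :: "('b \<Rightarrow> 'b) \<Rightarrow> 'a" where
  "lin_trace f =
     (let B = (SOME B. independent B \<and> span B = UNIV) in \<Sum>b\<in>B. representation B (f b) b)"

text \<open>A left \<open>kG\<close>-module, given as a \<open>k\<close>-vector space with a linear action of \<open>G\<close>.\<close>

locale group_representation =
  vector_space scale + group_action G "UNIV :: 'v set" act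
  for scale :: "'k::field \<Rightarrow> 'v::ab_group_add \<Rightarrow> 'v"
    and G :: "('g, 'm) monoid_scheme" (structure)
    and act :: "'g \<Rightarrow> 'v \<Rightarrow> 'v" +
  assumes linear_act: "g \<in> carrier G \<Longrightarrow> Vector_Spaces.linear scale scale (act g)"
begin

definition character :: "'g \<Rightarrow> 'k" where
  "character g = lin_trace (act g)"

definition Gens :: "'v set" where
  "Gens = {v. span (Group_Action.orbit G act v) = UNIV}"

definition cyclic :: bool where
  "cyclic \<longleftrightarrow> Gens \<noteq> {}"

definition GL :: "('v \<Rightarrow> 'v) set" where
  "GL = {A. Vector_Spaces.linear scale scale A \<and> bij A}"

definition Sym_vec :: "'v \<Rightarrow> ('g \<Rightarrow> 'g) set" where
  "Sym_vec v =
     {\<pi>. \<pi> permutes carrier G \<and> (\<exists>A\<in>GL. \<forall>g\<in>carrier G. A (act g v) = act (\<pi> g) v)}"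

definition Sym_mod :: "('g \<Rightarrow> 'g) set" where
  "Sym_mod = (\<Inter>v\<in>Gens. Sym_vec v)"

end

definition mat_representation ::
    "('g, 'm) monoid_scheme \<Rightarrow> nat \<Rightarrow> ('g \<Rightarrow> 'K::field mat) \<Rightarrow> bool" where
  "mat_representation G n \<rho> \<longleftrightarrow>
     (\<forall>g\<in>carrier G. \<rho> g \<in> carrier_mat n n) \<and>
     \<rho> \<one>\<^bsub>G\<^esub> = 1\<^sub>m n \<and>
     (\<forall>g\<in>carrier G. \<forall>h\<in>carrier G. \<rho> (g \<otimes>\<^bsub>G\<^esub> h) = \<rho> g * \<rho> h)"

definition irreducible_mat_representation ::
    "('g, 'm) monoid_scheme \<Rightarrow> nat \<Rightarrow> ('g \<Rightarrow> 'K::field mat) \<Rightarrow> bool" where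
  "irreducible_mat_representation G n \<rho> \<longleftrightarrow>
     mat_representation G n \<rho> \<and> n > 0 \<and>
     (\<forall>W. VectorSpace.subspace class_ring W (module_vec TYPE('K) n) \<and>
          (\<forall>g\<in>carrier G. \<forall>w\<in>W. \<rho> g *\<^sub>v w \<in> W) \<longrightarrow>
          W = {0\<^sub>v n} \<or> W = carrier_vec n)"

text \<open>Characters are restricted to the carrier so that distinct elements of \<open>Irr G\<close> are distinct
  as functions on the group.\<close>

definition Irr :: "('g, 'm) monoid_scheme \<Rightarrow> ('g \<Rightarrow> 'K::field) set" where
  "Irr G =
     {\<lambda>g\<in>carrier G. \<Sum>i<n. \<rho> g $$ (i, i) | n \<rho>. irreducible_mat_representation G n \<rho>}"

text \<open>The multiplicities \<open>m\<^sub>\<psi>\<close> in \<open>\<theta> = (\<Sum>\<psi>\<in>Irr G. m\<^sub>\<psi> \<psi>)\<close>, extended by \<open>0\<close> to functions outside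
  \<open>Irr G\<close>. They are determined when \<open>\<theta>\<close> is a character over an algebraically closed field of
  characteristic zero.\<close>

definition multiplicities ::
    "('g, 'm) monoid_scheme \<Rightarrow> ('g \<Rightarrow> 'K::field) \<Rightarrow> ('g \<Rightarrow> 'K) \<Rightarrow> nat" where
  "multiplicities G \<theta> =
     (THE m. (\<forall>\<psi>. \<psi> \<notin> Irr G \<longrightarrow> m \<psi> = 0) \<and>
             (\<forall>g\<in>carrier G. \<theta> g = (\<Sum>\<psi>\<in>Irr G. of_nat (m \<psi>) * \<psi> g)))"

definition ideal_part ::
    "('g, 'm) monoid_scheme \<Rightarrow> ('g \<Rightarrow> 'K::field) \<Rightarrow> 'g \<Rightarrow> 'K" where
  "ideal_part G \<theta> g =
     (\<Sum>\<psi> | \<psi> \<in> Irr G \<and> of_nat (multiplicities G \<theta> \<psi>) = \<psi> \<one>\<^bsub>G\<^esub>. \<psi> \<one>\<^bsub>G\<^esub> * \<psi> g)"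

definition char_Ker :: "('g, 'm) monoid_scheme \<Rightarrow> ('g \<Rightarrow> 'K) \<Rightarrow> 'g set" where
  "char_Ker G \<theta> = {g \<in> carrier G. \<theta> g = \<theta> \<one>\<^bsub>G\<^esub>}"

end

theory Submission
  imports
    Defs
    "HOL-Library.Function_Algebras"
    "HOL-Algebra.Multiplicative_Group"
    "Jordan_Normal_Form.Char_Poly"
begin

text \<open>Fix a generator \<open>v\<close>. The annihilators of the translates \<open>hv\<close> span a two-sided ideal \<open>kGf\<close> with a
  central idempotent \<open>f\<close>, and a constituent has full multiplicity in \<open>V\<close> iff \<open>f\<close> annihilates it; hence
  \<open>\<chi>\<^sub>I(g) = |G| (1 - f)(g\<inverse>)\<close>. A permutation in \<open>Sym(G, V)\<close> preserves \<open>kGf\<close>, and averaging shows that it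
  commutes with multiplication by \<open>f\<close>, which is condition (i). If moreover \<open>\<pi>(1) = 1\<close>, let \<open>A\<^sub>v\<close> be the linear
  map with \<open>A\<^sub>v(gv) = \<pi>(g)v\<close>. Comparing the generators \<open>v\<close>, \<open>v + w\<close> and \<open>v - w\<close> shows that \<open>A\<^sub>v\<close> commutes
  with the endomorphisms of \<open>V\<close> on \<open>fV\<close> and from this that it fixes \<open>fV\<close> pointwise. Since \<open>N\<close> is the kernel
  of \<open>G\<close> on \<open>fV\<close>, this is condition (ii). Conversely, \<open>cv = 0\<close> implies \<open>c = cf\<close>, and then (i) and (ii) give
  \<open>\<pi>(c)v = \<pi>(c)fv = \<pi>(1)cfv = 0\<close>.\<close>

section \<open>The group algebra\<close>

text \<open>The field k need not contain the values of the irreducible characters. The analysis of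
  \<open>Sym_mod\<close> therefore stays over k and uses only f; the field K enters when f is
  translated into \<open>\<chi>\<^sub>I\<close> and N along \<open>emb\<close>. Dimension counts are
  replaced by traces of idempotents. In characteristic zero such a trace is a natural number that
  vanishes only for the zero idempotent, and in the group algebra it is |G| times the coefficient at
  1. The multiplicity of a constituent is the trace of an idempotent matrix \<rho>(\<epsilon>). It
  is full exactly when \<rho> kills 1 - \<epsilon>, hence all annihilators of translates; this is
  why f detects the ideal part. The main obstacle is that the linear map attached to a permutation
  depends on the generator, with no evident relation between different generators. The generators v
  + w and v - w give two equations that differ only in the sign of an unwanted term, which therefore
  vanishes. A second obstacle is that an abstract K has no absolute value. The fact that \<theta>(g)
  = \<theta>(1) forces g to act trivially is imported from the complex numbers through the rational
  relations of a root of unity.\<close>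

definition fscale :: "'k::field \<Rightarrow> ('a \<Rightarrow> 'k) \<Rightarrow> 'a \<Rightarrow> 'k" where
  "fscale c a = (\<lambda>x. c * a x)"

lemma fscale_apply [simp]: "fscale c a x = c * a x"
  by (simp add: fscale_def)

lemma sum_fun_apply: "(\<Sum>i\<in>S. F i) x = (\<Sum>i\<in>S. F i x)"
  for F :: "'i \<Rightarrow> 'a \<Rightarrow> 'k::comm_monoid_add"
  by (induction S rule: infinite_finite_induct) auto

interpretation fs: vector_space "fscale :: 'k::field \<Rightarrow> ('a \<Rightarrow> 'k) \<Rightarrow> 'a \<Rightarrow> 'k"
  by unfold_locales (simp_all add: fun_eq_iff distrib_left distrib_right)

definition point :: "'a \<Rightarrow> 'a \<Rightarrow> 'k::field" where
  "point g = (\<lambda>x. if x = g then 1 else 0)"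

lemma sum_point_expand:
  assumes "finite S" "\<And>x. x \<notin> S \<Longrightarrow> a x = 0"
  shows "a = (\<Sum>x\<in>S. fscale (a x) (point x))"
  using assms by (auto simp: fun_eq_iff sum_fun_apply point_def if_distrib cong: if_cong)

text \<open>The sum is the trace of \<open>p\<close>, and for an idempotent this is the size of a
  basis of its range. In characteristic zero, trace 0 then means an empty basis. The index type is
  arbitrary so that operators on the group algebra and matrices are both covered.\<close>

lemma trace_idempotent:
  fixes p :: "('a \<Rightarrow> 'k::field_char_0) \<Rightarrow> 'a \<Rightarrow> 'k"
  assumes lin: "Vector_Spaces.linear fscale fscale p" and idem: "\<And>a. p (p a) = p a"
    and S: "finite S" "\<And>a x. x \<notin> S \<Longrightarrow> p a x = 0"
  shows "\<exists>n. (\<Sum>x\<in>S. p (point x) x) = of_nat n" (is ?nat)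
    and "(\<Sum>x\<in>S. p (point x) x) = 0 \<Longrightarrow> p a = 0"
proof -
  interpret p: Vector_Spaces.linear fscale fscale p by fact
  obtain B where B: "B \<subseteq> range p" "fs.independent B" "range p \<subseteq> fs.span B"
    using fs.maximal_independent_subset[of "range p"] by metis
  have pB: "p b = b" if "b \<in> B" for b
    using B(1) that idem by auto
  have expand: "p a = (\<Sum>x\<in>S. fscale (p a x) (point x))" for a
    by (rule sum_point_expand) (use S in auto)
  have "p a \<in> fs.span (point ` S)" for a
    by (subst expand) (intro fs.span_sum fs.span_scale fs.span_base imageI)
  then have "B \<subseteq> fs.span (point ` S)"
    using B(1) by auto
  then have finB: "finite B"
    using fs.independent_span_bound[OF _ B(2)] S(1) by blast
  let ?r = "fs.representation B"
  have "(\<Sum>x\<in>S. p (point x) x) = (\<Sum>x\<in>S. \<Sum>b\<in>B. ?r (p (point x)) b * b x)"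
  proof (rule sum.cong[OF refl])
    fix x
    have "p (point x) = (\<Sum>b\<in>B. fscale (?r (p (point x)) b) b)"
      using fs.sum_representation_eq[OF B(2) _ finB order_refl, of "p (point x)"] B(3)
      by (metis rangeI subsetD)
    from fun_cong[OF this, of x] show "p (point x) x = (\<Sum>b\<in>B. ?r (p (point x)) b * b x)"
      by (simp only: sum_fun_apply fscale_apply)
  qed
  also have "\<dots> = (\<Sum>b\<in>B. \<Sum>x\<in>S. ?r (p (point x)) b * b x)"
    by (rule sum.swap)
  \<comment> \<open>The inner sum is the b-coordinate of \<open>p b\<close>, expanded over points,
    and \<open>p b = b\<close>.\<close>
  also have "\<dots> = (\<Sum>b\<in>B. 1)"
  proof (rule sum.cong[OF refl])
    fix b assume b: "b \<in> B"
    have "b x = 0" if "x \<notin> S" for x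
      using S(2)[OF that, of b] pB[OF b] by simp
    then have "p b = p (\<Sum>x\<in>S. fscale (b x) (point x))"
      by (intro arg_cong[where f = p] sum_point_expand[OF S(1)])
    then have "b = (\<Sum>x\<in>S. fscale (b x) (p (point x)))"
      by (simp only: pB[OF b] p.sum p.scale)
    then have "?r b b = ?r (\<Sum>x\<in>S. fscale (b x) (p (point x))) b" by simp
    also have "\<dots> = (\<Sum>x\<in>S. ?r (p (point x)) b * b x)"
      using B(3) by (subst fs.representation_sum[OF B(2)])
        (auto intro!: fs.span_scale sum.cong simp: fs.representation_scale[OF B(2)] subset_eq)
    finally show "(\<Sum>x\<in>S. ?r (p (point x)) b * b x) = 1"
      using fs.representation_basis[OF B(2) b] by simp
  qed
  finally have tr: "(\<Sum>x\<in>S. p (point x) x) = of_nat (card B)" by simp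
  then show ?nat by blast
  assume "(\<Sum>x\<in>S. p (point x) x) = 0"
  then have "B = {}" using tr finB by simp
  then show "p a = 0" using B(3) by auto
qed

section \<open>Convolution on a finite group\<close>

locale finite_group = group G for G :: "('g, 'm) monoid_scheme" (structure) +
  assumes finite_carrier [simp]: "finite (carrier G)"
begin

text \<open>The functions live on the whole type and vanish off the carrier, so that equality of
  functions is equality in the group algebra. Since \<open>conv\<close> is cut off in the same way,
  products lie in \<open>galg\<close> for arbitrary factors, and identities such as
  \<open>conv_assoc\<close> hold without membership premises.\<close>

definition galg :: "('g \<Rightarrow> 'k::field) set" where
  "galg = {a. \<forall>x. x \<notin> carrier G \<longrightarrow> a x = 0}"

definition conv :: "('g \<Rightarrow> 'k::field) \<Rightarrow> ('g \<Rightarrow> 'k) \<Rightarrow> 'g \<Rightarrow> 'k" (infixl "\<star>" 70) where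
  "a \<star> b = (\<lambda>x. if x \<in> carrier G then \<Sum>g\<in>carrier G. a g * b (inv g \<otimes> x) else 0)"

lemma sum_inv: "(\<Sum>g\<in>carrier G. F (inv g)) = (\<Sum>g\<in>carrier G. F g)"
  by (rule sum.reindex_bij_witness[where i = "\<lambda>g. inv g" and j = "\<lambda>g. inv g"]) auto

lemma sum_left_mult: "h \<in> carrier G \<Longrightarrow> (\<Sum>g\<in>carrier G. F (h \<otimes> g)) = (\<Sum>g\<in>carrier G. F g)"
  by (rule sum.reindex_bij_witness[where i = "\<lambda>g. inv h \<otimes> g" and j = "\<lambda>g. h \<otimes> g"])
    (auto simp: m_assoc[symmetric])

lemma sum_right_mult: "h \<in> carrier G \<Longrightarrow> (\<Sum>g\<in>carrier G. F (g \<otimes> h)) = (\<Sum>g\<in>carrier G. F g)"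
  by (rule sum.reindex_bij_witness[where i = "\<lambda>g. g \<otimes> inv h" and j = "\<lambda>g. g \<otimes> h"])
    (auto simp: m_assoc)

lemma carrier_neq_empty [simp]: "carrier G \<noteq> {}"
  using one_closed by blast

lemma card_carrier_neq_0 [simp]: "(of_nat (card (carrier G)) :: 'k::field_char_0) \<noteq> 0"
  using one_closed by (auto simp: card_eq_0_iff simp del: one_closed)

lemma galgD: "a \<in> galg \<Longrightarrow> x \<notin> carrier G \<Longrightarrow> a x = 0"
  by (simp add: galg_def)

lemma galg_eqI: "a \<in> galg \<Longrightarrow> b \<in> galg \<Longrightarrow> (\<And>x. x \<in> carrier G \<Longrightarrow> a x = b x) \<Longrightarrow> a = b"
  by (rule ext) (metis galgD)

lemma conv_galg [simp]: "a \<star> b \<in> galg"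
  by (simp add: galg_def conv_def)

lemma point_galg [simp]: "g \<in> carrier G \<Longrightarrow> point g \<in> galg"
  by (auto simp: galg_def point_def)

lemma subspace_galg: "fs.subspace galg"
  by (auto simp: fs.subspace_def galg_def)

lemmas galg_add [simp] = fs.subspace_add[OF subspace_galg]
lemmas galg_diff [simp] = fs.subspace_diff[OF subspace_galg]
lemmas galg_scale [simp] = fs.subspace_scale[OF subspace_galg]
lemmas galg_zero [simp] = fs.subspace_0[OF subspace_galg]
lemmas galg_sum = fs.subspace_sum[OF subspace_galg]

lemma conv_add_left: "(a + b) \<star> c = a \<star> c + b \<star> c"
  by (auto simp: conv_def fun_eq_iff algebra_simps sum.distrib)

lemma conv_add_right: "a \<star> (b + c) = a \<star> b + a \<star> c"
  by (auto simp: conv_def fun_eq_iff algebra_simps sum.distrib)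

lemma conv_diff_left: "(a - b) \<star> c = a \<star> c - b \<star> c"
  by (auto simp: conv_def fun_eq_iff algebra_simps sum_subtractf)

lemma conv_diff_right: "a \<star> (b - c) = a \<star> b - a \<star> c"
  by (auto simp: conv_def fun_eq_iff algebra_simps sum_subtractf)

lemma conv_scale_left: "fscale r a \<star> c = fscale r (a \<star> c)"
  by (auto simp: conv_def fun_eq_iff sum_distrib_left algebra_simps)

lemma conv_scale_right: "a \<star> fscale r c = fscale r (a \<star> c)"
  by (auto simp: conv_def fun_eq_iff sum_distrib_left algebra_simps)

lemma conv_zero_left [simp]: "0 \<star> c = 0"
  by (auto simp: conv_def fun_eq_iff)

lemma conv_zero_right [simp]: "c \<star> 0 = 0"
  by (auto simp: conv_def fun_eq_iff)

lemma conv_sum_left: "(\<Sum>i\<in>S. F i) \<star> c = (\<Sum>i\<in>S. F i \<star> c)"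
  by (induction S rule: infinite_finite_induct)
    (simp_all only: sum.infinite sum.empty sum.insert conv_add_left conv_zero_left not_False_eq_True)

lemma conv_sum_right: "c \<star> (\<Sum>i\<in>S. F i) = (\<Sum>i\<in>S. c \<star> F i)"
  by (induction S rule: infinite_finite_induct)
    (simp_all only: sum.infinite sum.empty sum.insert conv_add_right conv_zero_right not_False_eq_True)

lemma point_conv: "g \<in> carrier G \<Longrightarrow> x \<in> carrier G \<Longrightarrow> (point g \<star> a) x = a (inv g \<otimes> x)"
  by (simp add: conv_def point_def if_distrib[where f = "\<lambda>c. c * _"] cong: if_cong)

lemma conv_point: "g \<in> carrier G \<Longrightarrow> x \<in> carrier G \<Longrightarrow> (a \<star> point g) x = a (x \<otimes> inv g)"
proof -
  assume g: "g \<in> carrier G" and x: "x \<in> carrier G"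
  have eq: "inv h \<otimes> x = g \<longleftrightarrow> h = x \<otimes> inv g" if "h \<in> carrier G" for h
    using g x that by (metis inv_closed inv_solve_left inv_solve_right)
  have "(a \<star> point g) x = (\<Sum>h\<in>carrier G. if h = x \<otimes> inv g then a h else 0)"
    unfolding conv_def point_def if_P[OF x] by (intro sum.cong refl) (simp only: eq split: if_split, simp)
  also have "\<dots> = a (x \<otimes> inv g)"
    using g x by simp
  finally show ?thesis .
qed

lemma conv_assoc: "(a \<star> b) \<star> c = a \<star> (b \<star> c)"
proof (rule galg_eqI)
  fix x assume x: "x \<in> carrier G"
  have "((a \<star> b) \<star> c) x = (\<Sum>g\<in>carrier G. \<Sum>h\<in>carrier G. a h * b (inv h \<otimes> g) * c (inv g \<otimes> x))"
    using x by (simp add: conv_def sum_distrib_right)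
  also have "\<dots> = (\<Sum>h\<in>carrier G. \<Sum>g\<in>carrier G. a h * b (inv h \<otimes> g) * c (inv g \<otimes> x))"
    by (rule sum.swap)
  also have "\<dots> = (\<Sum>h\<in>carrier G. \<Sum>g\<in>carrier G. a h * b g * c (inv (h \<otimes> g) \<otimes> x))"
  proof (rule sum.cong[OF refl])
    fix h assume h: "h \<in> carrier G"
    show "(\<Sum>g\<in>carrier G. a h * b (inv h \<otimes> g) * c (inv g \<otimes> x)) =
      (\<Sum>g\<in>carrier G. a h * b g * c (inv (h \<otimes> g) \<otimes> x))"
      by (subst sum_left_mult[OF h, symmetric]) (simp add: h flip: m_assoc)
  qed
  also have "\<dots> = (a \<star> (b \<star> c)) x"
    using x by (simp add: conv_def sum_distrib_left m_assoc inv_mult_group algebra_simps)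
  finally show "((a \<star> b) \<star> c) x = (a \<star> (b \<star> c)) x" .
qed auto

lemma galg_expand: "a \<in> galg \<Longrightarrow> a = (\<Sum>g\<in>carrier G. fscale (a g) (point g))"
  by (auto simp: fun_eq_iff sum_fun_apply point_def galg_def if_distrib cong: if_cong)

lemma conv_expand: "a \<star> b = (\<Sum>g\<in>carrier G. fscale (a g) (point g \<star> b))"
proof (rule galg_eqI)
  fix x assume x: "x \<in> carrier G"
  show "(a \<star> b) x = (\<Sum>g\<in>carrier G. fscale (a g) (point g \<star> b)) x"
    using x by (simp add: sum_fun_apply point_conv) (simp add: conv_def)
qed (auto intro!: galg_sum)

lemma point_mult: "g \<in> carrier G \<Longrightarrow> h \<in> carrier G \<Longrightarrow> point g \<star> point h = (point (g \<otimes> h) :: 'g \<Rightarrow> 'k::field)"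
  by (rule galg_eqI) (auto simp: point_conv, auto simp: point_def inv_solve_left')

lemma one_conv [simp]: "a \<in> galg \<Longrightarrow> point \<one> \<star> a = a"
  by (rule galg_eqI) (auto simp: point_conv)

lemma conv_one [simp]: "a \<in> galg \<Longrightarrow> a \<star> point \<one> = a"
  by (rule galg_eqI) (auto simp: conv_point)

lemma linear_conv_right: "Vector_Spaces.linear fscale fscale (\<lambda>a. a \<star> b)"
  by unfold_locales (auto simp: conv_add_left conv_scale_left)

lemma central_conv:
  assumes "\<And>g. g \<in> carrier G \<Longrightarrow> point g \<star> f = f \<star> point g" and "f \<in> galg" "a \<in> galg"
  shows "a \<star> f = f \<star> a"
proof -
  have "a \<star> f = (\<Sum>g\<in>carrier G. fscale (a g) (f \<star> point g))"
    by (subst conv_expand) (simp add: assms(1))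
  also have "\<dots> = f \<star> (\<Sum>g\<in>carrier G. fscale (a g) (point g))"
    by (simp add: conv_sum_right conv_scale_right)
  also have "\<dots> = f \<star> a"
    using galg_expand[OF assms(3)] by simp
  finally show ?thesis .
qed

text \<open>As in Maschke's theorem, a linear projection onto \<open>J\<close> is averaged over the group; the right identity
  is the image of \<open>1\<close>.\<close>

lemma left_ideal_right_identity:
  fixes J :: "('g \<Rightarrow> 'k::field_char_0) set"
  assumes J: "fs.subspace J" "J \<subseteq> galg" and inv: "\<And>g a. g \<in> carrier G \<Longrightarrow> a \<in> J \<Longrightarrow> point g \<star> a \<in> J"
  obtains \<iota> where "\<iota> \<in> J" "\<And>a. a \<in> J \<Longrightarrow> a \<star> \<iota> = a"
proof -
  interpret ff: vector_space_pair "fscale :: 'k \<Rightarrow> ('g \<Rightarrow> 'k) \<Rightarrow> 'g \<Rightarrow> 'k" "fscale :: 'k \<Rightarrow> ('g \<Rightarrow> 'k) \<Rightarrow> 'g \<Rightarrow> 'k" ..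
  obtain p where p: "range p \<subseteq> J" "Vector_Spaces.linear fscale fscale p" "\<And>a. a \<in> J \<Longrightarrow> p a = a"
    using ff.linear_exists_left_inverse_on[OF fs.linear_id J(1)] by auto
  then interpret p: Vector_Spaces.linear fscale fscale p by simp
  define P where "P a = fscale (1 / of_nat (card (carrier G))) (\<Sum>h\<in>carrier G. point h \<star> p (point (inv h) \<star> a))" for a
  have PJ: "P a \<in> J" for a
    unfolding P_def using p(1) by (intro fs.subspace_scale J fs.subspace_sum inv) auto
  have P_id: "P a = a" if "a \<in> J" for a
  proof -
    have "P a = fscale (1 / of_nat (card (carrier G))) (\<Sum>h\<in>carrier G. a)"
      unfolding P_def using that J(2)
      by (intro arg_cong[where f = "fscale _"] sum.cong refl) (auto simp: p(3) inv point_mult simp flip: conv_assoc)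
    then show ?thesis using one_closed by (auto simp: fun_eq_iff sum_fun_apply)
  qed
  have P_lin: "P (\<Sum>g\<in>carrier G. fscale (c g) (F g)) = (\<Sum>g\<in>carrier G. fscale (c g) (P (F g)))" for c F
  proof -
    let ?r = "1 / of_nat (card (carrier G)) :: 'k"
    have "P (\<Sum>g\<in>carrier G. fscale (c g) (F g)) = fscale ?r (\<Sum>h\<in>carrier G. \<Sum>g\<in>carrier G.
        fscale (c g) (point h \<star> p (point (inv h) \<star> F g)))"
      unfolding P_def by (simp only: conv_sum_right p.sum conv_scale_right p.scale)
    also have "\<dots> = fscale ?r (\<Sum>g\<in>carrier G. \<Sum>h\<in>carrier G.
        fscale (c g) (point h \<star> p (point (inv h) \<star> F g)))"
      by (subst sum.swap) (rule refl)
    also have "\<dots> = (\<Sum>g\<in>carrier G. fscale (c g) (P (F g)))"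
      unfolding P_def fs.scale_sum_right fs.scale_scale
      by (intro sum.cong refl) (simp only: mult.commute)
    finally show ?thesis .
  qed
  \<comment> \<open>Substituting gh for h in the average moves the factor g out to the left, so
    \<open>P\<close> is determined by its value at the identity.\<close>
  have P_point: "P (point g) = point g \<star> P (point \<one>)" if g: "g \<in> carrier G" for g
  proof -
    have "P (point g) = fscale (1 / of_nat (card (carrier G))) (\<Sum>h\<in>carrier G. point (g \<otimes> h) \<star> p (point (inv (g \<otimes> h)) \<star> point g))"
      unfolding P_def by (subst sum_left_mult[OF g, symmetric]) simp
    also have "\<dots> = point g \<star> P (point \<one>)"
      unfolding P_def using g 
      by (simp add: conv_sum_right conv_scale_right point_mult inv_mult_group m_assoc conv_assoc[symmetric] cong: sum.cong)
    finally show ?thesis .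
  qed
  have "a \<star> P (point \<one>) = a" if a: "a \<in> J" for a
  proof -
    have "a = P a" using P_id a by simp
    also have "\<dots> = P (\<Sum>g\<in>carrier G. fscale (a g) (point g))"
      using a J(2) galg_expand by (metis subsetD)
    also have "\<dots> = a \<star> P (point \<one>)"
      unfolding conv_expand[of a] P_lin by (intro sum.cong refl) (simp add: P_point[symmetric])
    finally show ?thesis by simp
  qed
  then show thesis by (rule that[OF PJ])
qed

text \<open>Right multiplication by \<eta> is an idempotent operator whose diagonal coefficients all
  equal \<open>\<eta> \<one>\<close>. Its trace is |G| times that coefficient, and
  \<open>trace_idempotent\<close> applies.\<close>

lemma idempotent_at_one:
  fixes \<eta> :: "'g \<Rightarrow> 'k::field_char_0"
  assumes "\<eta> \<in> galg" "\<eta> \<star> \<eta> = \<eta>"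
  shows "\<exists>n. of_nat (card (carrier G)) * \<eta> \<one> = of_nat n" and "\<eta> \<one> = 0 \<Longrightarrow> \<eta> = 0"
proof -
  have tr: "(\<Sum>x\<in>carrier G. (point x \<star> \<eta>) x) = of_nat (card (carrier G)) * \<eta> \<one>"
    by (simp add: point_conv)
  show "\<exists>n. of_nat (card (carrier G)) * \<eta> \<one> = of_nat n"
    using trace_idempotent(1)[OF linear_conv_right _ finite_carrier, of \<eta>] tr
    by (simp add: conv_assoc assms(2) galgD[OF conv_galg])
  assume "\<eta> \<one> = 0"
  then have "point \<one> \<star> \<eta> = 0"
    using trace_idempotent(2)[OF linear_conv_right _ finite_carrier, of \<eta> "point \<one>"] tr
    by (simp add: conv_assoc assms(2) galgD[OF conv_galg])
  then show "\<eta> = 0" using assms(1) by simp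
qed

lemma conv_at_one_commute: "(a \<star> b) \<one> = (b \<star> a) \<one>"
proof -
  have "(b \<star> a) \<one> = (\<Sum>g\<in>carrier G. b (inv g) * a (inv (inv g)))"
    by (subst sum_inv[of "\<lambda>g. b g * a (inv g)"]) (simp add: conv_def)
  then show ?thesis by (simp add: conv_def mult.commute)
qed

text \<open>The element \<open>1 - yx\<close> is an idempotent of trace \<open>0\<close>.\<close>

lemma right_inverse_imp_left_inverse:
  fixes x y :: "'g \<Rightarrow> 'k::field_char_0"
  assumes "x \<in> galg" "y \<in> galg" "x \<star> y = point \<one>"
  shows "y \<star> x = point \<one>"
proof -
  let ?z = "point \<one> - y \<star> x"
  have "(y \<star> x) \<star> (y \<star> x) = y \<star> (x \<star> y) \<star> x"
    by (simp only: conv_assoc)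
  then have "?z \<star> ?z = ?z"
    using assms by (simp add: conv_diff_left conv_diff_right)
  moreover have "?z \<one> = 0"
    using conv_at_one_commute[of y x] assms(3) by simp
  ultimately have "?z = 0"
    by (intro idempotent_at_one(2)) auto
  then show ?thesis by simp
qed

end

section \<open>Cyclic modules\<close>

locale finite_group_representation =
  group_representation scale G act
  for scale :: "'k::field_char_0 \<Rightarrow> 'v::ab_group_add \<Rightarrow> 'v"
    and G :: "('g, 'm) monoid_scheme" (structure)
    and act :: "'g \<Rightarrow> 'v \<Rightarrow> 'v" +
  assumes finite_G: "finite (carrier G)"

sublocale finite_group_representation \<subseteq> finite_group G
  using group_hom finite_G by (simp add: finite_group_def finite_group_axioms_def group_hom_def)

context finite_group_representation
begin

lemma act_one [simp]: "act \<one> v = v"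
  using fun_cong[OF id_eq_one, of v] by simp

lemma act_mult: "g \<in> carrier G \<Longrightarrow> h \<in> carrier G \<Longrightarrow> act (g \<otimes> h) v = act g (act h v)"
  using composition_rule by simp

lemma act_inv [simp]: "g \<in> carrier G \<Longrightarrow> act (inv g) (act g v) = v"
  by (metis act_mult act_one inv_closed l_inv)

lemma act_inv' [simp]: "g \<in> carrier G \<Longrightarrow> act g (act (inv g) v) = v"
  by (metis act_mult act_one inv_closed r_inv)

lemma module_hom_act: "g \<in> carrier G \<Longrightarrow> module_hom scale scale (act g)"
  using linear_act by (simp add: Vector_Spaces.linear_def)

lemmas act_add = module_hom.add[OF module_hom_act]
  and act_scale = module_hom.scale[OF module_hom_act]
  and act_diff = module_hom.diff[OF module_hom_act]
  and act_sum = module_hom.sum[OF module_hom_act]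
  and act_zero = module_hom.zero[OF module_hom_act]

definition alg_act :: "('g \<Rightarrow> 'k) \<Rightarrow> 'v \<Rightarrow> 'v" (infixr "\<rhd>" 68) where
  "a \<rhd> v = (\<Sum>g\<in>carrier G. scale (a g) (act g v))"

lemma alg_add_left: "(a + b) \<rhd> v = a \<rhd> v + b \<rhd> v"
  by (simp add: alg_act_def scale_left_distrib sum.distrib)

lemma alg_diff_left: "(a - b) \<rhd> v = a \<rhd> v - b \<rhd> v"
  by (simp add: alg_act_def scale_left_diff_distrib sum_subtractf)

lemma alg_scale_left: "fscale c a \<rhd> v = scale c (a \<rhd> v)"
  by (simp add: alg_act_def scale_sum_right)

lemma alg_zero_left [simp]: "0 \<rhd> v = 0"
  by (simp add: alg_act_def)

lemma alg_sum_left: "(\<Sum>i\<in>S. F i) \<rhd> v = (\<Sum>i\<in>S. F i \<rhd> v)"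
  by (induction S rule: infinite_finite_induct)
    (simp_all only: sum.infinite sum.empty sum.insert alg_add_left alg_zero_left not_False_eq_True)

lemma alg_add_right: "a \<rhd> (v + w) = a \<rhd> v + a \<rhd> w"
  by (simp add: alg_act_def act_add scale_right_distrib sum.distrib)

lemma alg_diff_right: "a \<rhd> (v - w) = a \<rhd> v - a \<rhd> w"
  by (simp add: alg_act_def act_diff scale_right_diff_distrib sum_subtractf)

lemma alg_scale_right: "a \<rhd> scale c v = scale c (a \<rhd> v)"
  by (simp add: alg_act_def act_scale scale_sum_right mult.commute)

lemma alg_zero_right [simp]: "a \<rhd> 0 = 0"
  by (simp add: alg_act_def act_zero)

lemma alg_point [simp]: "g \<in> carrier G \<Longrightarrow> point g \<rhd> v = act g v"
  by (simp add: alg_act_def point_def if_distrib[where f = "\<lambda>c. scale c _"] cong: if_cong)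

lemma alg_conv: "(a \<star> b) \<rhd> v = a \<rhd> b \<rhd> v"
proof -
  have pt: "(point g \<star> b) \<rhd> v = act g (b \<rhd> v)" if g: "g \<in> carrier G" for g
  proof -
    have "(point g \<star> b) \<rhd> v = (\<Sum>x\<in>carrier G. scale (b (inv g \<otimes> x)) (act x v))"
      by (simp add: alg_act_def point_conv g)
    also have "\<dots> = (\<Sum>x\<in>carrier G. scale (b x) (act (g \<otimes> x) v))"
      by (subst sum_left_mult[OF g, symmetric]) (simp add: g m_assoc[symmetric])
    also have "\<dots> = act g (b \<rhd> v)"
      by (simp add: alg_act_def act_sum g act_scale act_mult)
    finally show ?thesis .
  qed
  have "(a \<star> b) \<rhd> v = (\<Sum>g\<in>carrier G. scale (a g) ((point g \<star> b) \<rhd> v))"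
    unfolding conv_expand[of a b] alg_sum_left alg_scale_left ..
  then show ?thesis
    by (simp add: pt alg_act_def[of a])
qed

lemma Gens_iff: "v \<in> Gens \<longleftrightarrow> (\<forall>w. \<exists>a\<in>galg. a \<rhd> v = w)"
proof
  assume v: "v \<in> Gens"
  show "\<forall>w. \<exists>a\<in>galg. a \<rhd> v = w"
  proof
    fix w
    have "w \<in> span (orbit G act v)"
      using v by (simp add: Gens_def)
    then show "\<exists>a\<in>galg. a \<rhd> v = w"
    proof (induction rule: span_induct_alt)
      case base
      show ?case using galg_zero alg_zero_left by blast
    next
      case (step c x y)
      then obtain g a where "g \<in> carrier G" "x = act g v" "a \<in> galg" "a \<rhd> v = y"
        by (auto simp: orbit_def)
      then have "fscale c (point g) + a \<in> galg" "(fscale c (point g) + a) \<rhd> v = scale c x + y"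
        by (simp_all add: alg_add_left alg_scale_left)
      then show ?case by blast
    qed
  qed
next
  assume *: "\<forall>w. \<exists>a\<in>galg. a \<rhd> v = w"
  have "a \<rhd> v \<in> span (orbit G act v)" for a
    unfolding alg_act_def by (intro span_sum span_scale span_base) (auto simp: orbit_def)
  then show "v \<in> Gens"
    using * by (auto simp: Gens_def) metis
qed

lemma act_Gens: "v \<in> Gens \<Longrightarrow> h \<in> carrier G \<Longrightarrow> act h v \<in> Gens"
  unfolding Gens_iff
proof
  fix w assume *: "\<forall>w. \<exists>a\<in>galg. a \<rhd> v = w" and h: "h \<in> carrier G"
  then obtain a where "a \<in> galg" "a \<rhd> v = w" by blast
  then show "\<exists>a\<in>galg. a \<rhd> act h v = w"
    using h by (intro bexI[of _ "a \<star> point (inv h)"]) (auto simp: alg_conv)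
qed

definition ann :: "'v \<Rightarrow> ('g \<Rightarrow> 'k) set" where
  "ann v = {a \<in> galg. a \<rhd> v = 0}"

lemma subspace_ann: "fs.subspace (ann v)"
  by (auto simp: ann_def fs.subspace_def alg_add_left alg_scale_left)

lemma conv_ann: "a \<in> ann v \<Longrightarrow> b \<star> a \<in> ann v"
  by (simp add: ann_def alg_conv)

text \<open>If \<open>v\<close> is a generator, then the module is isomorphic to \<open>kG\<epsilon>\<close>.\<close>

lemma generating_idempotent:
  obtains \<epsilon> where "\<epsilon> \<in> galg" "\<epsilon> \<rhd> v = v" "\<And>a. a \<in> galg \<Longrightarrow> a \<star> \<epsilon> = 0 \<longleftrightarrow> a \<in> ann v"
proof -
  obtain \<iota> where i: "\<iota> \<in> ann v" "\<And>a. a \<in> ann v \<Longrightarrow> a \<star> \<iota> = a"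
    using left_ideal_right_identity[OF subspace_ann, of v] conv_ann by (auto simp: ann_def)
  have ig: "\<iota> \<in> galg" using i by (simp add: ann_def)
  show thesis
  proof (rule that[of "point \<one> - \<iota>"])
    show "(point \<one> - \<iota>) \<rhd> v = v"
      using i by (simp add: alg_diff_left ann_def)
    fix a :: "'g \<Rightarrow> 'k" assume a: "a \<in> galg"
    have "a \<star> (point \<one> - \<iota>) = a - a \<star> \<iota>" using a by (simp add: conv_diff_right)
    then show "a \<star> (point \<one> - \<iota>) = 0 \<longleftrightarrow> a \<in> ann v"
      using i conv_ann[OF i(1), of a] by auto
  qed (use ig in simp)
qed

text \<open>The element 1 - \<epsilon> annihilates v, so its product with \<epsilon> is
  zero.\<close>

lemma generating_idempotent_idem:
  assumes "\<epsilon> \<in> galg" "\<epsilon> \<rhd> v = v" "\<And>a. a \<in> galg \<Longrightarrow> a \<star> \<epsilon> = 0 \<longleftrightarrow> a \<in> ann v"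
  shows "\<epsilon> \<star> \<epsilon> = \<epsilon>"
proof -
  have "(point \<one> - \<epsilon>) \<star> \<epsilon> = 0"
    using assms by (simp add: ann_def alg_diff_left)
  then show ?thesis using assms(1) by (simp add: conv_diff_left)
qed

text \<open>The module is isomorphic to kG\<epsilon>, so the trace of g is that of the operator
  sending a to ga\<epsilon> on kG. The summand for x is the diagonal coefficient of this operator at
  x.\<close>

lemma character_generating_idempotent:
  assumes v: "v \<in> Gens" and \<epsilon>: "\<epsilon> \<in> galg" "\<And>a. a \<in> galg \<Longrightarrow> a \<star> \<epsilon> = 0 \<longleftrightarrow> a \<in> ann v"
    and e: "\<epsilon> \<rhd> v = v" and g: "g \<in> carrier G"
  shows "character g = (\<Sum>x\<in>carrier G. \<epsilon> (inv x \<otimes> inv g \<otimes> x))"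
proof -
  define B where "B = (SOME B. independent B \<and> span B = UNIV)"
  have "\<exists>B. independent B \<and> span B = UNIV"
    using maximal_independent_subset[of UNIV] by (metis top.extremum_uniqueI)
  then have B: "independent B" "span B = UNIV"
    unfolding B_def by (rule someI2_ex, simp)+
  have "finite (orbit G act v)"
    unfolding orbit_def by simp
  then have finB: "finite B"
    using independent_span_bound B(1) v by (auto simp: Gens_def)
  obtain \<alpha> where \<alpha>: "\<And>b. \<alpha> b \<in> galg" "\<And>b. \<alpha> b \<rhd> v = b"
    using v unfolding Gens_iff by metis
  \<comment> \<open>The preimages \<open>\<alpha> b\<close> are arbitrary. Multiplied by \<epsilon>
    they become the unique lifts inside kG\<epsilon>, so that the linear relation \<open>key\<close>
    holds exactly and not just modulo \<open>ann v\<close>.\<close>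
  define \<sigma> where "\<sigma> b = \<alpha> b \<star> \<epsilon>" for b
  have \<sigma>: "\<sigma> b \<rhd> v = b" for b
    by (simp add: \<sigma>_def alg_conv \<alpha> e)
  have key: "(\<Sum>b\<in>B. fscale (representation B (act x v) b) (\<sigma> b)) = point x \<star> \<epsilon>" if x: "x \<in> carrier G" for x
  proof -
    let ?a = "\<Sum>b\<in>B. fscale (representation B (act x v) b) (\<alpha> b)"
    have "?a \<rhd> v = act x v"
      using sum_representation_eq[OF B(1), of "act x v" B] B finB
      by (simp add: alg_sum_left alg_scale_left \<alpha>)
    moreover have "?a \<in> galg"
      by (intro galg_sum galg_scale \<alpha>)
    ultimately have "(?a - point x) \<star> \<epsilon> = 0"
      using x by (subst \<epsilon>) (auto simp: ann_def alg_diff_left)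
    then show ?thesis
      by (simp add: conv_diff_left conv_sum_left conv_scale_left \<sigma>_def)
  qed
  have rep: "representation B (act g b) b = (\<Sum>x\<in>carrier G. representation B (act x v) b * (point g \<star> \<sigma> b) x)" for b
  proof -
    have "act g b = (point g \<star> \<sigma> b) \<rhd> v"
      using g by (simp add: alg_conv \<sigma>)
    then have "representation B (act g b) b = representation B (\<Sum>x\<in>carrier G. scale ((point g \<star> \<sigma> b) x) (act x v)) b"
      by (simp add: alg_act_def)
    also have "\<dots> = (\<Sum>x\<in>carrier G. representation B (act x v) b * (point g \<star> \<sigma> b) x)"
      using B by (simp add: representation_sum representation_scale mult.commute)
    finally show ?thesis .
  qed
  have "character g = (\<Sum>b\<in>B. representation B (act g b) b)"
    by (simp add: character_def lin_trace_def B_def Let_def)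
  also have "\<dots> = (\<Sum>x\<in>carrier G. \<Sum>b\<in>B. representation B (act x v) b * (point g \<star> \<sigma> b) x)"
    unfolding rep by (rule sum.swap)
  also have "\<dots> = (\<Sum>x\<in>carrier G. (point g \<star> (\<Sum>b\<in>B. fscale (representation B (act x v) b) (\<sigma> b))) x)"
    by (simp only: conv_sum_right conv_scale_right sum_fun_apply fscale_apply)
  also have "\<dots> = (\<Sum>x\<in>carrier G. \<epsilon> (inv x \<otimes> inv g \<otimes> x))"
  proof (rule sum.cong[OF refl])
    fix x assume x: "x \<in> carrier G"
    show "(point g \<star> (\<Sum>b\<in>B. fscale (representation B (act x v) b) (\<sigma> b))) x = \<epsilon> (inv x \<otimes> inv g \<otimes> x)"
      unfolding key[OF x] using x g by (simp add: point_conv m_assoc)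
  qed
  finally show ?thesis .
qed

text \<open>The elements of \<open>ann (act h v)\<close> are the products of those of
  \<open>ann v\<close> with \<open>point (inv h)\<close> on the right, so this is the two-sided
  ideal generated by \<open>ann v\<close>.\<close>

definition ann_ideal :: "'v \<Rightarrow> ('g \<Rightarrow> 'k) set" where
  "ann_ideal v = fs.span (\<Union>h\<in>carrier G. ann (act h v))"

lemma ann_ideal_galg: "ann_ideal v \<subseteq> galg"
  unfolding ann_ideal_def by (rule fs.span_minimal[OF _ subspace_galg]) (auto simp: ann_def)

lemma subspace_ann_ideal: "fs.subspace (ann_ideal v)"
  unfolding ann_ideal_def by (rule fs.subspace_span)

lemma ann_subset_ann_ideal: "h \<in> carrier G \<Longrightarrow> ann (act h v) \<subseteq> ann_ideal v"
  unfolding ann_ideal_def by (auto intro!: fs.span_base)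

text \<open>With \<open>T\<close> the identity this is the induction rule for containment of the
  ideal in a subspace; with \<open>T\<close> a multiplication or a permutation it yields invariance
  of the ideal.\<close>

lemma ann_ideal_mapI:
  assumes "Vector_Spaces.linear fscale fscale T" "fs.subspace J"
    and "\<And>h a. h \<in> carrier G \<Longrightarrow> a \<in> ann (act h v) \<Longrightarrow> T a \<in> J" "a \<in> ann_ideal v"
  shows "T a \<in> J"
proof -
  interpret T: Vector_Spaces.linear fscale fscale T by fact
  from assms(4)[unfolded ann_ideal_def] show ?thesis
  proof (induction rule: fs.span_induct_alt)
    case base
    then show ?case using fs.subspace_0[OF assms(2)] by (simp only: T.zero)
  next
    case (step c x y)
    then show ?case
      using assms(2,3) by (auto simp only: T.add T.scale intro!: fs.subspace_add fs.subspace_scale)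
  qed
qed

lemma linear_conv_left: "Vector_Spaces.linear fscale fscale (\<lambda>a. b \<star> a)"
  by unfold_locales (auto simp: conv_add_right conv_scale_right)

lemma ann_ideal_left: "a \<in> ann_ideal v \<Longrightarrow> b \<star> a \<in> ann_ideal v"
  by (rule ann_ideal_mapI[OF linear_conv_left subspace_ann_ideal])
    (use ann_subset_ann_ideal conv_ann in blast)+

lemma ann_translate: "a \<in> ann (act h v) \<Longrightarrow> g \<in> carrier G \<Longrightarrow> h \<in> carrier G \<Longrightarrow> a \<star> point g \<in> ann (act (inv g \<otimes> h) v)"
  by (simp add: ann_def alg_conv act_mult)

lemma ann_ideal_right:
  assumes "a \<in> ann_ideal v" "g \<in> carrier G"
  shows "a \<star> point g \<in> ann_ideal v"
proof (rule ann_ideal_mapI[OF linear_conv_right subspace_ann_ideal _ assms(1)])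
  fix h a assume "h \<in> carrier G" "a \<in> ann (act h v)"
  then show "a \<star> point g \<in> ann_ideal v"
    using ann_translate[of a h v g] ann_subset_ann_ideal[of "inv g \<otimes> h" v] assms(2) by auto
qed

text \<open>A right identity of the ideal is averaged over its conjugates. Each conjugate is again a
  right identity, because the ideal is stable under right multiplication, and the average commutes
  with every group element.\<close>

lemma ann_ideal_central_idempotent:
  obtains f where "f \<in> ann_ideal v" "\<And>g. g \<in> carrier G \<Longrightarrow> point g \<star> f = f \<star> point g"
    "\<And>a. a \<in> ann_ideal v \<Longrightarrow> a \<star> f = a"
proof -
  obtain \<iota> where i: "\<iota> \<in> ann_ideal v" "\<And>a. a \<in> ann_ideal v \<Longrightarrow> a \<star> \<iota> = a"
    using left_ideal_right_identity[OF subspace_ann_ideal ann_ideal_galg] ann_ideal_left by metis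
  define f where "f = fscale (1 / of_nat (card (carrier G))) (\<Sum>x\<in>carrier G. point x \<star> (\<iota> \<star> point (inv x)))"
  show thesis
  proof (rule that[of f])
    show "f \<in> ann_ideal v"
      unfolding f_def
      by (intro fs.subspace_scale subspace_ann_ideal fs.subspace_sum ann_ideal_left ann_ideal_right i) auto
    fix g assume g: "g \<in> carrier G"
    have "point g \<star> f = fscale (1 / of_nat (card (carrier G))) (\<Sum>x\<in>carrier G. point (g \<otimes> x) \<star> (\<iota> \<star> point (inv (g \<otimes> x)))) \<star> point g"
      unfolding f_def conv_scale_right conv_sum_right conv_scale_left conv_sum_left
      using g by (intro arg_cong[where f = "fscale _"] sum.cong refl)
        (simp add: conv_assoc[symmetric] point_mult, simp add: conv_assoc point_mult inv_mult_group m_assoc)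
    also have "(\<Sum>x\<in>carrier G. point (g \<otimes> x) \<star> (\<iota> \<star> point (inv (g \<otimes> x)))) = (\<Sum>x\<in>carrier G. point x \<star> (\<iota> \<star> point (inv x)))"
      by (rule sum_left_mult[OF g])
    finally show "point g \<star> f = f \<star> point g" by (simp only: f_def)
  next
    fix a assume a: "a \<in> ann_ideal v"
    have "a \<star> (point x \<star> (\<iota> \<star> point (inv x))) = a" if x: "x \<in> carrier G" for x
    proof -
      have "a \<star> (point x \<star> (\<iota> \<star> point (inv x))) = (a \<star> point x) \<star> \<iota> \<star> point (inv x)"
        by (simp add: conv_assoc)
      also have "\<dots> = a"
        unfolding i(2)[OF ann_ideal_right[OF a x]] using subsetD[OF ann_ideal_galg a] x
          by (simp add: conv_assoc point_mult)
      finally show ?thesis .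
    qed
    then have "a \<star> f = fscale (1 / of_nat (card (carrier G))) (\<Sum>x\<in>carrier G. a)"
      by (simp add: f_def conv_scale_right conv_sum_right)
    then show "a \<star> f = a"
      using one_closed by (auto simp: fun_eq_iff sum_fun_apply)
  qed
qed

end

section \<open>Symmetries of cyclic modules\<close>

text \<open>Composition with the inverse is pushforward: for bijective \<pi> this is the linear
  extension of the map sending \<open>point g\<close> to \<open>point (\<pi> g)\<close>.\<close>

definition perm_alg :: "('g \<Rightarrow> 'g) \<Rightarrow> ('g \<Rightarrow> 'k) \<Rightarrow> 'g \<Rightarrow> 'k" where
  "perm_alg \<pi> a = (\<lambda>x. a (inv_into UNIV \<pi> x))"

lemma linear_perm_alg: "Vector_Spaces.linear fscale fscale (perm_alg \<pi>)"
  by unfold_locales (auto simp: perm_alg_def fun_eq_iff)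

lemma perm_alg_point: "bij \<pi> \<Longrightarrow> perm_alg \<pi> (point g) = point (\<pi> g)"
  by (rule ext) (metis bij_inv_eq_iff perm_alg_def point_def)

lemma perm_alg_comp: "bij \<sigma> \<Longrightarrow> bij \<tau> \<Longrightarrow> perm_alg (\<sigma> \<circ> \<tau>) a = perm_alg \<sigma> (perm_alg \<tau> a)"
  by (auto simp: perm_alg_def o_inv_distrib)

lemma perm_alg_inv: "bij \<sigma> \<Longrightarrow> perm_alg (inv_into UNIV \<sigma>) (perm_alg \<sigma> a) = a"
  by (simp add: perm_alg_def inv_inv_eq bij_is_inj)

lemma perm_alg_inv': "bij \<sigma> \<Longrightarrow> perm_alg \<sigma> (perm_alg (inv_into UNIV \<sigma>) a) = a"
  by (simp add: perm_alg_def inv_inv_eq bij_is_surj surj_f_inv_f)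

context finite_group
begin

lemma perm_alg_galg: "\<pi> permutes carrier G \<Longrightarrow> a \<in> galg \<Longrightarrow> perm_alg \<pi> a \<in> galg"
  unfolding galg_def perm_alg_def using permutes_not_in[OF permutes_inv] by fastforce

text \<open>Left translation is extended by the identity off the carrier, as \<open>permutes\<close>
  requires.\<close>

definition transl :: "'g \<Rightarrow> 'g \<Rightarrow> 'g" where
  "transl h = (\<lambda>x. if x \<in> carrier G then h \<otimes> x else x)"

lemma transl_permutes: "h \<in> carrier G \<Longrightarrow> transl h permutes carrier G"
  by (rule bij_imp_permutes, rule bij_betwI[where g = "transl (inv h)"])
    (auto simp: transl_def m_assoc[symmetric])

lemma inv_transl: "h \<in> carrier G \<Longrightarrow> inv_into UNIV (transl h) = transl (inv h)"
  by (rule inv_unique_comp) (auto simp: transl_def fun_eq_iff m_assoc[symmetric])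

lemma perm_alg_transl: "h \<in> carrier G \<Longrightarrow> a \<in> galg \<Longrightarrow> perm_alg (transl h) a = point h \<star> a"
  by (rule galg_eqI) (simp_all add: perm_alg_galg transl_permutes point_conv, simp add: perm_alg_def inv_transl, simp add: transl_def)

end

section \<open>Linear maps realizing a permutation on the orbit of one vector\<close>

context finite_group_representation
begin

lemma alg_sum_right: "a \<rhd> (\<Sum>i\<in>S. F i) = (\<Sum>i\<in>S. a \<rhd> F i)"
  by (induction S rule: infinite_finite_induct) (auto simp: alg_add_right)

lemma perm_alg_act:
  assumes "\<pi> permutes carrier G"
  shows "perm_alg \<pi> a \<rhd> v = (\<Sum>g\<in>carrier G. scale (a g) (act (\<pi> g) v))"
  unfolding alg_act_def
  by (subst sum.permute[OF assms]) (simp add: perm_alg_def permutes_inverses[OF assms])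

lemma Sym_vecD:
  assumes "\<pi> \<in> Sym_vec v"
  obtains A where "A \<in> GL" "\<And>a. perm_alg \<pi> a \<rhd> v = A (a \<rhd> v)"
proof -
  obtain A where p: "\<pi> permutes carrier G" and A: "A \<in> GL" "\<And>g. g \<in> carrier G \<Longrightarrow> A (act g v) = act (\<pi> g) v"
    using assms by (auto simp: Sym_vec_def)
  interpret A: Vector_Spaces.linear scale scale A using A by (simp add: GL_def)
  have "perm_alg \<pi> a \<rhd> v = A (a \<rhd> v)" for a
    unfolding perm_alg_act[OF p] by (simp add: alg_act_def A.sum A.scale A(2))
  then show thesis using A(1) that by blast
qed

lemma GL_inv: "A \<in> GL \<Longrightarrow> inv_into UNIV A \<in> GL"
  unfolding GL_def
proof safe
  assume A: "Vector_Spaces.linear scale scale A" "bij A"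
  interpret A: Vector_Spaces.linear scale scale A by fact
  show "bij (inv_into UNIV A)" using A by (simp add: bij_imp_bij_inv)
  show "Vector_Spaces.linear scale scale (inv_into UNIV A)"
    by unfold_locales (metis A.add A.scale A(2) bij_inv_eq_iff)+
qed

lemma GL_comp: "A \<in> GL \<Longrightarrow> B \<in> GL \<Longrightarrow> A \<circ> B \<in> GL"
  by (auto simp: GL_def bij_comp intro: Vector_Spaces.linear_compose[of scale scale _ scale])

lemma GL_act: "g \<in> carrier G \<Longrightarrow> act g \<in> GL"
  by (auto simp: GL_def linear_act intro!: bij_betw_byWitness[where f' = "act (inv g)"])

lemma Sym_vec_inv:
  assumes "\<pi> \<in> Sym_vec v"
  shows "inv_into UNIV \<pi> \<in> Sym_vec v"
proof -
  obtain A where p: "\<pi> permutes carrier G" and A: "A \<in> GL" "\<And>g. g \<in> carrier G \<Longrightarrow> A (act g v) = act (\<pi> g) v"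
    using assms by (auto simp: Sym_vec_def)
  have "inv_into UNIV A (act g v) = act (inv_into UNIV \<pi> g) v" if g: "g \<in> carrier G" for g
  proof -
    have "inv_into UNIV \<pi> g \<in> carrier G"
      using g p by (simp add: permutes_in_image permutes_inv)
    from A(2)[OF this] show ?thesis
      using A(1) permutes_inverses(1)[OF p] by (metis (no_types, lifting) GL_def bij_inv_eq_iff mem_Collect_eq)
  qed
  with p GL_inv[OF A(1)] show ?thesis
    by (auto simp: Sym_vec_def permutes_inv)
qed

lemma Sym_vec_comp:
  assumes "\<sigma> \<in> Sym_vec v" "\<tau> \<in> Sym_vec v"
  shows "\<sigma> \<circ> \<tau> \<in> Sym_vec v"
proof -
  obtain A B where "\<sigma> permutes carrier G" "\<tau> permutes carrier G" "A \<in> GL" "B \<in> GL"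
    "\<And>g. g \<in> carrier G \<Longrightarrow> A (act g v) = act (\<sigma> g) v" "\<And>g. g \<in> carrier G \<Longrightarrow> B (act g v) = act (\<tau> g) v"
    using assms by (auto simp: Sym_vec_def)
  then show ?thesis
    by (auto simp: Sym_vec_def permutes_compose permutes_in_image intro!: bexI[of _ "A \<circ> B"] GL_comp)
qed

lemma Sym_vec_transl: "h \<in> carrier G \<Longrightarrow> transl h \<in> Sym_vec v"
  unfolding Sym_vec_def using transl_permutes[of h] GL_act[of h] by (auto simp: act_mult transl_def intro!: bexI[of _ "act h"])

text \<open>Compatibility of \<open>T\<close> with \<open>v\<close> alone only controls \<open>T x \<rhd> v\<close>. The formula for \<open>T x \<rhd> w\<close>
  comes from the generators \<open>v + w\<close> and \<open>v - w\<close>.\<close>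

lemma compatible_on_ann:
  assumes T: "\<And>a. a \<in> galg \<Longrightarrow> T a \<in> galg"
      "\<And>u. u \<in> Gens \<Longrightarrow> \<exists>A. Vector_Spaces.linear scale scale A \<and> (\<forall>a\<in>galg. T a \<rhd> u = A (a \<rhd> u))"
    and v: "v \<in> Gens" and A: "Vector_Spaces.linear scale scale A" "\<And>a. a \<in> galg \<Longrightarrow> T a \<rhd> v = A (a \<rhd> v)"
    and x: "x \<in> ann v"
  shows "T x \<rhd> w = A (x \<rhd> w)"
proof -
  interpret A: Vector_Spaces.linear scale scale A by fact
  obtain \<epsilon> where \<epsilon>: "\<epsilon> \<in> galg" "\<epsilon> \<rhd> v = v" "\<And>a. a \<in> galg \<Longrightarrow> a \<star> \<epsilon> = 0 \<longleftrightarrow> a \<in> ann v"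
    using generating_idempotent by metis
  have xg: "x \<in> galg" and xv: "x \<rhd> v = 0" using x by (auto simp: ann_def)
  have Txv: "T x \<rhd> v = 0" using A(2)[OF xg] xv by (simp add: A.zero)
  \<comment> \<open>Only the part of w killed by \<epsilon> is kept. An element b\<epsilon> then
    acts on v as b does and kills \<open>w2\<close>, so both \<open>v + w2\<close> and
    \<open>v - w2\<close> generate the module.\<close>
  define w2 where "w2 = w - \<epsilon> \<rhd> w"
  have \<epsilon>w2: "\<epsilon> \<rhd> w2 = 0"
    using generating_idempotent_idem[OF \<epsilon>(1,2,3)]
    by (simp add: w2_def alg_diff_right alg_conv[symmetric])
  have lift: "\<exists>y\<in>galg. y \<rhd> v = u \<and> y \<rhd> w2 = 0" for u
  proof -
    obtain b where "b \<in> galg" "b \<rhd> v = u" using v unfolding Gens_iff by blast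
    then show ?thesis
      by (intro bexI[of _ "b \<star> \<epsilon>"]) (simp_all add: alg_conv \<epsilon>(2) \<epsilon>w2)
  qed
  have "v + w2 \<in> Gens" "v - w2 \<in> Gens"
    unfolding Gens_iff using lift by (auto simp: alg_add_right alg_diff_right) (metis add_0_right diff_zero)+
  from T(2)[OF this(1)] T(2)[OF this(2)] obtain P M where
    P: "Vector_Spaces.linear scale scale P" "\<And>a. a \<in> galg \<Longrightarrow> T a \<rhd> (v + w2) = P (a \<rhd> (v + w2))" and
    M: "Vector_Spaces.linear scale scale M" "\<And>a. a \<in> galg \<Longrightarrow> T a \<rhd> (v - w2) = M (a \<rhd> (v - w2))"
    by metis
  interpret P: Vector_Spaces.linear scale scale P by fact
  interpret M: Vector_Spaces.linear scale scale M by fact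
  \<comment> \<open>Both generators are sent by \<open>y\<close> to \<open>x \<rhd> w2\<close>,
    which is also the image of \<open>v + w2\<close> under x and, up to sign, that of
    \<open>v - w2\<close>. Evaluating \<open>P\<close> and \<open>M\<close> at this vector in two
    ways gives the equations 2 to 5.\<close>
  obtain y where y: "y \<in> galg" "y \<rhd> v = x \<rhd> w2" "y \<rhd> w2 = 0" using lift by blast
  have 1: "T y \<rhd> v = A (x \<rhd> w2)" using A(2)[OF y(1)] y by simp
  have 2: "P (x \<rhd> w2) = A (x \<rhd> w2) + T y \<rhd> w2"
    using P(2)[OF y(1)] by (simp add: alg_add_right y 1)
  have 3: "P (x \<rhd> w2) = T x \<rhd> w2"
    using P(2)[OF xg] by (simp add: alg_add_right xv Txv)
  have 4: "M (x \<rhd> w2) = A (x \<rhd> w2) - T y \<rhd> w2"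
    using M(2)[OF y(1)] by (simp add: alg_diff_right y 1)
  have 5: "M (x \<rhd> w2) = T x \<rhd> w2"
    using M(2)[OF xg] by (simp add: alg_diff_right xv Txv M.neg)
  \<comment> \<open>The two expressions for \<open>T x \<rhd> w2\<close> differ only in the sign of
    this term.\<close>
  have "T y \<rhd> w2 + T y \<rhd> w2 = 0"
  proof -
    have "A (x \<rhd> w2) + T y \<rhd> w2 = A (x \<rhd> w2) + - (T y \<rhd> w2)"
      using 2 3 4 5 by simp
    then have "T y \<rhd> w2 = - (T y \<rhd> w2)" by (rule add_left_imp_eq)
    then show ?thesis by (simp only: eq_neg_iff_add_eq_0)
  qed
  then have "scale 2 (T y \<rhd> w2) = 0"
    by (metis one_add_one scale_left_distrib scale_one)
  then have "T y \<rhd> w2 = 0" by simp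
  then have 6: "T x \<rhd> w2 = A (x \<rhd> w2)" using 2 3 by simp
  \<comment> \<open>On the discarded component \<open>\<epsilon> \<rhd> w\<close> both sides vanish,
    because x and \<open>T x\<close> annihilate v and hence give 0 when multiplied by
    \<epsilon>.\<close>
  have "T x \<star> \<epsilon> = 0" using \<epsilon>(3)[OF T(1)[OF xg]] T(1)[OF xg] Txv by (simp add: ann_def)
  moreover have "x \<star> \<epsilon> = 0" using \<epsilon>(3) xg x by simp
  ultimately have 7: "T x \<rhd> \<epsilon> \<rhd> w = 0" "x \<rhd> \<epsilon> \<rhd> w = 0"
    by (simp_all add: alg_conv[symmetric])
  show ?thesis using 6 7 by (simp add: w2_def alg_diff_right)
qed

end

text \<open>The element \<open>f\<close> cuts out the part of the module on which a symmetry must act as a group element;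
  the ideal part is \<open>(1 - f)kG\<close>.\<close>

locale annihilator_idempotent = finite_group_representation +
  fixes v0 :: 'b and f :: "'c \<Rightarrow> 'a"
  assumes v0: "v0 \<in> Gens"
    and f_ideal: "f \<in> ann_ideal v0"
    and f_central: "g \<in> carrier G \<Longrightarrow> point g \<star> f = f \<star> point g"
    and f_right: "a \<in> ann_ideal v0 \<Longrightarrow> a \<star> f = a"
begin

lemma f_galg [simp]: "f \<in> galg"
  using f_ideal ann_ideal_galg by blast

lemma f_commute: "a \<in> galg \<Longrightarrow> a \<star> f = f \<star> a"
  by (rule central_conv[OF f_central]) auto

text \<open>Elements of \<open>ann (act h v0)\<close> are covered by
  \<open>compatible_on_ann\<close>, and right translation carries the other annihilators into this
  one. Being the action of a group algebra element, the composite of a with A commutes with all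
  module endomorphisms.\<close>

lemma ann_ideal_linear_image:
  assumes T: "\<And>a. a \<in> galg \<Longrightarrow> T a \<in> galg"
      "\<And>u. u \<in> Gens \<Longrightarrow> \<exists>A. Vector_Spaces.linear scale scale A \<and> (\<forall>a\<in>galg. T a \<rhd> u = A (a \<rhd> u))"
    and h: "h \<in> carrier G" and A: "Vector_Spaces.linear scale scale A"
      "\<And>a. a \<in> galg \<Longrightarrow> T a \<rhd> act h v0 = A (a \<rhd> act h v0)"
    and a: "a \<in> ann_ideal v0"
  shows "\<exists>c\<in>galg. \<forall>u. A (a \<rhd> u) = c \<rhd> u"
proof -
  interpret A: Vector_Spaces.linear scale scale A by fact
  let ?J = "{a. \<exists>c\<in>galg. \<forall>u. A (a \<rhd> u) = c \<rhd> u}"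
  have "fs.subspace ?J"
  proof (rule fs.subspaceI)
    have "\<forall>u. A (0 \<rhd> u) = 0 \<rhd> u" by (simp only: alg_zero_left A.zero simp_thms)
    then show "0 \<in> ?J" using galg_zero by blast
  next
    fix x y assume "x \<in> ?J" "y \<in> ?J"
    then obtain c d where "c \<in> galg" "\<forall>u. A (x \<rhd> u) = c \<rhd> u" "d \<in> galg" "\<forall>u. A (y \<rhd> u) = d \<rhd> u"
      by blast
    then have "c + d \<in> galg" "\<forall>u. A ((x + y) \<rhd> u) = (c + d) \<rhd> u"
      by (simp_all add: A.add alg_add_left)
    then show "x + y \<in> ?J" by blast
  next
    fix r x assume "x \<in> ?J"
    then obtain c where "c \<in> galg" "\<forall>u. A (x \<rhd> u) = c \<rhd> u" by blast
    then have "fscale r c \<in> galg" "\<forall>u. A (fscale r x \<rhd> u) = fscale r c \<rhd> u"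
      by (simp_all add: A.scale alg_scale_left)
    then show "fscale r x \<in> ?J" by blast
  qed
  moreover have "a \<in> ?J" if k: "k \<in> carrier G" and a: "a \<in> ann (act k v0)" for a k
  proof -
    let ?g = "k \<otimes> inv h"
    have g: "?g \<in> carrier G" using h k by simp
    have "inv ?g \<otimes> k = h" using h k by (simp add: inv_mult_group m_assoc)
    then have ann: "a \<star> point ?g \<in> ann (act h v0)"
      using ann_translate[OF a g k] by simp
    have "A (a \<rhd> u) = (T (a \<star> point ?g) \<star> point (inv ?g)) \<rhd> u" for u
    proof -
      have "A (a \<rhd> u) = A ((a \<star> point ?g) \<rhd> act (inv ?g) u)"
        using g by (simp add: alg_conv)
      also have "\<dots> = T (a \<star> point ?g) \<rhd> act (inv ?g) u"
        by (rule compatible_on_ann[where T = T and A = A, OF T act_Gens[OF v0 h] A ann, symmetric])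
      finally show ?thesis using g by (simp add: alg_conv)
    qed
    then show ?thesis using conv_galg by blast
  qed
  ultimately show ?thesis
    using ann_ideal_mapI[OF fs.linear_id _ _ a, of ?J] by simp
qed

text \<open>The hypothesis on z says that some module endomorphism sends \<open>act h v0\<close> to
  z. The composite of f with A is the action of some c; it agrees with f at \<open>act h v0\<close>,
  hence also at z.\<close>

lemma fixes_f_part:
  assumes T: "\<And>a. a \<in> galg \<Longrightarrow> T a \<in> galg"
      "\<And>u. u \<in> Gens \<Longrightarrow> \<exists>A. Vector_Spaces.linear scale scale A \<and> (\<forall>a\<in>galg. T a \<rhd> u = A (a \<rhd> u))"
    and Tf: "T f = f"
    and h: "h \<in> carrier G" and A: "Vector_Spaces.linear scale scale A"
      "\<And>a. a \<in> galg \<Longrightarrow> T a \<rhd> act h v0 = A (a \<rhd> act h v0)"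
    and z: "ann (act h v0) \<subseteq> ann z"
  shows "A (f \<rhd> z) = f \<rhd> z"
proof -
  obtain c where c: "c \<in> galg" "\<And>u. A (f \<rhd> u) = c \<rhd> u"
    using ann_ideal_linear_image[OF T h A f_ideal] by blast
  have "c \<rhd> act h v0 = f \<rhd> act h v0"
    using c(2) A(2)[of f] Tf by simp
  then have "c - f \<in> ann (act h v0)"
    using c by (simp add: ann_def alg_diff_left)
  then have "c - f \<in> ann z" using z by blast
  then show ?thesis using c(2) by (simp add: ann_def alg_diff_left)
qed

text \<open>For v = \<open>act h v0\<close> and w = gv the claim amounts to A(fw) = fw. In general w
  is not the image of v under a module endomorphism, so \<open>fixes_f_part\<close> does not apply
  to it directly.\<close>

lemma compatible_acts_as_group:
  assumes T: "\<And>a. a \<in> galg \<Longrightarrow> T a \<in> galg"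
      "\<And>u. u \<in> Gens \<Longrightarrow> \<exists>A. Vector_Spaces.linear scale scale A \<and> (\<forall>a\<in>galg. T a \<rhd> u = A (a \<rhd> u))"
    and T1: "T (point \<one>) = point \<one>" and Tf: "\<And>a. a \<in> galg \<Longrightarrow> T (a \<star> f) = T a \<star> f"
    and h: "h \<in> carrier G" and g: "g \<in> carrier G"
  shows "T (point g) \<rhd> f \<rhd> act h v0 = act g (f \<rhd> act h v0)"
proof -
  let ?v = "act h v0" and ?w = "act (g \<otimes> h) v0"
  have gh: "g \<otimes> h \<in> carrier G" using g h by simp
  have Tff: "T f = f" using Tf[of "point \<one>"] T1 by simp
  obtain A where A: "Vector_Spaces.linear scale scale A" "\<And>a. a \<in> galg \<Longrightarrow> T a \<rhd> ?v = A (a \<rhd> ?v)"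
    using T(2)[OF act_Gens[OF v0 h]] by blast
  obtain A' where A': "Vector_Spaces.linear scale scale A'" "\<And>a. a \<in> galg \<Longrightarrow> T a \<rhd> ?w = A' (a \<rhd> ?w)"
    using T(2)[OF act_Gens[OF v0 gh]] by blast
  interpret A: Vector_Spaces.linear scale scale A by fact
  define J where "J = {a + b | a b. a \<in> ann ?v \<and> b \<in> ann ?w}"
  have J: "fs.subspace J" "J \<subseteq> galg"
    unfolding J_def using fs.subspace_sums[OF subspace_ann subspace_ann] by (auto simp: ann_def)
  have J_left: "point x \<star> c \<in> J" if "x \<in> carrier G" "c \<in> J" for c x
  proof -
    from that(2) obtain a b where "c = a + b" "a \<in> ann ?v" "b \<in> ann ?w"
      unfolding J_def mem_Collect_eq by (elim exE conjE)
    then have "point x \<star> c = point x \<star> a + point x \<star> b" "point x \<star> a \<in> ann ?v" "point x \<star> b \<in> ann ?w"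
      by (simp_all only: conv_add_right conv_ann)
    then show ?thesis unfolding J_def by blast
  qed
  obtain \<iota> where \<iota>: "\<iota> \<in> J" "\<And>a. a \<in> J \<Longrightarrow> a \<star> \<iota> = a"
    by (rule left_ideal_right_identity[OF J J_left]) (assumption | rule that)+
  have sub: "a \<in> J" if "a \<in> ann ?v \<or> a \<in> ann ?w" for a
  proof -
    have "a + 0 \<in> J \<or> 0 + a \<in> J"
      using that fs.subspace_0[OF subspace_ann] unfolding J_def by blast
    then show ?thesis by simp
  qed
  obtain a b where ab: "\<iota> = a + b" "a \<in> ann ?v" "b \<in> ann ?w" 
    using \<iota>(1) unfolding J_def mem_Collect_eq by (elim exE conjE)
  \<comment> \<open>The component b kills w, so aw = \<iota>w, and every c in \<open>J\<close>
    satisfies c(aw) = cw.\<close>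
  have \<iota>w: "\<iota> \<rhd> ?w = a \<rhd> ?w" using ab by (simp add: alg_add_left ann_def)
  txt \<open>The vector \<open>w = gv\<close> is split into \<open>y\<close>, on which \<open>A\<close> and \<open>A'\<close> agree, and \<open>z\<close>, which \<open>ann v\<close> kills.\<close>
  define y where "y = a \<rhd> ?w"
  define z where "z = ?w - y"
  have conv_\<iota>: "c \<rhd> y = c \<rhd> ?w" if "c \<in> J" for c
    using \<iota>(2)[OF that] unfolding y_def \<iota>w[symmetric] alg_conv[symmetric] by simp
  have "ann ?w \<subseteq> ann y" "ann ?v \<subseteq> ann z"
    using conv_\<iota>[OF sub] by (auto simp: ann_def z_def alg_diff_right)
  then have fixes_w: "A' (f \<rhd> y) = f \<rhd> y" and fixes_v: "A (f \<rhd> z) = f \<rhd> z"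
    using fixes_f_part[where T = T and A = A', OF T Tff gh A'] fixes_f_part[where T = T and A = A, OF T Tff h A]
    by blast+
  \<comment> \<open>The element fa still annihilates v, so \<open>compatible_on_ann\<close> turns
    A(fy) into T(fa)w, and the defining property of \<open>A'\<close> at w turns that into
    A'(fy).\<close>
  have "A (f \<rhd> y) = T (f \<star> a) \<rhd> ?w"
    unfolding y_def alg_conv[symmetric]
    by (rule compatible_on_ann[where T = T and A = A, OF T act_Gens[OF v0 h] A conv_ann[OF ab(2)], symmetric])
  moreover have "T (f \<star> a) \<rhd> ?w = A' (f \<rhd> y)"
    unfolding A'(2)[OF conv_galg] y_def alg_conv ..
  ultimately have "A (f \<rhd> y) = f \<rhd> y" using fixes_w by metis
  with fixes_v have "A (f \<rhd> ?w) = f \<rhd> ?w"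
    by (simp add: z_def alg_diff_right A.diff)
  moreover have "f \<rhd> ?w = (f \<star> point g) \<rhd> ?v"
    using g h by (simp add: alg_conv act_mult)
  then have "f \<rhd> ?w = act g (f \<rhd> ?v)"
    using g by (simp add: f_central[OF g, symmetric] alg_conv)
  moreover have "A (f \<rhd> ?w) = T (point g) \<rhd> f \<rhd> ?v"
  proof -
    have "A (f \<rhd> ?w) = A ((point g \<star> f) \<rhd> ?v)"
      using \<open>f \<rhd> ?w = act g (f \<rhd> ?v)\<close> g by (simp add: alg_conv)
    also have "\<dots> = (T (point g) \<star> f) \<rhd> ?v"
      using g by (simp add: A(2)[symmetric] Tf)
    finally show ?thesis by (simp add: alg_conv)
  qed
  ultimately show ?thesis by simp
qed

end

section \<open>Generic symmetries and the idempotent f\<close>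

context annihilator_idempotent
begin

lemma Sym_mod_permutes: "\<pi> \<in> Sym_mod \<Longrightarrow> \<pi> permutes carrier G"
  using v0 by (auto simp: Sym_mod_def Sym_vec_def)

lemma Sym_mod_bij: "\<pi> \<in> Sym_mod \<Longrightarrow> bij \<pi>"
  using Sym_mod_permutes permutes_bij by blast

lemma Sym_mod_inv: "\<pi> \<in> Sym_mod \<Longrightarrow> inv_into UNIV \<pi> \<in> Sym_mod"
  by (auto simp: Sym_mod_def intro: Sym_vec_inv)

lemma Sym_mod_comp: "\<sigma> \<in> Sym_mod \<Longrightarrow> \<tau> \<in> Sym_mod \<Longrightarrow> \<sigma> \<circ> \<tau> \<in> Sym_mod"
  by (auto simp: Sym_mod_def intro: Sym_vec_comp)

lemma Sym_mod_transl: "h \<in> carrier G \<Longrightarrow> transl h \<in> Sym_mod"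
  by (auto simp: Sym_mod_def intro: Sym_vec_transl)

lemma finite_Sym_mod: "finite Sym_mod"
  by (rule finite_subset[OF _ finite_permutations[OF finite_G]]) (auto dest: Sym_mod_permutes)

lemma perm_alg_ann_ideal:
  assumes \<pi>: "\<pi> \<in> Sym_mod" and a: "a \<in> ann_ideal v0"
  shows "perm_alg \<pi> a \<in> ann_ideal v0"
proof (rule ann_ideal_mapI[OF linear_perm_alg subspace_ann_ideal _ a])
  fix h a assume h: "h \<in> carrier G" and a: "a \<in> ann (act h v0)"
  have "\<pi> \<in> Sym_vec (act h v0)"
    using \<pi> act_Gens[OF v0 h] by (auto simp: Sym_mod_def)
  then obtain A where A: "A \<in> GL" "\<And>a. perm_alg \<pi> a \<rhd> act h v0 = A (a \<rhd> act h v0)"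
    by (rule Sym_vecD) blast
  interpret A: Vector_Spaces.linear scale scale A using A by (simp add: GL_def)
  have "perm_alg \<pi> a \<in> ann (act h v0)"
    using a A(2)[of a] perm_alg_galg[OF Sym_mod_permutes[OF \<pi>], of a] by (simp add: ann_def A.zero)
  then show "perm_alg \<pi> a \<in> ann_ideal v0"
    using ann_subset_ann_ideal[OF h] by blast
qed

text \<open>Averaging \<open>a \<mapsto> a \<star> f\<close> over \<open>Sym_mod\<close> yields an equivariant projection onto the ideal. It commutes with the
  left translations, so it is right multiplication by an element, which can only be \<open>f\<close>.\<close>

lemma perm_alg_conv_f:
  assumes \<pi>: "\<pi> \<in> Sym_mod" and a: "a \<in> galg"
  shows "perm_alg \<pi> (a \<star> f) = perm_alg \<pi> a \<star> f"
proof -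
  \<comment> \<open>Right multiplication by f, conjugated by \<sigma>. It maps into the ideal and
    fixes it pointwise because \<sigma> preserves the ideal.\<close>
  define P where "P \<sigma> a = perm_alg (inv_into UNIV \<sigma>) (perm_alg \<sigma> a \<star> f)" for \<sigma> and a :: "'c \<Rightarrow> 'a"
  define Q where "Q a = fscale (1 / of_nat (card Sym_mod)) (\<Sum>\<sigma>\<in>Sym_mod. P \<sigma> a)" for a
  have "transl \<one> \<in> Sym_mod" by (rule Sym_mod_transl) simp
  then have card: "(of_nat (card Sym_mod) :: 'a) \<noteq> 0"
    using finite_Sym_mod by auto
  have average: "fscale (1 / of_nat (card Sym_mod)) (\<Sum>\<sigma>\<in>Sym_mod. a) = a" for a :: "'c \<Rightarrow> 'a"
    using card by (simp add: fun_eq_iff sum_fun_apply)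
  have Q_ideal: "Q a \<in> ann_ideal v0" for a
    unfolding Q_def P_def
    by (intro fs.subspace_scale subspace_ann_ideal fs.subspace_sum perm_alg_ann_ideal Sym_mod_inv)
      (auto intro: ann_ideal_left f_ideal)
  have "P \<sigma> a = a" if "\<sigma> \<in> Sym_mod" "a \<in> ann_ideal v0" for \<sigma> a
    unfolding P_def f_right[OF perm_alg_ann_ideal[OF that]] by (rule perm_alg_inv[OF Sym_mod_bij[OF that(1)]])
  then have Q_id: "Q a = a" if "a \<in> ann_ideal v0" for a
    using that average[of a] by (simp add: Q_def)
  have linear_P: "Vector_Spaces.linear fscale fscale (P \<sigma>)" for \<sigma>
  proof -
    have "P \<sigma> = perm_alg (inv_into UNIV \<sigma>) \<circ> ((\<lambda>a. a \<star> f) \<circ> perm_alg \<sigma>)"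
      by (simp add: P_def fun_eq_iff)
    then show ?thesis
      using linear_perm_alg linear_conv_right
      by (auto intro!: Vector_Spaces.linear_compose[of fscale fscale _ fscale])
  qed
  have Q_perm: "Q (perm_alg \<tau> a) = perm_alg \<tau> (Q a)" if \<tau>: "\<tau> \<in> Sym_mod" for \<tau> a
  proof -
    interpret \<tau>: Vector_Spaces.linear fscale fscale "perm_alg \<tau>" by (rule linear_perm_alg)
    have "P \<sigma> (perm_alg \<tau> a) = perm_alg \<tau> (P (\<sigma> \<circ> \<tau>) a)" if "\<sigma> \<in> Sym_mod" for \<sigma>
      using Sym_mod_bij[OF \<tau>] Sym_mod_bij[OF that]
      by (simp add: P_def perm_alg_comp o_inv_distrib perm_alg_inv' bij_imp_bij_inv)
    then have "Q (perm_alg \<tau> a) = fscale (1 / of_nat (card Sym_mod)) (\<Sum>\<sigma>\<in>Sym_mod. perm_alg \<tau> (P (\<sigma> \<circ> \<tau>) a))"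
      unfolding Q_def by (intro arg_cong[where f = "fscale _"] sum.cong refl)
    also have "(\<Sum>\<sigma>\<in>Sym_mod. perm_alg \<tau> (P (\<sigma> \<circ> \<tau>) a)) = (\<Sum>\<sigma>\<in>Sym_mod. perm_alg \<tau> (P \<sigma> a))"
      by (rule sum.reindex_bij_witness[where i = "\<lambda>\<sigma>. \<sigma> \<circ> inv_into UNIV \<tau>" and j = "\<lambda>\<sigma>. \<sigma> \<circ> \<tau>"])
        (use Sym_mod_bij[OF \<tau>] in \<open>auto simp: comp_assoc bij_is_surj bij_is_inj surj_iff[THEN iffD1] intro: Sym_mod_comp Sym_mod_inv \<tau>\<close>)
    finally show ?thesis
      by (simp only: Q_def \<tau>.scale \<tau>.sum)
  qed
  have Q_point: "Q (point g) = point g \<star> Q (point \<one>)" if g: "g \<in> carrier G" for g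
  proof -
    have "perm_alg (transl g) (point \<one>) = (point g :: 'c \<Rightarrow> 'a)"
      using g by (simp add: perm_alg_transl)
    then show ?thesis
      using Q_perm[OF Sym_mod_transl[OF g], of "point \<one>"] g
        subsetD[OF ann_ideal_galg Q_ideal[of "point \<one>"]]
      by (simp add: perm_alg_transl)
  qed
  have Q_conv: "Q a = a \<star> Q (point \<one>)" if a: "a \<in> galg" for a
  proof -
    have "Q (\<Sum>g\<in>carrier G. fscale (a g) (point g)) = (\<Sum>g\<in>carrier G. fscale (a g) (Q (point g)))"
    proof -
      interpret Q: Vector_Spaces.linear fscale fscale Q
      proof -
        interpret P: Vector_Spaces.linear fscale fscale "P \<sigma>" for \<sigma> by (rule linear_P)
        show "Vector_Spaces.linear fscale fscale Q"
          by unfold_locales (simp_all only: Q_def P.add P.scale sum.distrib fs.scale_right_distrib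
              fs.scale_sum_right[symmetric] fs.scale_left_commute)
      qed
      show ?thesis by (simp only: Q.sum Q.scale)
    qed
    also have "\<dots> = a \<star> Q (point \<one>)"
      unfolding conv_expand[of a] by (intro sum.cong refl) (simp only: Q_point[symmetric])
    finally show ?thesis
      using galg_expand[OF a] by simp
  qed
  \<comment> \<open>The projection fixes f, and its value at the identity lies in the ideal, where f
    is a right identity. Centrality of f joins the two facts.\<close>
  have "f = f \<star> Q (point \<one>)"
    using Q_conv[OF f_galg] Q_id[OF f_ideal] by simp
  also have "\<dots> = Q (point \<one>) \<star> f"
    using Q_ideal[of "point \<one>"] ann_ideal_galg by (intro f_commute[symmetric]) blast
  also have "\<dots> = Q (point \<one>)"
    by (rule f_right[OF Q_ideal])
  finally have "Q b = b \<star> f" if "b \<in> galg" for b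
    using Q_conv[OF that] by simp
  then show ?thesis
    using Q_perm[OF \<pi>, of a] a perm_alg_galg[OF Sym_mod_permutes[OF \<pi>] a] by simp
qed

text \<open>If \<open>v = b v\<^sub>0\<close> and \<open>v\<^sub>0 = b' v\<close>, then \<open>b\<close> and \<open>b'\<close> are mutually inverse modulo the ideal \<open>kGf\<close>.\<close>

lemma ann_Gens_f:
  assumes v: "v \<in> Gens" and c: "c \<in> ann v"
  shows "c \<star> f = c"
proof -
  obtain b b' where b: "b \<in> galg" "b \<rhd> v0 = v" and b': "b' \<in> galg" "b' \<rhd> v = v0"
    using v v0 unfolding Gens_iff by blast
  have cg: "c \<in> galg" "c \<rhd> v = 0" using c by (auto simp: ann_def)
  have ideal: "a \<star> f = a" if "a \<in> galg" "a \<rhd> v0 = 0" for a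
    using that ann_subset_ann_ideal[OF one_closed, of v0] by (intro f_right) (auto simp: ann_def)
  define e where "e = point \<one> - f"
  have e: "e \<in> galg" "e \<star> f = 0" "f \<star> f = f"
    using f_right[OF f_ideal] by (simp_all add: e_def conv_diff_left)
  have ec: "a \<star> e = e \<star> a" if "a \<in> galg" for a
    using that f_commute[OF that] by (simp add: e_def conv_diff_left conv_diff_right)
  have ee: "e \<star> e = e" using e by (simp add: e_def conv_diff_right conv_diff_left)
  have kill: "a \<star> e = 0" if "a \<in> galg" "a \<rhd> v0 = 0" for a
    using ideal[OF that] that by (simp add: e_def conv_diff_right)
  have bb: "b' \<star> b \<star> e = e"
  proof -
    have "(b' \<star> b - point \<one>) \<star> e = 0"
      by (rule kill) (use b b' in \<open>auto simp: alg_diff_left alg_conv\<close>)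
    then show ?thesis using e by (simp add: conv_diff_left)
  qed
  \<comment> \<open>Adding f completes the two elements to inverses in the whole group algebra,
    where a one-sided inverse is two-sided.\<close>
  let ?x = "b' \<star> e + f" and ?y = "b \<star> e + f"
  have fe: "f \<star> e = 0" using e by (simp add: e_def conv_diff_right)
  have mult: "(p \<star> e + f) \<star> (q \<star> e + f) = p \<star> q \<star> e + f" if "p \<in> galg" "q \<in> galg" for p q
  proof -
    have "p \<star> e \<star> (q \<star> e) = p \<star> q \<star> e"
      using ec[OF that(2)] ee by (metis conv_assoc)
    moreover have "f \<star> (q \<star> e) = 0"
      using f_commute[OF that(2)] fe by (metis conv_assoc conv_zero_right)
    moreover have "p \<star> e \<star> f = 0" using e by (simp add: conv_assoc)
    ultimately show ?thesis
      using e by (simp only: conv_add_left conv_add_right) simp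
  qed
  have xy: "?x \<star> ?y = point \<one>"
    using mult[OF b'(1) b(1)] bb by (simp add: e_def)
  have "?y \<star> ?x = point \<one>"
    by (rule right_inverse_imp_left_inverse[OF _ _ xy]) simp_all
  then have bb': "b \<star> b' \<star> e = e"
    using mult[OF b(1) b'(1)] by (simp add: e_def eq_diff_eq)
  \<comment> \<open>Since cb kills \<open>v0\<close>, the product cbe is zero. Multiplying by
    \<open>b'\<close> on the right, moving the central e past it and using \<open>bb'\<close>
    recovers ce.\<close>
  have "(c \<star> b) \<star> e = 0"
    by (rule kill) (use b cg in \<open>auto simp: alg_conv\<close>)
  then have "c \<star> (b \<star> b' \<star> e) = 0"
    using ec[OF b'(1)] by (metis conv_assoc conv_zero_left)
  then have "c \<star> e = 0" unfolding bb' .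
  then show ?thesis using cg by (simp add: e_def conv_diff_right)
qed

text \<open>These are the two conditions of the theorem, expressed over k:
  \<open>\<chi>\<^sub>I\<close> is determined by the coefficients of f, and two elements lie in the
  same coset of N when they act equally on fV.\<close>

definition sym_cond :: "('c \<Rightarrow> 'c) \<Rightarrow> bool" where
  "sym_cond \<pi> \<longleftrightarrow> (\<forall>g\<in>carrier G. \<forall>h\<in>carrier G. f (inv (\<pi> g) \<otimes> \<pi> h) = f (inv g \<otimes> h)) \<and>
    (\<forall>g\<in>carrier G. \<forall>u. act (\<pi> g) (f \<rhd> u) = act (\<pi> \<one>) (act g (f \<rhd> u)))"

lemma Sym_mod_imp_sym_cond:
  assumes \<pi>: "\<pi> \<in> Sym_mod"
  shows "sym_cond \<pi>"
  unfolding sym_cond_def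
proof (intro conjI ballI allI)
  note p = Sym_mod_permutes[OF \<pi>] and bij = Sym_mod_bij[OF \<pi>]
  have pG: "\<pi> g \<in> carrier G" if "g \<in> carrier G" for g
    using p that by (simp add: permutes_in_image)
  fix g assume g: "g \<in> carrier G"
  {
    fix h assume h: "h \<in> carrier G"
    \<comment> \<open>Read at the coefficient of \<open>\<pi> h\<close>, the commutation of
      \<open>perm_alg \<pi>\<close> with f is the first condition.\<close>
    have "perm_alg \<pi> (point g \<star> f) (\<pi> h) = (point (\<pi> g) \<star> f) (\<pi> h)"
      using perm_alg_conv_f[OF \<pi> point_galg[OF g]] by (simp add: perm_alg_point bij)
    moreover have "perm_alg \<pi> (point g \<star> f) (\<pi> h) = (point g \<star> f) h"
      using bij by (simp add: perm_alg_def bij_is_inj)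
    ultimately show "f (inv (\<pi> g) \<otimes> \<pi> h) = f (inv g \<otimes> h)"
      using g h pG by (simp add: point_conv)
  }
  fix u
  define t where "t = \<pi> \<one>"
  have t: "t \<in> carrier G" using pG by (simp add: t_def)
  \<comment> \<open>Dividing by \<open>\<pi> \<one>\<close> makes \<open>T\<close> fix the identity,
    as \<open>compatible_acts_as_group\<close> requires; compatibility with all generators
    survives.\<close>
  define T where "T a = point (inv t) \<star> perm_alg \<pi> a" for a :: "'c \<Rightarrow> 'a"
  have "T (point g) \<rhd> f \<rhd> act h v0 = act g (f \<rhd> act h v0)" if h: "h \<in> carrier G" for h
  proof (rule compatible_acts_as_group[OF _ _ _ _ h g])
    fix u assume u: "u \<in> Gens"
    then have "\<pi> \<in> Sym_vec u" using \<pi> by (simp add: Sym_mod_def)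
    then obtain A where A: "A \<in> GL" "\<And>a. perm_alg \<pi> a \<rhd> u = A (a \<rhd> u)"
      by (rule Sym_vecD) blast
    have "act (inv t) \<circ> A \<in> GL" using A(1) t GL_comp GL_act by blast
    moreover have "\<forall>a\<in>galg. T a \<rhd> u = (act (inv t) \<circ> A) (a \<rhd> u)"
      using t by (simp add: T_def alg_conv A(2))
    ultimately show "\<exists>A. Vector_Spaces.linear scale scale A \<and> (\<forall>a\<in>galg. T a \<rhd> u = A (a \<rhd> u))"
      unfolding GL_def by blast
  next
    show "T (point \<one>) = point \<one>"
      using t by (simp add: T_def perm_alg_point bij point_mult flip: t_def)
  next
    fix a :: "'c \<Rightarrow> 'a" assume "a \<in> galg"
    then show "T (a \<star> f) = T a \<star> f"
      by (simp add: T_def perm_alg_conv_f[OF \<pi>] conv_assoc)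
  qed (simp add: T_def)
  then have *: "act (\<pi> g) (f \<rhd> act h v0) = act t (act g (f \<rhd> act h v0))" if "h \<in> carrier G" for h
    using that t g pG by (simp add: T_def perm_alg_point bij alg_conv) (metis act_inv')
  \<comment> \<open>The translates of \<open>v0\<close> span the module, so the equality extends
    from them to every u.\<close>
  obtain b where b: "b \<in> galg" "b \<rhd> v0 = u" using v0 unfolding Gens_iff by blast
  have "act (\<pi> g) (f \<rhd> b \<rhd> v0) = act t (act g (f \<rhd> b \<rhd> v0))"
    unfolding alg_act_def[of b] alg_sum_right alg_scale_right
    using * g t pG by (simp add: act_sum act_scale)
  then show "act (\<pi> g) (f \<rhd> u) = act (\<pi> \<one>) (act g (f \<rhd> u))"
    by (simp add: b t_def)
qed

lemma sym_cond_ann: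
  assumes p: "\<pi> permutes carrier G" and \<pi>: "sym_cond \<pi>" and v: "v \<in> Gens" and c: "c \<in> ann v"
  shows "perm_alg \<pi> c \<rhd> v = 0"
proof -
  have pG: "\<pi> g \<in> carrier G" if "g \<in> carrier G" for g
    using p that by (simp add: permutes_in_image)
  \<comment> \<open>Condition (i) lets \<open>perm_alg \<pi>\<close> commute with right
    multiplication by f, and c = cf.\<close>
  have "perm_alg \<pi> c = perm_alg \<pi> c \<star> f"
  proof (rule galg_eqI)
    fix x assume x: "x \<in> carrier G"
    define y where "y = inv_into UNIV \<pi> x"
    have y: "y \<in> carrier G" "\<pi> y = x"
      using p x by (simp_all add: y_def permutes_in_image permutes_inv permutes_inverses)
    have "perm_alg \<pi> c x = (c \<star> f) y"
      using ann_Gens_f[OF v c] by (simp add: perm_alg_def y_def)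
    also have "\<dots> = (\<Sum>g\<in>carrier G. c g * f (inv (\<pi> g) \<otimes> \<pi> y))"
      using y(1) \<pi> by (simp add: conv_def sym_cond_def)
    also have "\<dots> = (perm_alg \<pi> c \<star> f) x"
      unfolding conv_def if_P[OF x] y(2)
      by (subst (2) sum.permute[OF p]) (simp add: perm_alg_def permutes_inverses[OF p])
    finally show "perm_alg \<pi> c x = (perm_alg \<pi> c \<star> f) x" .
  qed (use c p in \<open>auto simp: ann_def intro: perm_alg_galg\<close>)
  then have "perm_alg \<pi> c \<rhd> v = perm_alg \<pi> c \<rhd> f \<rhd> v"
    by (metis alg_conv)
  also have "\<dots> = (\<Sum>g\<in>carrier G. scale (c g) (act (\<pi> \<one>) (act g (f \<rhd> v))))"
    unfolding perm_alg_act[OF p] using \<pi> by (simp add: sym_cond_def)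
  also have "\<dots> = act (\<pi> \<one>) (c \<rhd> f \<rhd> v)"
    using pG by (simp add: alg_act_def[of c] act_sum act_scale)
  also have "c \<rhd> f \<rhd> v = 0"
    using ann_Gens_f[OF v c] c by (simp add: ann_def flip: alg_conv)
  finally show ?thesis using pG by (simp add: act_zero)
qed

text \<open>This serves to invert the linear map realizing \<pi>. On fV the image of the identity
  under the inverse permutation acts as the inverse of \<open>\<pi> \<one>\<close>, and group
  elements commute with f.\<close>

lemma sym_cond_inv:
  assumes p: "\<pi> permutes carrier G" and \<pi>: "sym_cond \<pi>"
  shows "sym_cond (inv_into UNIV \<pi>)"
proof -
  let ?p = "inv_into UNIV \<pi>"
  have pG: "\<pi> g \<in> carrier G" "?p g \<in> carrier G" "\<pi> (?p g) = g" if "g \<in> carrier G" for g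
    using p that by (simp_all add: permutes_in_image permutes_inv permutes_inverses)
  have 1: "f (inv (?p g) \<otimes> ?p h) = f (inv g \<otimes> h)" if "g \<in> carrier G" "h \<in> carrier G" for g h
    using \<pi> pG that unfolding sym_cond_def by metis
  have act: "act (?p g) (f \<rhd> u) = act (inv (\<pi> \<one>)) (act g (f \<rhd> u))" if g: "g \<in> carrier G" for g u
  proof -
    have "act g (f \<rhd> u) = act (\<pi> \<one>) (act (?p g) (f \<rhd> u))"
      using \<pi> pG[OF g] unfolding sym_cond_def by metis
    then show ?thesis using pG by simp
  qed
  have "act (?p g) (f \<rhd> u) = act (?p \<one>) (act g (f \<rhd> u))" if g: "g \<in> carrier G" for g u
  proof -
    have "act g (f \<rhd> u) = f \<rhd> act g u"
      using f_central[OF g] g by (metis alg_conv alg_point)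
    then show ?thesis
      using act[OF g, of u] act[OF one_closed, of "act g u"] by simp
  qed
  with 1 show ?thesis by (simp add: sym_cond_def)
qed

lemma sym_cond_imp_Sym_mod:
  assumes p: "\<pi> permutes carrier G" and \<pi>: "sym_cond \<pi>"
  shows "\<pi> \<in> Sym_mod"
  unfolding Sym_mod_def
proof
  fix v assume v: "v \<in> Gens"
  let ?p = "inv_into UNIV \<pi>"
  note pi = permutes_inv[OF p]
  obtain s where s: "\<And>u. s u \<in> galg" "\<And>u. s u \<rhd> v = u"
    using v unfolding Gens_iff by metis
  \<comment> \<open>The preimages \<open>s u\<close> are arbitrary; \<open>sym_cond_ann\<close>
    makes the result independent of the choice, and linearity and invertibility follow from this
    independence.\<close>
  define A where "A \<sigma> u = perm_alg \<sigma> (s u) \<rhd> v" for \<sigma> u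
  have A: "A \<sigma> (a \<rhd> v) = perm_alg \<sigma> a \<rhd> v"
    if "\<sigma> permutes carrier G" "sym_cond \<sigma>" "a \<in> galg" for \<sigma> a
  proof -
    interpret T: Vector_Spaces.linear fscale fscale "perm_alg \<sigma> :: ('c \<Rightarrow> 'a) \<Rightarrow> _" by (rule linear_perm_alg)
    have "s (a \<rhd> v) - a \<in> ann v"
      using that s by (simp add: ann_def alg_diff_left)
    from sym_cond_ann[OF that(1,2) v this] show ?thesis
      by (simp add: A_def T.diff alg_diff_left)
  qed
  note A1 = A[OF p \<pi>] and A2 = A[OF pi sym_cond_inv[OF p \<pi>]]
  interpret T: Vector_Spaces.linear fscale fscale "perm_alg \<pi> :: ('c \<Rightarrow> 'a) \<Rightarrow> _" by (rule linear_perm_alg)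
  have "A \<pi> \<in> GL"
    unfolding GL_def
  proof safe
    show "Vector_Spaces.linear scale scale (A \<pi>)"
    proof unfold_locales
      fix x y
      show "A \<pi> (x + y) = A \<pi> x + A \<pi> y"
        using A1[of "s x + s y"] s by (simp add: alg_add_left T.add A_def)
    next
      fix r x
      show "A \<pi> (scale r x) = scale r (A \<pi> x)"
        using A1[of "fscale r (s x)"] s by (simp add: alg_scale_left T.scale A_def)
    qed
    have "A ?p (A \<pi> u) = u" "A \<pi> (A ?p u) = u" for u
      using A1[of "perm_alg ?p (s u)"] A2[of "perm_alg \<pi> (s u)"] s(2)[of u] perm_alg_galg[OF p s(1)] perm_alg_galg[OF pi s(1)]
        permutes_bij[OF p]
      by (simp_all add: A_def perm_alg_inv perm_alg_inv')
    then show "bij (A \<pi>)"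
      by (intro bij_betw_byWitness[where f' = "A ?p"]) auto
  qed
  moreover have "A \<pi> (act g v) = act (\<pi> g) v" if g: "g \<in> carrier G" for g
    using A1[of "point g"] g p by (simp add: perm_alg_point permutes_bij permutes_in_image)
  ultimately show "\<pi> \<in> Sym_vec v"
    using p by (auto simp: Sym_vec_def)
qed

lemma Sym_mod_iff: "\<pi> permutes carrier G \<Longrightarrow> \<pi> \<in> Sym_mod \<longleftrightarrow> sym_cond \<pi>"
  using Sym_mod_imp_sym_cond sym_cond_imp_Sym_mod by blast

end

section \<open>Irreducible characters\<close>

lemma subspace_vecI:
  fixes W :: "'K::field vec set"
  assumes "W \<subseteq> carrier_vec n" "0\<^sub>v n \<in> W" "\<And>v w. v \<in> W \<Longrightarrow> w \<in> W \<Longrightarrow> v + w \<in> W"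
    "\<And>c v. v \<in> W \<Longrightarrow> c \<cdot>\<^sub>v v \<in> W"
  shows "VectorSpace.subspace class_ring W (module_vec TYPE('K) n)"
proof -
  interpret V: vec_space "TYPE('K)" n .
  show ?thesis
    using assms by unfold_locales (auto simp: module_vec_simps)
qed

section \<open>Matrix traces and Schur's lemma\<close>

definition mat_trace :: "'K::comm_ring_1 mat \<Rightarrow> 'K" where
  "mat_trace A = (\<Sum>i<dim_row A. A $$ (i, i))"

lemma mult_mat_index:
  "A \<in> carrier_mat n m \<Longrightarrow> B \<in> carrier_mat m p \<Longrightarrow> i < n \<Longrightarrow> j < p \<Longrightarrow>
    (A * B) $$ (i, j) = (\<Sum>k<m. A $$ (i, k) * B $$ (k, j))"
  by (auto simp: scalar_prod_def atLeast0LessThan)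

lemma mat_trace_comm:
  assumes "A \<in> carrier_mat n m" "B \<in> carrier_mat m n"
  shows "mat_trace (A * B) = mat_trace (B * A)"
proof -
  have "mat_trace (A * B) = (\<Sum>i<n. \<Sum>k<m. A $$ (i, k) * B $$ (k, i))"
    using assms by (simp add: mat_trace_def mult_mat_index[OF assms] del: index_mult_mat(1))
  also have "\<dots> = (\<Sum>k<m. \<Sum>i<n. B $$ (k, i) * A $$ (i, k))"
    by (subst sum.swap) (simp add: mult.commute)
  also have "\<dots> = mat_trace (B * A)"
    using assms by (simp add: mat_trace_def mult_mat_index[OF assms(2,1)] del: index_mult_mat(1))
  finally show ?thesis .
qed

lemma mat_trace_idempotent:
  fixes A :: "'K::field_char_0 mat"
  assumes A: "A \<in> carrier_mat n n" "A * A = A"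
  shows "\<exists>r. mat_trace A = of_nat r" and "mat_trace A = 0 \<Longrightarrow> A = 0\<^sub>m n n"
proof -
  \<comment> \<open>The matrix becomes an operator on functions, with values supported below n, so
    that \<open>trace_idempotent\<close> applies.\<close>
  define p where "p a i = (if i < n then \<Sum>j<n. A $$ (i, j) * a j else 0)" for a :: "nat \<Rightarrow> 'K" and i
  have lin: "Vector_Spaces.linear fscale fscale p"
    by unfold_locales (auto simp: p_def fun_eq_iff algebra_simps sum.distrib sum_distrib_left)
  have idem: "p (p a) = p a" for a
  proof
    fix i
    have "(\<Sum>k<n. A $$ (i, k) * p a k) = (\<Sum>j<n. A $$ (i, j) * a j)" if i: "i < n"
    proof -
      have "(\<Sum>k<n. A $$ (i, k) * p a k) = (\<Sum>k<n. \<Sum>j<n. A $$ (i, k) * A $$ (k, j) * a j)"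
        by (simp add: p_def sum_distrib_left mult.assoc)
      also have "\<dots> = (\<Sum>j<n. (\<Sum>k<n. A $$ (i, k) * A $$ (k, j)) * a j)"
        by (subst sum.swap) (simp add: sum_distrib_right)
      also have "\<dots> = (\<Sum>j<n. A $$ (i, j) * a j)"
        using i by (intro sum.cong refl) (simp add: mult_mat_index[OF A(1) A(1), symmetric] A(2) del: index_mult_mat(1))
      finally show ?thesis .
    qed
    then show "p (p a) i = p a i" unfolding p_def[of "p a"] by (simp add: p_def)
  qed
  have tr: "(\<Sum>i<n. p (point i) i) = mat_trace A"
    using A(1) by (simp add: p_def point_def mat_trace_def if_distrib[where f = "\<lambda>c. _ * c"] cong: if_cong)
  have supp: "p a i = 0" if "i \<notin> {..<n}" for a i using that by (simp add: p_def)
  note * = trace_idempotent[where p = p and S = "{..<n}", OF lin idem finite_lessThan supp, unfolded tr]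
  show "\<exists>r. mat_trace A = of_nat r" using *(1) by simp
  assume "mat_trace A = 0"
  then have p0: "p (point j) = 0" for j using *(2) by simp
  show "A = 0\<^sub>m n n"
  proof (rule eq_matI)
    fix i j assume "i < dim_row (0\<^sub>m n n :: 'K mat)" "j < dim_col (0\<^sub>m n n :: 'K mat)"
    then show "A $$ (i, j) = 0\<^sub>m n n $$ (i, j)"
      using fun_cong[OF p0[of j], of i]
      by (simp add: p_def point_def if_distrib[where f = "\<lambda>c. _ * c"] cong: if_cong)
  qed (use A in auto)
qed

lemma mult_mat_unit_vec:
  fixes A :: "'K::field mat"
  shows "A \<in> carrier_mat n m \<Longrightarrow> j < m \<Longrightarrow> A *\<^sub>v unit_vec m j = col A j"
  by (rule eq_vecI) (auto simp: scalar_prod_right_unit[where n = m])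

lemma mat_eq_on_vecI:
  fixes A B :: "'K::field mat"
  assumes "A \<in> carrier_mat n m" "B \<in> carrier_mat n m"
    "\<And>x. x \<in> carrier_vec m \<Longrightarrow> A *\<^sub>v x = B *\<^sub>v x"
  shows "A = B"
proof (rule mat_col_eqI)
  fix j assume "j < dim_col B"
  then have j: "j < m" using assms(2) by simp
  show "col A j = col B j"
    using mult_mat_unit_vec[OF assms(1) j] mult_mat_unit_vec[OF assms(2) j] assms(3)[OF unit_vec_carrier] by simp
qed (use assms in auto)

text \<open>Schur's lemma: the kernel and the range of an intertwiner are invariant, so
  irreducibility of both representations makes T bijective. The columns of the inverse are preimages
  of the unit vectors.\<close>

lemma schur_intertwiner:
  fixes \<rho> \<sigma> :: "'g \<Rightarrow> 'K::field mat"
  assumes \<rho>: "irreducible_mat_representation G n \<rho>" and \<sigma>: "irreducible_mat_representation G m \<sigma>"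
    and T: "T \<in> carrier_mat n m" "T \<noteq> 0\<^sub>m n m" "\<And>g. g \<in> carrier G \<Longrightarrow> \<rho> g * T = T * \<sigma> g"
  obtains S where "S \<in> carrier_mat m n" "T * S = 1\<^sub>m n" "S * T = 1\<^sub>m m"
proof -
  have \<rho>c: "\<rho> g \<in> carrier_mat n n" and \<sigma>c: "\<sigma> g \<in> carrier_mat m m" if "g \<in> carrier G" for g
    using \<rho> \<sigma> that by (auto simp: irreducible_mat_representation_def mat_representation_def)
  define K where "K = {w \<in> carrier_vec m. T *\<^sub>v w = 0\<^sub>v n}"
  define R where "R = (\<lambda>w. T *\<^sub>v w) ` carrier_vec m"
  have "VectorSpace.subspace class_ring K (module_vec TYPE('K) m)"
    using T(1) by (intro subspace_vecI) (auto simp: K_def mult_add_distrib_mat_vec mult_mat_vec)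
  moreover have "\<sigma> g *\<^sub>v w \<in> K" if g: "g \<in> carrier G" and w: "w \<in> K" for g w
  proof -
    have "T *\<^sub>v (\<sigma> g *\<^sub>v w) = (\<rho> g * T) *\<^sub>v w"
      unfolding T(3)[OF g] using T(1) \<sigma>c[OF g] w by (simp add: K_def)
    also have "\<dots> = \<rho> g *\<^sub>v (T *\<^sub>v w)"
      using T(1) \<rho>c[OF g] w by (simp add: K_def)
    finally show ?thesis using \<rho>c[OF g] \<sigma>c[OF g] w by (auto simp: K_def)
  qed
  ultimately have "K = {0\<^sub>v m} \<or> K = carrier_vec m"
    using \<sigma> by (simp add: irreducible_mat_representation_def)
  moreover have "K \<noteq> carrier_vec m"
  proof
    assume "K = carrier_vec m"
    then have Tx: "T *\<^sub>v x = 0\<^sub>v n" if "x \<in> carrier_vec m" for x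
      using that unfolding K_def by blast
    have "T = 0\<^sub>m n m"
    proof (rule mat_eq_on_vecI[OF T(1) zero_carrier_mat])
      fix x :: "'K vec" assume x: "x \<in> carrier_vec m"
      show "T *\<^sub>v x = 0\<^sub>m n m *\<^sub>v x"
        unfolding Tx[OF x] using x by (intro eq_vecI) auto
    qed
    with T(2) show False by simp
  qed
  ultimately have K: "K = {0\<^sub>v m}" by blast
  have "VectorSpace.subspace class_ring R (module_vec TYPE('K) n)"
  proof (rule subspace_vecI)
    show "R \<subseteq> carrier_vec n" using T(1) by (auto simp: R_def)
    have "0\<^sub>v n = T *\<^sub>v 0\<^sub>v m" using T(1) by auto
    then show "0\<^sub>v n \<in> R" unfolding R_def by (rule image_eqI) simp
    fix v w assume "v \<in> R" "w \<in> R"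
    then obtain x y where "x \<in> carrier_vec m" "y \<in> carrier_vec m" "v = T *\<^sub>v x" "w = T *\<^sub>v y"
      by (auto simp: R_def)
    then have "v + w = T *\<^sub>v (x + y)" "x + y \<in> carrier_vec m" using T(1) by (auto simp: mult_add_distrib_mat_vec)
    then show "v + w \<in> R" unfolding R_def by (rule image_eqI)
  next
    fix c v assume "v \<in> R"
    then obtain x where "x \<in> carrier_vec m" "v = T *\<^sub>v x" by (auto simp: R_def)
    then have "c \<cdot>\<^sub>v v = T *\<^sub>v (c \<cdot>\<^sub>v x)" "c \<cdot>\<^sub>v x \<in> carrier_vec m" using T(1) by (auto simp: mult_mat_vec)
    then show "c \<cdot>\<^sub>v v \<in> R" unfolding R_def by (rule image_eqI)
  qed
  moreover have "\<rho> g *\<^sub>v w \<in> R" if g: "g \<in> carrier G" and w: "w \<in> R" for g w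
  proof -
    obtain x where x: "x \<in> carrier_vec m" "w = T *\<^sub>v x" using w by (auto simp: R_def)
    have "\<rho> g *\<^sub>v w = (\<rho> g * T) *\<^sub>v x" using x T(1) \<rho>c[OF g] by simp
    also have "\<dots> = T *\<^sub>v (\<sigma> g *\<^sub>v x)" using x T(1) T(3)[OF g] \<sigma>c[OF g] by simp
    finally show ?thesis unfolding R_def
      using mult_mat_vec_carrier[OF \<sigma>c[OF g] x(1)] by (intro image_eqI)
  qed
  ultimately have "R = {0\<^sub>v n} \<or> R = carrier_vec n"
    using \<rho> by (simp add: irreducible_mat_representation_def)
  moreover have "R \<noteq> {0\<^sub>v n}"
  proof
    assume "R = {0\<^sub>v n}"
    then have "K = carrier_vec m" by (auto simp: K_def R_def)
    moreover have "unit_vec m 0 \<noteq> (0\<^sub>v m :: 'K vec)"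
      using \<sigma> by (metis irreducible_mat_representation_def unit_vec_nonzero)
    ultimately show False using K unit_vec_carrier[of m 0] by (metis singletonD)
  qed
  ultimately have R: "R = carrier_vec n" by blast
  have "\<forall>i<n. \<exists>w\<in>carrier_vec m. T *\<^sub>v w = unit_vec n i"
  proof (intro allI impI)
    fix i assume "i < n"
    have "unit_vec n i \<in> R" unfolding R by simp
    then obtain w where "unit_vec n i = T *\<^sub>v w" "w \<in> carrier_vec m" unfolding R_def by (rule imageE)
    then show "\<exists>w\<in>carrier_vec m. T *\<^sub>v w = unit_vec n i" by metis
  qed
  then obtain w where w: "\<And>i. i < n \<Longrightarrow> w i \<in> carrier_vec m" "\<And>i. i < n \<Longrightarrow> T *\<^sub>v w i = unit_vec n i"
    by metis
  define S where "S = mat m n (\<lambda>(i, j). w j $ i)"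
  have S: "S \<in> carrier_mat m n" by (simp add: S_def)
  have colS: "col S j = w j" if "j < n" for j
    using that w(1)[OF that] by (auto simp: S_def)
  have TS: "T * S = 1\<^sub>m n"
  proof (rule eq_matI)
    fix i j assume ij: "i < dim_row (1\<^sub>m n :: 'K mat)" "j < dim_col (1\<^sub>m n :: 'K mat)"
    have "(T * S) $$ (i, j) = (T *\<^sub>v w j) $ i"
      using ij T(1) S colS by simp
    then show "(T * S) $$ (i, j) = 1\<^sub>m n $$ (i, j)"
      using ij w(2) by (auto simp: unit_vec_def)
  qed (use T(1) S in auto)
  have "(S * T) *\<^sub>v x = x" if x: "x \<in> carrier_vec m" for x
  proof -
    have "T *\<^sub>v ((S * T) *\<^sub>v x) = (T * S) *\<^sub>v (T *\<^sub>v x)"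
      using T(1) S x by simp
    then have "T *\<^sub>v ((S * T) *\<^sub>v x - x) = 0\<^sub>v n"
      using T(1) S x TS by (simp add: mult_minus_distrib_mat_vec)
    then have "(S * T) *\<^sub>v x - x \<in> K"
      using T(1) S x by (auto simp: K_def)
    then have *: "(S * T) *\<^sub>v x - x = 0\<^sub>v m" using K by simp
    show ?thesis
    proof (rule eq_vecI)
      fix i assume "i < dim_vec x"
      then show "((S * T) *\<^sub>v x) $ i = x $ i"
        using arg_cong[OF *, of "\<lambda>v. v $ i"] x by simp
    qed (use S x in auto)
  qed
  then have "S * T = 1\<^sub>m m"
    using T(1) S by (intro mat_eq_on_vecI[of _ m m]) simp_all
  with S TS show thesis by (rule that)
qed

text \<open>Subtracting an eigenvalue, which exists over an algebraically closed field, leaves an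
  intertwiner with nonzero kernel. It is not invertible, so it is zero by
  \<open>schur_intertwiner\<close>.\<close>

lemma schur_scalar:
  fixes \<rho> :: "'g \<Rightarrow> 'K::alg_closed_field mat"
  assumes \<rho>: "irreducible_mat_representation G n \<rho>"
    and T: "T \<in> carrier_mat n n" "\<And>g. g \<in> carrier G \<Longrightarrow> \<rho> g * T = T * \<rho> g"
  obtains c where "T = c \<cdot>\<^sub>m 1\<^sub>m n"
proof -
  have \<rho>c: "\<rho> g \<in> carrier_mat n n" if "g \<in> carrier G" for g
    using \<rho> that by (auto simp: irreducible_mat_representation_def mat_representation_def)
  have n: "n > 0" using \<rho> by (simp add: irreducible_mat_representation_def)
  have "degree (char_poly T) > 0"
    using degree_monic_char_poly[OF T(1)] n by simp
  then obtain c where "poly (char_poly T) c = 0"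
    using alg_closed_imp_poly_has_root by blast
  then have "eigenvalue T c"
    using eigenvalue_root_char_poly[OF T(1)] by simp
  then obtain v where v: "v \<in> carrier_vec n" "v \<noteq> 0\<^sub>v n" "T *\<^sub>v v = c \<cdot>\<^sub>v v"
    using T(1) by (auto simp: eigenvalue_def eigenvector_def)
  define D where "D = T - c \<cdot>\<^sub>m 1\<^sub>m n"
  have D: "D \<in> carrier_mat n n" unfolding D_def by (intro minus_carrier_mat smult_carrier_mat one_carrier_mat)
  have cv: "(c \<cdot>\<^sub>m 1\<^sub>m n) *\<^sub>v v = c \<cdot>\<^sub>v v"
    using v(1) by (intro eq_vecI) (auto simp: row_smult)
  have Dv: "D *\<^sub>v v = 0\<^sub>v n"
    unfolding D_def using minus_mult_distrib_mat_vec[OF T(1) smult_carrier_mat[OF one_carrier_mat] v(1), of c] v(1)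
    by (simp add: cv v(3))
  have "D = 0\<^sub>m n n"
  proof (rule ccontr)
    assume "D \<noteq> 0\<^sub>m n n"
    moreover have "\<rho> g * D = D * \<rho> g" if g: "g \<in> carrier G" for g
    proof -
      have "\<rho> g * D = \<rho> g * T - c \<cdot>\<^sub>m \<rho> g"
        using \<rho>c[OF g] T(1) by (simp add: D_def mult_minus_distrib_mat mult_smult_distrib[of _ n n _ n])
      also have "\<dots> = D * \<rho> g"
        using \<rho>c[OF g] T(1) by (simp add: D_def minus_mult_distrib_mat T(2)[OF g] mult_smult_assoc_mat[of _ n n _ n])
      finally show ?thesis .
    qed
    ultimately obtain S where S: "S \<in> carrier_mat n n" "S * D = 1\<^sub>m n"
      by (rule schur_intertwiner[OF \<rho> \<rho> D]) blast
    have "v = (S * D) *\<^sub>v v" using S v by simp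
    also have "\<dots> = 0\<^sub>v n" using S(1) D v(1) by (auto simp: Dv)
    finally show False using v(2) by simp
  qed
  then have "T = c \<cdot>\<^sub>m 1\<^sub>m n"
  proof -
    have "T $$ (i, j) = (c \<cdot>\<^sub>m 1\<^sub>m n) $$ (i, j)" if "i < n" "j < n" for i j
      using arg_cong[OF \<open>D = 0\<^sub>m n n\<close>, of "\<lambda>A. A $$ (i, j)"] that T(1) by (simp add: D_def)
    then show ?thesis using T(1) by (intro eq_matI) auto
  qed
  then show thesis by (rule that)
qed

section \<open>The group algebra in matrix representations and the orthogonality relations\<close>

context finite_group
begin

definition rep_alg :: "nat \<Rightarrow> ('g \<Rightarrow> 'K::field mat) \<Rightarrow> ('g \<Rightarrow> 'K) \<Rightarrow> 'K mat" where
  "rep_alg n \<rho> a = mat n n (\<lambda>(i, j). \<Sum>g\<in>carrier G. a g * \<rho> g $$ (i, j))"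

lemma rep_alg_carrier [simp]: "rep_alg n \<rho> a \<in> carrier_mat n n"
  by (simp add: rep_alg_def)

lemma rep_alg_index: "i < n \<Longrightarrow> j < n \<Longrightarrow> rep_alg n \<rho> a $$ (i, j) = (\<Sum>g\<in>carrier G. a g * \<rho> g $$ (i, j))"
  by (simp add: rep_alg_def)

lemma mat_representation_carrier: "mat_representation G n \<rho> \<Longrightarrow> g \<in> carrier G \<Longrightarrow> \<rho> g \<in> carrier_mat n n"
  by (simp add: mat_representation_def)

lemma mat_representation_mult_index:
  "mat_representation G n \<rho> \<Longrightarrow> g \<in> carrier G \<Longrightarrow> h \<in> carrier G \<Longrightarrow> i < n \<Longrightarrow> j < n \<Longrightarrow>
    \<rho> (g \<otimes> h) $$ (i, j) = (\<Sum>k<n. \<rho> g $$ (i, k) * \<rho> h $$ (k, j))"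
  by (simp add: mat_representation_def mult_mat_index[of _ n n _ n] del: index_mult_mat(1))

lemma rep_alg_point:
  "mat_representation G n \<rho> \<Longrightarrow> g \<in> carrier G \<Longrightarrow> rep_alg n \<rho> (point g) = \<rho> g"
  by (rule eq_matI) (auto simp: rep_alg_def point_def mat_representation_carrier
      if_distrib[where f = "\<lambda>c. c * _"] dest: mat_representation_carrier cong: if_cong)

lemma rep_alg_diff: "rep_alg n \<rho> (a - b) = rep_alg n \<rho> a - rep_alg n \<rho> b"
  by (rule eq_matI) (auto simp: rep_alg_def algebra_simps sum_subtractf)

lemma rep_alg_conv:
  assumes \<rho>: "mat_representation G n \<rho>"
  shows "rep_alg n \<rho> (a \<star> b) = rep_alg n \<rho> a * rep_alg n \<rho> b"
proof (rule eq_matI)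
  fix i j assume "i < dim_row (rep_alg n \<rho> a * rep_alg n \<rho> b)" "j < dim_col (rep_alg n \<rho> a * rep_alg n \<rho> b)"
  then have ij: "i < n" "j < n" by (auto simp: rep_alg_def)
  have "rep_alg n \<rho> (a \<star> b) $$ (i, j) = (\<Sum>x\<in>carrier G. \<Sum>g\<in>carrier G. a g * b (inv g \<otimes> x) * \<rho> x $$ (i, j))"
    using ij by (simp add: rep_alg_index conv_def sum_distrib_right)
  also have "\<dots> = (\<Sum>g\<in>carrier G. \<Sum>x\<in>carrier G. a g * b (inv g \<otimes> x) * \<rho> x $$ (i, j))"
    by (rule sum.swap)
  also have "\<dots> = (\<Sum>g\<in>carrier G. \<Sum>y\<in>carrier G. a g * b y * \<rho> (g \<otimes> y) $$ (i, j))"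
  proof (rule sum.cong[OF refl])
    fix g assume g: "g \<in> carrier G"
    show "(\<Sum>x\<in>carrier G. a g * b (inv g \<otimes> x) * \<rho> x $$ (i, j)) = (\<Sum>y\<in>carrier G. a g * b y * \<rho> (g \<otimes> y) $$ (i, j))"
      by (subst sum_left_mult[OF g, symmetric]) (simp add: g m_assoc[symmetric])
  qed
  also have "\<dots> = (\<Sum>g\<in>carrier G. \<Sum>y\<in>carrier G. \<Sum>k<n. (a g * \<rho> g $$ (i, k)) * (b y * \<rho> y $$ (k, j)))"
    using ij by (simp add: mat_representation_mult_index[OF \<rho>] sum_distrib_left mult_ac)
  also have "\<dots> = (\<Sum>g\<in>carrier G. \<Sum>k<n. \<Sum>y\<in>carrier G. (a g * \<rho> g $$ (i, k)) * (b y * \<rho> y $$ (k, j)))"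
    by (intro sum.cong refl sum.swap)
  also have "\<dots> = (\<Sum>k<n. \<Sum>g\<in>carrier G. \<Sum>y\<in>carrier G. (a g * \<rho> g $$ (i, k)) * (b y * \<rho> y $$ (k, j)))"
    by (rule sum.swap)
  also have "\<dots> = (\<Sum>k<n. rep_alg n \<rho> a $$ (i, k) * rep_alg n \<rho> b $$ (k, j))"
    using ij by (simp add: rep_alg_index sum_product)
  also have "\<dots> = (rep_alg n \<rho> a * rep_alg n \<rho> b) $$ (i, j)"
    using ij by (simp add: mult_mat_index[of _ n n _ n] del: index_mult_mat(1))
  finally show "rep_alg n \<rho> (a \<star> b) $$ (i, j) = (rep_alg n \<rho> a * rep_alg n \<rho> b) $$ (i, j)" .
qed (auto simp: rep_alg_def)

lemma mat_trace_rep_alg: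
  "mat_representation G n \<rho> \<Longrightarrow> mat_trace (rep_alg n \<rho> a) = (\<Sum>g\<in>carrier G. a g * mat_trace (\<rho> g))"
proof -
  assume \<rho>: "mat_representation G n \<rho>"
  have "mat_trace (rep_alg n \<rho> a) = (\<Sum>i<n. \<Sum>g\<in>carrier G. a g * \<rho> g $$ (i, i))"
    by (simp add: mat_trace_def rep_alg_def)
  also have "\<dots> = (\<Sum>g\<in>carrier G. a g * mat_trace (\<rho> g))"
    using carrier_matD(1)[OF mat_representation_carrier[OF \<rho>]]
    by (subst sum.swap) (simp add: sum_distrib_left mat_trace_def)
  finally show ?thesis .
qed

lemma IrrE:
  assumes "\<psi> \<in> Irr G"
  obtains n \<rho> where "irreducible_mat_representation G n \<rho>" "mat_representation G n \<rho>" "n > 0"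
    "\<And>g. g \<in> carrier G \<Longrightarrow> \<psi> g = mat_trace (\<rho> g)" "\<psi> \<one> = of_nat n"
proof -
  obtain n \<rho> where \<rho>: "irreducible_mat_representation G n \<rho>" and \<psi>: "\<psi> = (\<lambda>g\<in>carrier G. \<Sum>i<n. \<rho> g $$ (i, i))"
    using assms by (auto simp: Irr_def)
  then have \<rho>': "mat_representation G n \<rho>" "n > 0" by (auto simp: irreducible_mat_representation_def)
  have tr: "\<psi> g = mat_trace (\<rho> g)" if "g \<in> carrier G" for g
    using that mat_representation_carrier[OF \<rho>'(1) that] by (simp add: \<psi> mat_trace_def)
  moreover have "\<psi> \<one> = of_nat n"
    using \<rho>'(1) by (simp add: tr mat_representation_def mat_trace_def)
  ultimately show thesis using \<rho> \<rho>' that by blast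
qed

lemma Irr_eqI:
  assumes "\<psi> \<in> Irr G" "\<phi> \<in> Irr G" "\<And>g. g \<in> carrier G \<Longrightarrow> \<psi> g = \<phi> g"
  shows "\<psi> = \<phi>"
  using assms unfolding Irr_def by (auto simp: restrict_def fun_eq_iff)

text \<open>The matrix \<open>T\<close> below is the average of \<open>\<rho>(h) E\<^sub>j\<^sub>k \<sigma>(h\<inverse>)\<close>, an intertwiner.\<close>

lemma average_intertwines:
  fixes \<rho> \<sigma> :: "'g \<Rightarrow> 'K::field mat"
  assumes \<rho>: "mat_representation G n \<rho>" and \<sigma>: "mat_representation G m \<sigma>" and jk: "j < n" "k < m"
  defines "T \<equiv> mat n m (\<lambda>(i, l). \<Sum>h\<in>carrier G. \<rho> h $$ (i, j) * \<sigma> (inv h) $$ (k, l))"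
  assumes g: "g \<in> carrier G"
  shows "\<rho> g * T = T * \<sigma> g"
proof (rule eq_matI)
  note \<rho>c = mat_representation_carrier[OF \<rho> g] and \<sigma>c = mat_representation_carrier[OF \<sigma> g]
  have T: "T \<in> carrier_mat n m" by (simp add: T_def)
  fix i l assume "i < dim_row (T * \<sigma> g)" "l < dim_col (T * \<sigma> g)"
  then have il: "i < n" "l < m" using T \<sigma>c by auto
  have "(\<rho> g * T) $$ (i, l) = (\<Sum>p<n. \<Sum>h\<in>carrier G. \<rho> g $$ (i, p) * \<rho> h $$ (p, j) * \<sigma> (inv h) $$ (k, l))"
    using il by (simp add: mult_mat_index[OF \<rho>c T] del: index_mult_mat(1)) (simp add: T_def sum_distrib_left mult.assoc)
  also have "\<dots> = (\<Sum>h\<in>carrier G. \<rho> (g \<otimes> h) $$ (i, j) * \<sigma> (inv h) $$ (k, l))"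
    using il jk g by (subst sum.swap) (simp add: mat_representation_mult_index[OF \<rho>] sum_distrib_right)
  also have "\<dots> = (\<Sum>h\<in>carrier G. \<rho> (g \<otimes> h) $$ (i, j) * \<sigma> (inv (g \<otimes> h) \<otimes> g) $$ (k, l))"
    using g by (intro sum.cong refl) (simp add: inv_mult_group m_assoc)
  also have "\<dots> = (\<Sum>h\<in>carrier G. \<rho> h $$ (i, j) * \<sigma> (inv h \<otimes> g) $$ (k, l))"
    by (rule sum_left_mult[OF g])
  also have "\<dots> = (\<Sum>h\<in>carrier G. \<Sum>p<m. \<rho> h $$ (i, j) * \<sigma> (inv h) $$ (k, p) * \<sigma> g $$ (p, l))"
    using il jk g by (simp add: mat_representation_mult_index[OF \<sigma>] sum_distrib_left mult.assoc)
  also have "\<dots> = (T * \<sigma> g) $$ (i, l)"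
    unfolding mult_mat_index[OF T \<sigma>c il] using il by (subst sum.swap) (simp add: T_def sum_distrib_right)
  finally show "(\<rho> g * T) $$ (i, l) = (T * \<sigma> g) $$ (i, l)" .
qed (use mat_representation_carrier[OF \<rho> g] mat_representation_carrier[OF \<sigma> g] in \<open>auto simp: T_def\<close>)

text \<open>The matrix coefficient sums are entries of averaged intertwiners. These vanish by
  Schur's lemma, since an invertible one would make the two characters equal. The free factor g is
  what turns the relation into one about products of idempotents.\<close>

lemma Irr_conv_neq:
  fixes \<psi> \<phi> :: "'g \<Rightarrow> 'K::field"
  assumes \<psi>: "\<psi> \<in> Irr G" and \<phi>: "\<phi> \<in> Irr G" and neq: "\<psi> \<noteq> \<phi>" and g: "g \<in> carrier G"
  shows "(\<Sum>h\<in>carrier G. \<psi> (inv h) * \<phi> (h \<otimes> g)) = 0"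
proof -
  obtain n \<rho> where \<rho>: "irreducible_mat_representation G n \<rho>" "mat_representation G n \<rho>" "n > 0"
    "\<And>g. g \<in> carrier G \<Longrightarrow> \<phi> g = mat_trace (\<rho> g)" "\<phi> \<one> = of_nat n" by (rule IrrE[OF \<phi>]) blast
  obtain m \<sigma> where \<sigma>: "irreducible_mat_representation G m \<sigma>" "mat_representation G m \<sigma>" "m > 0"
    "\<And>g. g \<in> carrier G \<Longrightarrow> \<psi> g = mat_trace (\<sigma> g)" "\<psi> \<one> = of_nat m" by (rule IrrE[OF \<psi>]) blast
  have zero: "(\<Sum>h\<in>carrier G. \<rho> h $$ (i, j) * \<sigma> (inv h) $$ (k, l)) = 0"
    if "i < n" "j < n" "k < m" "l < m" for i j k l
  proof -
    define T where "T = mat n m (\<lambda>(i, l). \<Sum>h\<in>carrier G. \<rho> h $$ (i, j) * \<sigma> (inv h) $$ (k, l))"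
    have T: "T \<in> carrier_mat n m" by (simp add: T_def)
    have comm: "\<rho> g * T = T * \<sigma> g" if "g \<in> carrier G" for g
      unfolding T_def by (rule average_intertwines[OF \<rho>(2) \<sigma>(2) \<open>j < n\<close> \<open>k < m\<close> that])
    have "T = 0\<^sub>m n m"
    proof (rule ccontr)
      assume "T \<noteq> 0\<^sub>m n m"
      then obtain S where S: "S \<in> carrier_mat m n" "T * S = 1\<^sub>m n" "S * T = 1\<^sub>m m"
        by (rule schur_intertwiner[OF \<rho>(1) \<sigma>(1) T _ comm])
      have "\<phi> x = \<psi> x" if x: "x \<in> carrier G" for x
      proof -
        note \<rho>c = mat_representation_carrier[OF \<rho>(2) x] and \<sigma>c = mat_representation_carrier[OF \<sigma>(2) x]
        have "\<rho> x = \<rho> x * T * S" using \<rho>c T S by (simp add: assoc_mult_mat[of _ n n _ m _ n])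
        also have "\<dots> = T * (\<sigma> x * S)" unfolding comm[OF x] using \<sigma>c T S by (simp add: assoc_mult_mat[of _ n m _ m _ n])
        finally have "mat_trace (\<rho> x) = mat_trace (T * (\<sigma> x * S))" by simp
        also have "\<dots> = mat_trace ((\<sigma> x * S) * T)" using \<sigma>c T S by (intro mat_trace_comm) auto
        also have "(\<sigma> x * S) * T = \<sigma> x" using \<sigma>c T S by (simp add: assoc_mult_mat[of _ m m _ n _ m])
        finally show ?thesis by (simp add: \<rho>(4) \<sigma>(4) x)
      qed
      then show False using Irr_eqI[OF \<phi> \<psi>] neq by simp
    qed
    from arg_cong[OF this, of "\<lambda>A. A $$ (i, l)"] show ?thesis
      using that by (simp add: T_def)
  qed
  \<comment> \<open>The trace of \<rho>(h)\<rho>(g) is written out so that h occurs only in the sums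
    handled by \<open>zero\<close>.\<close>
  have "\<psi> (inv h) * \<phi> (h \<otimes> g) = (\<Sum>k<m. \<Sum>i<n. \<Sum>j<n. \<rho> g $$ (j, i) * (\<rho> h $$ (i, j) * \<sigma> (inv h) $$ (k, k)))"
    if h: "h \<in> carrier G" for h
  proof -
    have d: "dim_row (\<sigma> (inv h)) = m" "dim_row (\<rho> (h \<otimes> g)) = n"
      using mat_representation_carrier[OF \<sigma>(2), of "inv h"] mat_representation_carrier[OF \<rho>(2), of "h \<otimes> g"] h g by auto
    have "\<psi> (inv h) * \<phi> (h \<otimes> g) = (\<Sum>k<m. \<sigma> (inv h) $$ (k, k)) * (\<Sum>i<n. \<Sum>j<n. \<rho> h $$ (i, j) * \<rho> g $$ (j, i))"
      using h g by (simp add: \<rho>(4) \<sigma>(4) mat_trace_def d mat_representation_mult_index[OF \<rho>(2)])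
    then show ?thesis
      unfolding sum_distrib_right unfolding sum_distrib_left by (simp add: mult_ac)
  qed
  then have "(\<Sum>h\<in>carrier G. \<psi> (inv h) * \<phi> (h \<otimes> g)) =
      (\<Sum>h\<in>carrier G. \<Sum>k<m. \<Sum>i<n. \<Sum>j<n. \<rho> g $$ (j, i) * (\<rho> h $$ (i, j) * \<sigma> (inv h) $$ (k, k)))"
    by (rule sum.cong[OF refl])
  also have "\<dots> = (\<Sum>k<m. \<Sum>i<n. \<Sum>j<n. \<rho> g $$ (j, i) * (\<Sum>h\<in>carrier G. \<rho> h $$ (i, j) * \<sigma> (inv h) $$ (k, k)))"
    by (subst sum.swap, rule sum.cong[OF refl], subst sum.swap, rule sum.cong[OF refl], subst sum.swap)
      (simp add: sum_distrib_left)
  also have "\<dots> = 0"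
    by (intro sum.neutral ballI) (simp add: zero)
  finally show ?thesis .
qed

text \<open>Here the averaged intertwiner is a scalar matrix. The scalar is found from its trace,
  where the sum over i contracts \<rho>(h\<inverse>)\<rho>(h) to the identity matrix.\<close>

lemma Irr_conv_self:
  fixes \<psi> :: "'g \<Rightarrow> 'K::{alg_closed_field, field_char_0}"
  assumes \<psi>: "\<psi> \<in> Irr G" and g: "g \<in> carrier G"
  shows "(\<Sum>h\<in>carrier G. \<psi> (inv h) * \<psi> (h \<otimes> g)) = of_nat (card (carrier G)) / \<psi> \<one> * \<psi> g"
proof -
  obtain n \<rho> where \<rho>: "irreducible_mat_representation G n \<rho>" "mat_representation G n \<rho>" "n > 0"
    "\<And>g. g \<in> carrier G \<Longrightarrow> \<psi> g = mat_trace (\<rho> g)" "\<psi> \<one> = of_nat n" by (rule IrrE[OF \<psi>]) blast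
  let ?c = "of_nat (card (carrier G)) / of_nat n :: 'K"
  have val: "(\<Sum>h\<in>carrier G. \<rho> h $$ (i, j) * \<rho> (inv h) $$ (k, l)) = (if i = l \<and> j = k then ?c else 0)"
    if ijkl: "i < n" "j < n" "k < n" "l < n" for i j k l
  proof -
    define T where "T = mat n n (\<lambda>(i, l). \<Sum>h\<in>carrier G. \<rho> h $$ (i, j) * \<rho> (inv h) $$ (k, l))"
    have "T \<in> carrier_mat n n" by (simp add: T_def)
    moreover have "\<rho> g * T = T * \<rho> g" if "g \<in> carrier G" for g
      unfolding T_def by (rule average_intertwines[OF \<rho>(2) \<rho>(2) ijkl(2,3) that])
    ultimately obtain c where c: "T = c \<cdot>\<^sub>m 1\<^sub>m n"
      by (rule schur_scalar[OF \<rho>(1)])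
    have "of_nat n * c = mat_trace T" by (simp add: c mat_trace_def)
    also have "\<dots> = (\<Sum>h\<in>carrier G. \<Sum>i<n. \<rho> (inv h) $$ (k, i) * \<rho> h $$ (i, j))"
      by (subst sum.swap) (simp add: mat_trace_def T_def mult.commute)
    also have "\<dots> = (\<Sum>h\<in>carrier G. \<rho> \<one> $$ (k, j))"
      using ijkl by (intro sum.cong refl) (simp flip: mat_representation_mult_index[OF \<rho>(2)])
    also have "\<dots> = (if j = k then of_nat (card (carrier G)) else 0)"
      using \<rho>(2) ijkl by (simp add: mat_representation_def)
    finally have "c = (if j = k then ?c else 0)"
      using \<rho>(3) by (auto simp: field_simps)
    then show ?thesis
      using arg_cong[OF c, of "\<lambda>A. A $$ (i, l)"] ijkl by (simp add: T_def)
  qed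
  have "\<psi> (inv h) * \<psi> (h \<otimes> g) = (\<Sum>k<n. \<Sum>i<n. \<Sum>j<n. \<rho> g $$ (j, i) * (\<rho> h $$ (i, j) * \<rho> (inv h) $$ (k, k)))"
    if h: "h \<in> carrier G" for h
  proof -
    have d: "dim_row (\<rho> (inv h)) = n" "dim_row (\<rho> (h \<otimes> g)) = n"
      using mat_representation_carrier[OF \<rho>(2), of "inv h"] mat_representation_carrier[OF \<rho>(2), of "h \<otimes> g"] h g by auto
    have "\<psi> (inv h) * \<psi> (h \<otimes> g) = (\<Sum>k<n. \<rho> (inv h) $$ (k, k)) * (\<Sum>i<n. \<Sum>j<n. \<rho> h $$ (i, j) * \<rho> g $$ (j, i))"
      using h g by (simp add: \<rho>(4) mat_trace_def d mat_representation_mult_index[OF \<rho>(2)])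
    then show ?thesis
      unfolding sum_distrib_right unfolding sum_distrib_left by (simp add: mult_ac)
  qed
  then have "(\<Sum>h\<in>carrier G. \<psi> (inv h) * \<psi> (h \<otimes> g)) =
      (\<Sum>h\<in>carrier G. \<Sum>k<n. \<Sum>i<n. \<Sum>j<n. \<rho> g $$ (j, i) * (\<rho> h $$ (i, j) * \<rho> (inv h) $$ (k, k)))"
    by (rule sum.cong[OF refl])
  also have "\<dots> = (\<Sum>k<n. \<Sum>i<n. \<Sum>j<n. \<rho> g $$ (j, i) * (\<Sum>h\<in>carrier G. \<rho> h $$ (i, j) * \<rho> (inv h) $$ (k, k)))"
    by (subst sum.swap, rule sum.cong[OF refl], subst sum.swap, rule sum.cong[OF refl], subst sum.swap)
      (simp add: sum_distrib_left)
  also have "\<dots> = (\<Sum>k<n. \<Sum>i<n. \<Sum>j<n. if i = k \<and> j = k then \<rho> g $$ (j, i) * ?c else 0)"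
    by (intro sum.cong refl) (auto simp: val)
  also have "\<dots> = (\<Sum>k<n. \<rho> g $$ (k, k) * ?c)"
  proof (rule sum.cong[OF refl])
    fix k assume k: "k \<in> {..<n}"
    have "(\<Sum>i<n. \<Sum>j<n. if i = k \<and> j = k then \<rho> g $$ (j, i) * ?c else 0) =
        (\<Sum>i<n. if i = k then \<rho> g $$ (k, k) * ?c else 0)"
      using k by (intro sum.cong refl) auto
    also have "\<dots> = \<rho> g $$ (k, k) * ?c" using k by simp
    finally show "(\<Sum>i<n. \<Sum>j<n. if i = k \<and> j = k then \<rho> g $$ (j, i) * ?c else 0) = \<rho> g $$ (k, k) * ?c" .
  qed
  also have "\<dots> = ?c * \<psi> g"
    using g mat_representation_carrier[OF \<rho>(2) g] by (simp add: \<rho>(4) mat_trace_def sum_distrib_left mult.commute)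
  finally show ?thesis using \<rho>(5) by simp
qed

lemma central_scalar:
  fixes f :: "'g \<Rightarrow> 'K::alg_closed_field"
  assumes "irreducible_mat_representation G n \<rho>" and f: "\<And>g. g \<in> carrier G \<Longrightarrow> point g \<star> f = f \<star> point g"
  obtains c where "rep_alg n \<rho> f = c \<cdot>\<^sub>m 1\<^sub>m n"
proof -
  have \<rho>: "mat_representation G n \<rho>" using assms(1) by (simp add: irreducible_mat_representation_def)
  have "\<rho> g * rep_alg n \<rho> f = rep_alg n \<rho> f * \<rho> g" if g: "g \<in> carrier G" for g
    using arg_cong[OF f[OF g], of "rep_alg n \<rho>"] by (simp add: rep_alg_conv[OF \<rho>] rep_alg_point[OF \<rho> g])
  then show thesis
    by (rule schur_scalar[OF assms(1) rep_alg_carrier]) (assumption | rule that)+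
qed

end

section \<open>Constituents of left ideals and central idempotents\<close>

lemma subspace_vecD:
  fixes U :: "'K::field vec set"
  assumes "VectorSpace.subspace class_ring U (module_vec TYPE('K) n)"
  shows "U \<subseteq> carrier_vec n" "0\<^sub>v n \<in> U" "\<And>u v. u \<in> U \<Longrightarrow> v \<in> U \<Longrightarrow> u + v \<in> U" "\<And>c u. u \<in> U \<Longrightarrow> c \<cdot>\<^sub>v u \<in> U"
proof -
  have sub: "submodule class_ring U (module_vec TYPE('K) n)"
    using assms by (simp add: VectorSpace.subspace_def)
  show "U \<subseteq> carrier_vec n" using submodule.subset[OF sub] by (simp add: module_vec_simps)
  show "0\<^sub>v n \<in> U" using submodule.zero_closed[OF sub] by (simp add: module_vec_simps)
  show "u + v \<in> U" if "u \<in> U" "v \<in> U" for u v using submodule.m_closed[OF sub that] by (simp add: module_vec_simps)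
  show "c \<cdot>\<^sub>v u \<in> U" if "u \<in> U" for c u using submodule.smult_closed[OF sub _ that, of c] by (simp add: module_vec_simps)
qed

context finite_group
begin

lemma galg_subset_span: "galg \<subseteq> fs.span (point ` carrier G)"
proof
  fix a :: "'g \<Rightarrow> 'k::field" assume "a \<in> galg"
  from galg_expand[OF this] show "a \<in> fs.span (point ` carrier G)"
    by (metis (mono_tags, lifting) fs.span_sum fs.span_scale fs.span_base imageI)
qed

text \<open>The character \<open>\<psi>\<close> is afforded by a minimal nonzero left ideal inside \<open>W0\<close>.\<close>

lemma irreducible_in_left_ideal:
  fixes W0 :: "('g \<Rightarrow> 'K::field_char_0) set"
  assumes W0: "fs.subspace W0" "W0 \<subseteq> galg" "\<And>g a. g \<in> carrier G \<Longrightarrow> a \<in> W0 \<Longrightarrow> point g \<star> a \<in> W0"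
    and a0: "a0 \<in> W0" "a0 \<noteq> 0" and z: "\<And>a. a \<in> W0 \<Longrightarrow> z \<star> a = a"
  shows "\<exists>\<psi>\<in>Irr G. (\<Sum>g\<in>carrier G. z g * \<psi> g) \<noteq> 0"
proof -
  define P where "P W \<longleftrightarrow> fs.subspace W \<and> W \<subseteq> W0 \<and> (\<forall>g\<in>carrier G. \<forall>a\<in>W. point g \<star> a \<in> W) \<and> W \<noteq> {0}"
    for W :: "('g \<Rightarrow> 'K) set"
  have "P W0" using W0 a0 by (auto simp: P_def)
  from ex_has_least_nat[of P, OF this, of fs.dim]
  obtain W where W: "P W" and min: "\<And>W'. P W' \<Longrightarrow> fs.dim W \<le> fs.dim W'" by blast
  have Wsub: "fs.subspace W" and WW0: "\<And>a. a \<in> W \<Longrightarrow> a \<in> W0" and Winv: "\<And>g a. g \<in> carrier G \<Longrightarrow> a \<in> W \<Longrightarrow> point g \<star> a \<in> W" and W0': "W \<noteq> {0}"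
    using W by (auto simp: P_def)
  obtain B where B: "B \<subseteq> W" "fs.independent B" "W \<subseteq> fs.span B" "card B = fs.dim W"
    by (rule fs.basis_exists)
  have "B \<subseteq> fs.span (point ` carrier G)"
    using B(1) WW0 W0(2) galg_subset_span by fast
  then have finB: "finite B"
    using fs.independent_span_bound[OF finite_imageI[OF finite_carrier] B(2)] by blast
  obtain xs where xs: "set xs = B" "distinct xs" using finite_distinct_list[OF finB] by blast
  define n where "n = length xs"
  have bij: "bij_betw ((!) xs) {..<n} B"
    using xs bij_betw_nth[of xs "{..<n}" B] by (simp add: n_def)
  have xsB: "xs ! i \<in> B" if "i < n" for i using that xs by (auto simp: n_def)
  have xsW: "xs ! i \<in> W" if "i < n" for i using xsB[OF that] B(1) by blast
  define r where "r = fs.representation B"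
  have inspan: "a \<in> fs.span B" if "a \<in> W" for a using that B(3) by blast
  have r_sum: "r (\<Sum>i\<in>I. fscale (c i) (F i)) x = (\<Sum>i\<in>I. c i * r (F i) x)"
    if "\<And>i. i \<in> I \<Longrightarrow> F i \<in> W" for I :: "'i set" and c F x
  proof -
    have "r (\<Sum>i\<in>I. fscale (c i) (F i)) x = (\<Sum>i\<in>I. r (fscale (c i) (F i)) x)"
      unfolding r_def by (rule fun_cong[OF fs.representation_sum[OF B(2)]]) (intro fs.span_scale inspan that)
    also have "\<dots> = (\<Sum>i\<in>I. c i * r (F i) x)"
      unfolding r_def using fs.representation_scale[OF B(2) inspan[OF that]] by (intro sum.cong refl) simp
    finally show ?thesis .
  qed
  have r_xs: "r (xs ! j) (xs ! i) = (if i = j then 1 else 0)" if "i < n" "j < n" for i j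
    using fs.representation_basis[OF B(2) xsB[OF that(2)]] nth_eq_iff_index_eq[OF xs(2)] that by (auto simp: r_def n_def)
  have expand: "a = (\<Sum>i<n. fscale (r a (xs ! i)) (xs ! i))" if "a \<in> W" for a
  proof -
    have "a = (\<Sum>b\<in>B. fscale (r a b) b)"
      using fs.sum_representation_eq[OF B(2) inspan[OF that] finB order_refl] by (simp add: r_def)
    also have "\<dots> = (\<Sum>i<n. fscale (r a (xs ! i)) (xs ! i))"
      by (rule sum.reindex_bij_betw[OF bij, symmetric])
    finally show ?thesis .
  qed
  have L: "r (point g \<star> a) x = (\<Sum>k<n. r a (xs ! k) * r (point g \<star> (xs ! k)) x)"
    if "g \<in> carrier G" "a \<in> W" for g a x
  proof -
    have "point g \<star> a = point g \<star> (\<Sum>k<n. fscale (r a (xs ! k)) (xs ! k))"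
      by (rule arg_cong[OF expand[OF that(2)]])
    also have "\<dots> = (\<Sum>k<n. fscale (r a (xs ! k)) (point g \<star> (xs ! k)))"
      by (simp only: conv_sum_right conv_scale_right)
    finally have "r (point g \<star> a) x = r (\<Sum>k<n. fscale (r a (xs ! k)) (point g \<star> (xs ! k))) x"
      by (rule arg_cong[where f = "\<lambda>a. r a x"])
    also have "\<dots> = (\<Sum>k<n. r a (xs ! k) * r (point g \<star> (xs ! k)) x)"
      using that xsW Winv by (intro r_sum) simp
    finally show ?thesis .
  qed
  define \<rho> where "\<rho> g = mat n n (\<lambda>(i, j). r (point g \<star> (xs ! j)) (xs ! i))" for g
  have \<rho>_rep: "mat_representation G n \<rho>"
    unfolding mat_representation_def
  proof (intro conjI ballI)
    show "\<rho> g \<in> carrier_mat n n" for g by (simp add: \<rho>_def)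
    have "point \<one> \<star> (xs ! j) = xs ! j" if "j < n" for j
      using xsW[OF that] WW0 W0(2) by (intro one_conv) blast
    then show "\<rho> \<one> = 1\<^sub>m n"
      by (intro eq_matI) (auto simp: \<rho>_def r_xs)
    fix g h assume gh: "g \<in> carrier G" "h \<in> carrier G"
    show "\<rho> (g \<otimes> h) = \<rho> g * \<rho> h"
    proof (rule eq_matI)
      fix i j assume "i < dim_row (\<rho> g * \<rho> h)" "j < dim_col (\<rho> g * \<rho> h)"
      then have ij: "i < n" "j < n" by (auto simp: \<rho>_def)
      have "point (g \<otimes> h) \<star> (xs ! j) = point g \<star> (point h \<star> (xs ! j))"
        using gh by (simp add: point_mult flip: conv_assoc)
      then have "\<rho> (g \<otimes> h) $$ (i, j) = (\<Sum>k<n. r (point h \<star> (xs ! j)) (xs ! k) * r (point g \<star> (xs ! k)) (xs ! i))"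
        using ij L[OF gh(1) Winv[OF gh(2) xsW[OF ij(2)]]] by (simp add: \<rho>_def)
      also have "\<dots> = (\<Sum>k<n. \<rho> g $$ (i, k) * \<rho> h $$ (k, j))"
        using ij by (simp add: \<rho>_def mult.commute)
      also have "\<dots> = (\<rho> g * \<rho> h) $$ (i, j)"
        by (rule mult_mat_index[symmetric]) (use ij in \<open>auto simp: \<rho>_def\<close>)
      finally show "\<rho> (g \<otimes> h) $$ (i, j) = (\<rho> g * \<rho> h) $$ (i, j)" .
    qed (auto simp: \<rho>_def)
  qed
  \<comment> \<open>The coordinate isomorphism from column vectors onto \<open>W\<close>. It carries
    an invariant subspace of vectors into \<open>W\<close>, where minimality applies.\<close>
  define \<phi> where "\<phi> u = (\<Sum>i<n. fscale (u $ i) (xs ! i))" for u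
  have \<phi>W: "\<phi> u \<in> W" for u
    unfolding \<phi>_def using xsW by (intro fs.subspace_sum[OF Wsub] fs.subspace_scale[OF Wsub]) simp
  have r_\<phi>: "r (\<phi> u) (xs ! j) = u $ j" if "j < n" for u j
  proof -
    have "r (\<phi> u) (xs ! j) = (\<Sum>i<n. u $ i * r (xs ! i) (xs ! j))"
      unfolding \<phi>_def by (rule r_sum) (simp add: xsW)
    also have "\<dots> = (\<Sum>i<n. if i = j then u $ i else 0)"
      using that by (intro sum.cong refl) (simp add: r_xs)
    finally show ?thesis using that by simp
  qed
  have \<phi>_inj: "u = v" if "u \<in> carrier_vec n" "v \<in> carrier_vec n" "\<phi> u = \<phi> v" for u v
  proof (rule eq_vecI)
    fix i assume "i < dim_vec v"
    then show "u $ i = v $ i" using that r_\<phi>[of i u] r_\<phi>[of i v] by simp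
  qed (use that in auto)
  have \<phi>_act: "point g \<star> \<phi> u = \<phi> (\<rho> g *\<^sub>v u)" if g: "g \<in> carrier G" and u: "u \<in> carrier_vec n" for g u
  proof -
    have "r (point g \<star> \<phi> u) (xs ! i) = (\<rho> g *\<^sub>v u) $ i" if i: "i < n" for i
    proof -
      have "r (point g \<star> \<phi> u) (xs ! i) = (\<Sum>k<n. u $ k * r (point g \<star> (xs ! k)) (xs ! i))"
        unfolding L[OF g \<phi>W] by (intro sum.cong refl) (simp add: r_\<phi>)
      also have "\<dots> = (\<rho> g *\<^sub>v u) $ i"
        using i u by (simp add: \<rho>_def scalar_prod_def atLeast0LessThan mult.commute)
      finally show ?thesis .
    qed
    then show ?thesis
      unfolding \<phi>_def[of "\<rho> g *\<^sub>v u"] by (subst expand[OF Winv[OF g \<phi>W]]) (intro sum.cong refl, simp)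
  qed
  have npos: "n > 0"
  proof (rule ccontr)
    assume "\<not> n > 0"
    then have "a = 0" if "a \<in> W" for a using expand[OF that] by simp
    then have "W \<subseteq> {0}" by blast
    then show False using W0' fs.subspace_0[OF Wsub] by blast
  qed
  have irr: "irreducible_mat_representation G n \<rho>"
    unfolding irreducible_mat_representation_def
  proof (intro conjI allI impI \<rho>_rep npos)
    fix U :: "'K vec set"
    assume U: "VectorSpace.subspace class_ring U (module_vec TYPE('K) n) \<and> (\<forall>g\<in>carrier G. \<forall>w\<in>U. \<rho> g *\<^sub>v w \<in> U)"
    note Us = subspace_vecD[OF conjunct1[OF U]]
    define W' where "W' = \<phi> ` U"
    have W'sub: "fs.subspace W'"
    proof (rule fs.subspaceI)
      have "\<phi> (0\<^sub>v n) = 0" unfolding \<phi>_def by (rule sum.neutral) simp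
      then show "0 \<in> W'" unfolding W'_def using Us(2) by (metis imageI)
    next
      fix a b assume "a \<in> W'" "b \<in> W'"
      then obtain u v where uv: "u \<in> U" "v \<in> U" "a = \<phi> u" "b = \<phi> v" by (auto simp: W'_def)
      have "u \<in> carrier_vec n" "v \<in> carrier_vec n" using uv Us(1) by auto
      then have "a + b = \<phi> (u + v)"
        unfolding uv(3,4) \<phi>_def sum.distrib[symmetric] by (intro sum.cong refl) (simp add: fs.scale_left_distrib)
      then show "a + b \<in> W'" unfolding W'_def using Us(3)[OF uv(1,2)] by (metis imageI)
    next
      fix c a assume "a \<in> W'"
      then obtain u where u: "u \<in> U" "a = \<phi> u" by (auto simp: W'_def)
      have "u \<in> carrier_vec n" using u Us(1) by auto
      then have "fscale c a = \<phi> (c \<cdot>\<^sub>v u)"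
        unfolding u(2) \<phi>_def fs.scale_sum_right by (intro sum.cong refl) simp
      then show "fscale c a \<in> W'" unfolding W'_def using Us(4)[OF u(1)] by (metis imageI)
    qed
    have W'W: "W' \<subseteq> W" using \<phi>W by (auto simp: W'_def)
    have W'inv: "point g \<star> a \<in> W'" if g: "g \<in> carrier G" and a: "a \<in> W'" for g a
    proof -
      obtain u where u: "u \<in> U" "a = \<phi> u" using a by (auto simp: W'_def)
      have "point g \<star> a = \<phi> (\<rho> g *\<^sub>v u)" using \<phi>_act[OF g] u Us(1) by auto
      moreover have "\<rho> g *\<^sub>v u \<in> U" using U g u by blast
      ultimately show ?thesis unfolding W'_def by (metis imageI)
    qed
    show "U = {0\<^sub>v n} \<or> U = carrier_vec n"
    proof (cases "W' = {0}")
      case True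
      have "u = 0\<^sub>v n" if u: "u \<in> U" for u
      proof (rule \<phi>_inj)
        have "\<phi> u \<in> W'" "\<phi> (0\<^sub>v n) \<in> W'" using u Us(2) by (simp_all add: W'_def)
        then show "\<phi> u = \<phi> (0\<^sub>v n)" using True by simp
      qed (use u Us(1) in auto)
      then show ?thesis using Us(2) by blast
    next
      case False
      have "W' \<subseteq> W0" using W'W WW0 by blast
      then have "P W'" using W'sub W'inv False by (simp add: P_def)
      note dim = min[OF this]
      obtain B' where B': "B' \<subseteq> W'" "fs.independent B'" "W' \<subseteq> fs.span B'" "card B' = fs.dim W'"
        by (rule fs.basis_exists)
      have "W \<subseteq> W'"
      proof
        fix w assume w: "w \<in> W"
        show "w \<in> W'"
        proof (rule ccontr)
          assume "w \<notin> W'"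
          then have "w \<notin> fs.span B'" using fs.span_minimal[OF B'(1) W'sub] by blast
          \<comment> \<open>Enlarging a basis of \<open>W'\<close> by w would give more independent
            vectors than the dimension of \<open>W\<close>, which by minimality is at most that of
            \<open>W'\<close>.\<close>
          then have ind: "fs.independent (insert w B')" "w \<notin> B'"
            using B'(2) fs.span_base by (auto simp: fs.independent_insert)
          have "insert w B' \<subseteq> fs.span B" using w B'(1) W'W inspan by blast
          from fs.independent_span_bound[OF finB ind(1) this]
          have "finite (insert w B')" "card (insert w B') \<le> card B" by auto
          then show False using ind(2) dim B(4) B'(4) by simp
        qed
      qed
      have "w \<in> U" if w: "w \<in> carrier_vec n" for w
      proof -
        have "\<phi> w \<in> W'" using \<phi>W \<open>W \<subseteq> W'\<close> by blast
        then obtain u where u: "u \<in> U" "\<phi> w = \<phi> u" by (auto simp: W'_def)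
        then have "w = u" using \<phi>_inj[OF w] Us(1) by blast
        then show ?thesis using u by simp
      qed
      then show ?thesis using Us(1) by blast
    qed
  qed
  define \<psi> where "\<psi> = (\<lambda>g\<in>carrier G. \<Sum>i<n. \<rho> g $$ (i, i))"
  have "\<psi> \<in> Irr G" using irr by (auto simp: Irr_def \<psi>_def)
  \<comment> \<open>The sum is the trace of z on \<open>W\<close>, and z acts there as the
    identity.\<close>
  moreover have "(\<Sum>g\<in>carrier G. z g * \<psi> g) = of_nat n"
  proof -
    have "(\<Sum>g\<in>carrier G. z g * \<psi> g) = (\<Sum>g\<in>carrier G. \<Sum>i<n. z g * r (point g \<star> (xs ! i)) (xs ! i))"
      by (simp add: \<psi>_def \<rho>_def sum_distrib_left)
    also have "\<dots> = (\<Sum>i<n. \<Sum>g\<in>carrier G. z g * r (point g \<star> (xs ! i)) (xs ! i))"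
      by (rule sum.swap)
    also have "\<dots> = (\<Sum>i<n. 1)"
    proof (rule sum.cong[OF refl])
      fix i assume "i \<in> {..<n}"
      then have i: "i < n" by simp
      have "(\<Sum>g\<in>carrier G. z g * r (point g \<star> (xs ! i)) (xs ! i)) = r (z \<star> (xs ! i)) (xs ! i)"
        unfolding conv_expand[of z] using xsW[OF i] Winv by (intro r_sum[symmetric]) simp
      then show "(\<Sum>g\<in>carrier G. z g * r (point g \<star> (xs ! i)) (xs ! i)) = 1"
        using z[OF WW0[OF xsW[OF i]]] r_xs[OF i i] by simp
    qed
    finally show ?thesis by simp
  qed
  ultimately show ?thesis using npos by (metis of_nat_eq_0_iff less_numeral_extra(3))
qed

lemma Irr_class_function:
  fixes \<psi> :: "'g \<Rightarrow> 'K::field"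
  assumes \<psi>: "\<psi> \<in> Irr G" and "x \<in> carrier G" "y \<in> carrier G"
  shows "\<psi> (x \<otimes> y) = \<psi> (y \<otimes> x)"
proof -
  obtain n \<rho> where \<rho>: "mat_representation G n \<rho>" "\<And>g. g \<in> carrier G \<Longrightarrow> \<psi> g = mat_trace (\<rho> g)"
    by (rule IrrE[OF \<psi>]) blast
  then show ?thesis
    using assms(2,3) mat_trace_comm[OF mat_representation_carrier[OF \<rho>(1)] mat_representation_carrier[OF \<rho>(1)], of x y]
    by (simp add: mat_representation_def)
qed

lemma Irr_one_neq_0: "\<psi> \<in> Irr G \<Longrightarrow> \<psi> \<one> \<noteq> (0 :: 'K::field_char_0)"
  by (erule IrrE) simp

text \<open>The central idempotent that projects the group algebra onto its \<psi>-isotypic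
  part.\<close>

definition irr_idem :: "('g \<Rightarrow> 'K::field_char_0) \<Rightarrow> 'g \<Rightarrow> 'K" where
  "irr_idem \<psi> = (\<lambda>x. if x \<in> carrier G then \<psi> \<one> / of_nat (card (carrier G)) * \<psi> (inv x) else 0)"

lemma irr_idem_galg [simp]: "irr_idem \<psi> \<in> galg"
  by (simp add: galg_def irr_idem_def)

lemma irr_idem_central:
  assumes "\<psi> \<in> Irr G" "g \<in> carrier G"
  shows "point g \<star> irr_idem \<psi> = irr_idem \<psi> \<star> point g"
proof (rule galg_eqI)
  fix x assume "x \<in> carrier G"
  then show "(point g \<star> irr_idem \<psi>) x = (irr_idem \<psi> \<star> point g) x"
    using assms Irr_class_function[OF assms(1), of "inv x" g]
    by (simp add: point_conv conv_point irr_idem_def inv_mult_group)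
qed auto

lemma irr_idem_conv:
  fixes \<psi> \<phi> :: "'g \<Rightarrow> 'K::{alg_closed_field, field_char_0}"
  assumes \<psi>: "\<psi> \<in> Irr G" and \<phi>: "\<phi> \<in> Irr G"
  shows "irr_idem \<psi> \<star> irr_idem \<phi> = (if \<psi> = \<phi> then irr_idem \<psi> else 0)"
proof (rule galg_eqI)
  fix x assume x: "x \<in> carrier G"
  let ?c = "of_nat (card (carrier G)) :: 'K"
  have "(irr_idem \<psi> \<star> irr_idem \<phi>) x = (\<Sum>g\<in>carrier G. \<psi> \<one> / ?c * (\<phi> \<one> / ?c) * (\<psi> (inv g) * \<phi> (g \<otimes> inv x)))"
    using x Irr_class_function[OF \<phi>, of "inv x"]
    by (auto simp: conv_def irr_idem_def inv_mult_group intro!: sum.cong)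
  also have "\<dots> = \<psi> \<one> / ?c * (\<phi> \<one> / ?c) * (\<Sum>g\<in>carrier G. \<psi> (inv g) * \<phi> (g \<otimes> inv x))"
    by (simp only: sum_distrib_left)
  also have "\<dots> = (if \<psi> = \<phi> then irr_idem \<psi> else 0) x"
    using x Irr_conv_self[OF \<psi>, of "inv x"] Irr_conv_neq[OF \<psi> \<phi>, of "inv x"] Irr_one_neq_0[OF \<psi>]
    by (auto simp: irr_idem_def)
  finally show "(irr_idem \<psi> \<star> irr_idem \<phi>) x = (if \<psi> = \<phi> then irr_idem \<psi> else 0) x" .
qed auto

lemma irr_idem_sum_conv:
  fixes S :: "('g \<Rightarrow> 'K::{alg_closed_field, field_char_0}) set"
  assumes "finite S" "S \<subseteq> Irr G" "\<phi> \<in> Irr G"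
  shows "(\<Sum>\<psi>\<in>S. irr_idem \<psi>) \<star> irr_idem \<phi> = (if \<phi> \<in> S then irr_idem \<phi> else 0)"
proof -
  have "(\<Sum>\<psi>\<in>S. irr_idem \<psi>) \<star> irr_idem \<phi> = (\<Sum>\<psi>\<in>S. if \<psi> = \<phi> then irr_idem \<phi> else 0)"
    unfolding conv_sum_left using assms by (intro sum.cong refl) (auto simp: irr_idem_conv)
  then show ?thesis using assms(1) by simp
qed

text \<open>The set is an arbitrary finite one because the lemma first serves to show that
  \<open>Irr G\<close> is finite; afterwards it is applied to all of \<open>Irr G\<close>.\<close>

lemma irr_idem_complement:
  fixes S :: "('g \<Rightarrow> 'K::{alg_closed_field, field_char_0}) set"
  assumes S: "finite S" "S \<subseteq> Irr G"
  defines "z \<equiv> point \<one> - (\<Sum>\<psi>\<in>S. irr_idem \<psi>)"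
  shows "z \<in> galg" "z \<star> z = z" "\<And>\<phi>. \<phi> \<in> S \<Longrightarrow> z \<star> irr_idem \<phi> = 0"
    "\<And>g. g \<in> carrier G \<Longrightarrow> point g \<star> z = z \<star> point g"
proof -
  have e: "(\<Sum>\<psi>\<in>S. irr_idem \<psi>) \<in> galg" by (intro galg_sum irr_idem_galg)
  then show "z \<in> galg" by (simp add: z_def)
  show z0: "z \<star> irr_idem \<phi> = 0" if "\<phi> \<in> S" for \<phi>
  proof -
    have "\<phi> \<in> Irr G" using that S(2) by blast
    then show ?thesis using irr_idem_sum_conv[OF S] that by (simp add: z_def conv_diff_left)
  qed
  have "z \<star> (\<Sum>\<psi>\<in>S. irr_idem \<psi>) = 0"
    unfolding conv_sum_right by (rule sum.neutral) (simp add: z0)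
  moreover have "z \<star> point \<one> = z" using \<open>z \<in> galg\<close> by simp
  ultimately show "z \<star> z = z"
    by (subst (2) z_def) (simp add: conv_diff_right)
  fix g assume g: "g \<in> carrier G"
  have "point g \<star> (\<Sum>\<psi>\<in>S. irr_idem \<psi>) = (\<Sum>\<psi>\<in>S. irr_idem \<psi>) \<star> point g"
    unfolding conv_sum_left conv_sum_right using S(2) g by (intro sum.cong refl irr_idem_central) auto
  then show "point g \<star> z = z \<star> point g"
    using g by (simp add: z_def conv_diff_left conv_diff_right)
qed

text \<open>For a finite set S of irreducible characters the complement z is idempotent, so |G|z(1)
  = |G| - \<Sum>\<psi>(1)^2 is a natural number. Each degree is at least 1, which bounds the size of
  S by |G|.\<close>

lemma finite_Irr: "finite (Irr G :: ('g \<Rightarrow> 'K::{alg_closed_field, field_char_0}) set)"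
proof -
  have "card S \<le> card (carrier G)" if S: "S \<subseteq> Irr G" "finite S" for S :: "('g \<Rightarrow> 'K) set"
  proof -
    have "\<exists>d. \<psi> \<one> = of_nat d \<and> d > 0" if "\<psi> \<in> S" for \<psi>
      using that S(1) by (auto elim!: IrrE[of \<psi>])
    then obtain d where d: "\<And>\<psi>. \<psi> \<in> S \<Longrightarrow> \<psi> \<one> = of_nat (d \<psi>) \<and> d \<psi> > 0" by metis
    let ?z = "point \<one> - (\<Sum>\<psi>\<in>S. irr_idem \<psi>)"
    obtain n where "of_nat (card (carrier G)) * ?z \<one> = of_nat n"
      using idempotent_at_one(1)[OF irr_idem_complement(1,2)[OF S(2,1)]] by blast
    moreover have "(\<Sum>\<psi>\<in>S. irr_idem \<psi>) \<one> = of_nat (\<Sum>\<psi>\<in>S. d \<psi> * d \<psi>) / of_nat (card (carrier G))"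
      using d by (simp add: sum_fun_apply irr_idem_def sum_divide_distrib)
    ultimately have "of_nat (card (carrier G)) - of_nat (\<Sum>\<psi>\<in>S. d \<psi> * d \<psi>) = (of_nat n :: 'K)"
      by (simp add: point_def right_diff_distrib)
    then have "(of_nat (card (carrier G)) :: 'K) = of_nat (n + (\<Sum>\<psi>\<in>S. d \<psi> * d \<psi>))"
      by (simp only: of_nat_add diff_eq_eq)
    then have "card (carrier G) = n + (\<Sum>\<psi>\<in>S. d \<psi> * d \<psi>)"
      by (simp only: of_nat_eq_iff)
    moreover have "card S \<le> (\<Sum>\<psi>\<in>S. d \<psi> * d \<psi>)"
      unfolding card_eq_sum using d by (intro sum_mono) (simp add: Suc_leI)
    ultimately show ?thesis by simp
  qed
  then show ?thesis
    using finite_if_finite_subsets_card_bdd[of "Irr G :: ('g \<Rightarrow> 'K) set" "card (carrier G)"] by blast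
qed

text \<open>If the idempotents did not sum to 1, their complement z would act as the identity on a
  nonzero left ideal and so have a nonzero value on some \<psi>. Up to a nonzero factor that value
  is the coefficient at 1 of the product of z with the idempotent of \<psi>, which is zero.\<close>

lemma sum_Irr_regular:
  assumes g: "g \<in> carrier G"
  shows "(\<Sum>\<psi>\<in>(Irr G :: ('g \<Rightarrow> 'K::{alg_closed_field, field_char_0}) set). \<psi> \<one> * \<psi> g) =
    (if g = \<one> then of_nat (card (carrier G)) else 0)"
proof -
  let ?I = "Irr G :: ('g \<Rightarrow> 'K) set"
  define z :: "'g \<Rightarrow> 'K" where "z = point \<one> - (\<Sum>\<psi>\<in>?I. irr_idem \<psi>)"
  have z: "z \<in> galg" "z \<star> z = z" "\<And>\<phi>. \<phi> \<in> ?I \<Longrightarrow> z \<star> irr_idem \<phi> = 0"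
      "\<And>g. g \<in> carrier G \<Longrightarrow> point g \<star> z = z \<star> point g"
    unfolding z_def by (fact irr_idem_complement[OF finite_Irr order_refl])+
  have "z = 0"
  proof (rule ccontr)
    assume "z \<noteq> 0"
    define W where "W = {a \<in> galg. z \<star> a = a}"
    have W: "fs.subspace W"
      by (auto simp only: fs.subspace_def W_def mem_Collect_eq galg_zero conv_zero_right galg_add conv_add_right
          galg_scale conv_scale_right)
    have W_left: "point g \<star> a \<in> W" if "g \<in> carrier G" "a \<in> W" for g a
    proof -
      have "z \<star> (point g \<star> a) = point g \<star> (z \<star> a)"
        using z(4)[OF that(1)] by (metis conv_assoc)
      then show ?thesis using that by (simp add: W_def)
    qed
    have "W \<subseteq> galg" "z \<in> W" and zW: "\<And>a. a \<in> W \<Longrightarrow> z \<star> a = a"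
      using z(1,2) by (simp_all add: W_def)
    from irreducible_in_left_ideal[where z = z, OF W this(1) W_left this(2) \<open>z \<noteq> 0\<close> zW]
    obtain \<psi> where \<psi>: "\<psi> \<in> ?I" "(\<Sum>g\<in>carrier G. z g * \<psi> g) \<noteq> 0" by blast
    have "(z \<star> irr_idem \<psi>) \<one> = \<psi> \<one> / of_nat (card (carrier G)) * (\<Sum>g\<in>carrier G. z g * \<psi> g)"
      by (simp add: conv_def irr_idem_def sum_distrib_left mult_ac)
    then show False
      using \<psi> z(3)[OF \<psi>(1)] Irr_one_neq_0[OF \<psi>(1)] by simp
  qed
  then have "point \<one> (inv g) = (\<Sum>\<psi>\<in>?I. irr_idem \<psi>) (inv g)"
    by (simp add: z_def)
  also have "\<dots> = (\<Sum>\<psi>\<in>?I. \<psi> \<one> * \<psi> g) / of_nat (card (carrier G))"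
    using g by (simp add: sum_fun_apply irr_idem_def sum_divide_distrib)
  finally show ?thesis
    using g by (auto simp: point_def inv_eq_1_iff field_simps split: if_splits)
qed

lemma sum_Irr_inner:
  fixes \<phi> :: "'g \<Rightarrow> 'K::{alg_closed_field, field_char_0}"
  assumes "\<phi> \<in> Irr G"
  shows "(\<Sum>g\<in>carrier G. \<phi> (inv g) * (\<Sum>\<psi>\<in>Irr G. c \<psi> * \<psi> g)) = of_nat (card (carrier G)) * c \<phi>"
proof -
  have *: "(\<Sum>g\<in>carrier G. \<phi> (inv g) * \<psi> g) = (if \<psi> = \<phi> then of_nat (card (carrier G)) else 0)"
    if "\<psi> \<in> Irr G" for \<psi>
    using Irr_conv_self[OF assms one_closed] Irr_conv_neq[OF assms that _ one_closed] Irr_one_neq_0[OF assms]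
    by auto
  have "(\<Sum>g\<in>carrier G. \<phi> (inv g) * (\<Sum>\<psi>\<in>Irr G. c \<psi> * \<psi> g)) =
      (\<Sum>\<psi>\<in>Irr G. c \<psi> * (\<Sum>g\<in>carrier G. \<phi> (inv g) * \<psi> g))"
    unfolding sum_distrib_left by (subst sum.swap) (simp add: mult_ac)
  also have "\<dots> = (\<Sum>\<psi>\<in>Irr G. if \<psi> = \<phi> then of_nat (card (carrier G)) * c \<phi> else 0)"
    by (intro sum.cong refl) (simp add: *)
  also have "\<dots> = of_nat (card (carrier G)) * c \<phi>"
    by (simp add: assms finite_Irr)
  finally show ?thesis .
qed

text \<open>Orthogonality recovers each coefficient from \<theta>, so the description in
  \<open>multiplicities\<close> has exactly one solution.\<close>

lemma multiplicities_eq: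
  fixes m :: "('g \<Rightarrow> 'K::{alg_closed_field, field_char_0}) \<Rightarrow> nat"
  assumes \<theta>: "\<And>g. g \<in> carrier G \<Longrightarrow> \<theta> g = (\<Sum>\<psi>\<in>Irr G. of_nat (m \<psi>) * \<psi> g)" and \<phi>: "\<phi> \<in> Irr G"
  shows "multiplicities G \<theta> \<phi> = m \<phi>"
proof -
  \<comment> \<open>The coefficients outside \<open>Irr G\<close> are set to 0, as the definition
    demands.\<close>
  define m' where "m' \<psi> = (if \<psi> \<in> Irr G then m \<psi> else 0)" for \<psi>
  have "multiplicities G \<theta> = m'"
    unfolding multiplicities_def
  proof (rule the_equality)
    show "(\<forall>\<psi>. \<psi> \<notin> Irr G \<longrightarrow> m' \<psi> = 0) \<and> (\<forall>g\<in>carrier G. \<theta> g = (\<Sum>\<psi>\<in>Irr G. of_nat (m' \<psi>) * \<psi> g))"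
      using \<theta> by (auto simp: m'_def)
    fix l assume l: "(\<forall>\<psi>. \<psi> \<notin> Irr G \<longrightarrow> l \<psi> = 0) \<and> (\<forall>g\<in>carrier G. \<theta> g = (\<Sum>\<psi>\<in>Irr G. of_nat (l \<psi>) * \<psi> g))"
    show "l = m'"
    proof
      fix \<psi> :: "'g \<Rightarrow> 'K"
      show "l \<psi> = m' \<psi>"
      proof (cases "\<psi> \<in> Irr G")
        case True
        have "of_nat (card (carrier G)) * of_nat (l \<psi>) = (\<Sum>g\<in>carrier G. \<psi> (inv g) * \<theta> g)"
          using l by (subst sum_Irr_inner[OF True, symmetric]) simp
        also have "\<dots> = of_nat (card (carrier G)) * of_nat (m \<psi>)"
          using \<theta> by (subst sum_Irr_inner[OF True, symmetric]) simp
        finally have "(of_nat (l \<psi>) :: 'K) = of_nat (m \<psi>)" by simp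
        then show ?thesis using True by (simp only: of_nat_eq_iff m'_def if_True)
      qed (use l in \<open>simp add: m'_def\<close>)
    qed
  qed
  then show ?thesis using \<phi> by (simp add: m'_def)
qed

section \<open>The ideal part\<close>

text \<open>The character afforded by the left ideal generated by an idempotent \<open>\<epsilon>\<close>.\<close>

definition ideal_char :: "('g \<Rightarrow> 'K::field) \<Rightarrow> 'g \<Rightarrow> 'K" where
  "ideal_char \<epsilon> g = (\<Sum>x\<in>carrier G. \<epsilon> (inv x \<otimes> inv g \<otimes> x))"

text \<open>By Schur's lemma f acts as a scalar, and the case g = 1 identifies this scalar through
  its trace.\<close>

lemma central_eval:
  fixes f :: "'g \<Rightarrow> 'K::{alg_closed_field, field_char_0}"
  assumes f: "\<And>g. g \<in> carrier G \<Longrightarrow> point g \<star> f = f \<star> point g" and \<psi>: "\<psi> \<in> Irr G" and g: "g \<in> carrier G"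
  shows "(\<Sum>y\<in>carrier G. f y * \<psi> (y \<otimes> g)) = (\<Sum>y\<in>carrier G. f y * \<psi> y) / \<psi> \<one> * \<psi> g"
proof -
  obtain n \<rho> where \<rho>: "irreducible_mat_representation G n \<rho>" "mat_representation G n \<rho>" "n > 0"
    "\<And>g. g \<in> carrier G \<Longrightarrow> \<psi> g = mat_trace (\<rho> g)" "\<psi> \<one> = of_nat n" by (rule IrrE[OF \<psi>]) blast
  obtain c where c: "rep_alg n \<rho> f = c \<cdot>\<^sub>m 1\<^sub>m n"
    by (rule central_scalar[OF \<rho>(1) f])
  note \<rho>g = mat_representation_carrier[OF \<rho>(2) g]
  have "(\<Sum>y\<in>carrier G. f y * \<psi> y) = mat_trace (rep_alg n \<rho> f)"
    by (simp add: mat_trace_rep_alg[OF \<rho>(2)] \<rho>(4))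
  also have "\<dots> = of_nat n * c" by (simp add: c mat_trace_def)
  finally have "c = (\<Sum>y\<in>carrier G. f y * \<psi> y) / \<psi> \<one>" using \<rho>(3,5) by simp
  moreover have "(\<Sum>y\<in>carrier G. f y * \<psi> (y \<otimes> g)) = (\<Sum>x\<in>carrier G. (f \<star> point g) x * \<psi> x)"
    using g by (subst sum_right_mult[OF g, symmetric]) (simp add: conv_point m_assoc)
  moreover have "\<dots> = mat_trace (rep_alg n \<rho> f * \<rho> g)"
    by (simp add: \<rho>(4) rep_alg_conv[OF \<rho>(2)] rep_alg_point[OF \<rho>(2) g] flip: mat_trace_rep_alg[OF \<rho>(2)])
  moreover have "rep_alg n \<rho> f * \<rho> g = c \<cdot>\<^sub>m \<rho> g"
    unfolding c using \<rho>g by (simp add: mult_smult_assoc_mat[of _ n n _ n])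
  moreover have "mat_trace (c \<cdot>\<^sub>m \<rho> g) = c * \<psi> g"
    using \<rho>g by (simp add: \<rho>(4)[OF g] mat_trace_def sum_distrib_left)
  ultimately show ?thesis by simp
qed

text \<open>Summing \<epsilon> over conjugates gives a central z whose coefficient at
  \<open>inv g\<close> is the left-hand side. The regular character extracts this coefficient, and
  on each of its constituents z acts as a scalar.\<close>

lemma ideal_char_decomposition:
  fixes \<epsilon> :: "'g \<Rightarrow> 'K::{alg_closed_field, field_char_0}"
  assumes g: "g \<in> carrier G"
  shows "ideal_char \<epsilon> g = (\<Sum>\<psi>\<in>Irr G. (\<Sum>y\<in>carrier G. \<epsilon> y * \<psi> y) * \<psi> g)"
proof -
  let ?c = "of_nat (card (carrier G)) :: 'K"
  define z where "z x = (if x \<in> carrier G then \<Sum>w\<in>carrier G. \<epsilon> (inv w \<otimes> x \<otimes> w) else 0)" for x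
  have z_central: "point h \<star> z = z \<star> point h" if h: "h \<in> carrier G" for h
  proof (rule galg_eqI)
    fix x assume x: "x \<in> carrier G"
    have "(point h \<star> z) x = (\<Sum>w\<in>carrier G. \<epsilon> (inv w \<otimes> (inv h \<otimes> x) \<otimes> w))"
      using h x by (simp add: point_conv z_def)
    also have "\<dots> = (\<Sum>w\<in>carrier G. \<epsilon> (inv (inv h \<otimes> w) \<otimes> (inv h \<otimes> x) \<otimes> (inv h \<otimes> w)))"
      by (rule sum_left_mult[symmetric]) (use h in simp)
    also have "\<dots> = (\<Sum>w\<in>carrier G. \<epsilon> (inv w \<otimes> (x \<otimes> inv h) \<otimes> w))"
    proof (rule sum.cong[OF refl])
      fix w assume w: "w \<in> carrier G"
      have "h \<otimes> (inv h \<otimes> x) = x"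
        using h x by (simp add: m_assoc[symmetric])
      then have "inv (inv h \<otimes> w) \<otimes> (inv h \<otimes> x) = inv w \<otimes> x"
        using w h x by (simp add: inv_mult_group m_assoc)
      then show "\<epsilon> (inv (inv h \<otimes> w) \<otimes> (inv h \<otimes> x) \<otimes> (inv h \<otimes> w)) = \<epsilon> (inv w \<otimes> (x \<otimes> inv h) \<otimes> w)"
        using w h x by (simp add: m_assoc)
    qed
    also have "\<dots> = (z \<star> point h) x"
      using h x by (simp add: conv_point z_def)
    finally show "(point h \<star> z) x = (z \<star> point h) x" .
  qed auto
  have z_inner: "(\<Sum>y\<in>carrier G. z y * \<psi> y) = ?c * (\<Sum>y\<in>carrier G. \<epsilon> y * \<psi> y)"
    if \<psi>: "\<psi> \<in> Irr G" for \<psi>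
  proof -
    have "(\<Sum>y\<in>carrier G. z y * \<psi> y) = (\<Sum>w\<in>carrier G. \<Sum>y\<in>carrier G. \<epsilon> (inv w \<otimes> y \<otimes> w) * \<psi> y)"
      by (subst sum.swap) (simp add: z_def sum_distrib_right)
    also have "\<dots> = (\<Sum>w\<in>carrier G. \<Sum>y\<in>carrier G. \<epsilon> y * \<psi> y)"
    proof (rule sum.cong[OF refl])
      fix w assume w: "w \<in> carrier G"
      have "(\<Sum>y\<in>carrier G. \<epsilon> (inv w \<otimes> y \<otimes> w) * \<psi> y) =
          (\<Sum>y\<in>carrier G. \<epsilon> (inv w \<otimes> (w \<otimes> y) \<otimes> w) * \<psi> (w \<otimes> y))"
        by (rule sum_left_mult[OF w, symmetric])
      also have "\<dots> = (\<Sum>y\<in>carrier G. \<epsilon> (y \<otimes> w) * \<psi> (y \<otimes> w))"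
        using w by (intro sum.cong refl) (simp add: Irr_class_function[OF \<psi> w] m_assoc[symmetric])
      also have "\<dots> = (\<Sum>y\<in>carrier G. \<epsilon> y * \<psi> y)"
        by (rule sum_right_mult[OF w])
      finally show "(\<Sum>y\<in>carrier G. \<epsilon> (inv w \<otimes> y \<otimes> w) * \<psi> y) = (\<Sum>y\<in>carrier G. \<epsilon> y * \<psi> y)" .
    qed
    finally show ?thesis by simp
  qed
  have "?c * ideal_char \<epsilon> g = ?c * z (inv g)"
    using g by (simp add: ideal_char_def z_def)
  also have "\<dots> = (\<Sum>y\<in>carrier G. z y * (if y = inv g then ?c else 0))"
    using g by (simp add: if_distrib[where f = "\<lambda>c. _ * c"] mult.commute cong: if_cong)
  also have "\<dots> = (\<Sum>y\<in>carrier G. z y * (\<Sum>\<psi>\<in>Irr G. \<psi> \<one> * \<psi> (y \<otimes> g)))"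
  proof (rule sum.cong[OF refl])
    fix y assume y: "y \<in> carrier G"
    have "y \<otimes> g = \<one> \<longleftrightarrow> y = inv g" using y g by (metis inv_equality l_inv)
    then show "z y * (if y = inv g then ?c else 0) = z y * (\<Sum>\<psi>\<in>Irr G. \<psi> \<one> * \<psi> (y \<otimes> g))"
      using y g by (simp add: sum_Irr_regular)
  qed
  also have "\<dots> = (\<Sum>\<psi>\<in>Irr G. \<psi> \<one> * (\<Sum>y\<in>carrier G. z y * \<psi> (y \<otimes> g)))"
    unfolding sum_distrib_left by (subst sum.swap) (simp add: mult_ac)
  also have "\<dots> = (\<Sum>\<psi>\<in>Irr G. ?c * ((\<Sum>y\<in>carrier G. \<epsilon> y * \<psi> y) * \<psi> g))"
  proof (rule sum.cong[OF refl])
    fix \<psi> :: "'g \<Rightarrow> 'K" assume \<psi>: "\<psi> \<in> Irr G"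
    have "(\<Sum>y\<in>carrier G. z y * \<psi> (y \<otimes> g)) = (?c * (\<Sum>y\<in>carrier G. \<epsilon> y * \<psi> y)) / \<psi> \<one> * \<psi> g"
      using central_eval[where f = z, OF z_central \<psi> g] unfolding z_inner[OF \<psi>] .
    then show "\<psi> \<one> * (\<Sum>y\<in>carrier G. z y * \<psi> (y \<otimes> g)) = ?c * ((\<Sum>y\<in>carrier G. \<epsilon> y * \<psi> y) * \<psi> g)"
      using Irr_one_neq_0[OF \<psi>] by simp
  qed
  also have "\<dots> = ?c * (\<Sum>\<psi>\<in>Irr G. (\<Sum>y\<in>carrier G. \<epsilon> y * \<psi> y) * \<psi> g)"
    by (simp only: sum_distrib_left)
  finally show ?thesis by (simp only: mult_cancel_left card_carrier_neq_0) simp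
qed

text \<open>The right-hand side is the trace of the idempotent matrix \<rho>(\<epsilon>), hence a
  natural number, and it is the coefficient of \<psi> in
  \<open>ideal_char_decomposition\<close>.\<close>

lemma multiplicities_ideal_char:
  fixes \<epsilon> :: "'g \<Rightarrow> 'K::{alg_closed_field, field_char_0}"
  assumes \<epsilon>: "\<epsilon> \<star> \<epsilon> = \<epsilon>" and \<theta>: "\<And>g. g \<in> carrier G \<Longrightarrow> \<theta> g = ideal_char \<epsilon> g" and \<psi>: "\<psi> \<in> Irr G"
  shows "of_nat (multiplicities G \<theta> \<psi>) = (\<Sum>y\<in>carrier G. \<epsilon> y * \<psi> y)"
proof -
  have "\<exists>m. (\<Sum>y\<in>carrier G. \<epsilon> y * \<psi> y) = of_nat m" if \<psi>: "\<psi> \<in> Irr G" for \<psi>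
  proof -
    obtain n \<rho> where \<rho>: "mat_representation G n \<rho>" "\<And>g. g \<in> carrier G \<Longrightarrow> \<psi> g = mat_trace (\<rho> g)"
      by (rule IrrE[OF \<psi>]) blast
    have "rep_alg n \<rho> \<epsilon> * rep_alg n \<rho> \<epsilon> = rep_alg n \<rho> \<epsilon>"
      using rep_alg_conv[OF \<rho>(1), of \<epsilon> \<epsilon>] \<epsilon> by simp
    from mat_trace_idempotent(1)[OF rep_alg_carrier this] show ?thesis
      by (simp add: mat_trace_rep_alg[OF \<rho>(1)] \<rho>(2))
  qed
  then obtain m where m: "\<And>\<psi>. \<psi> \<in> Irr G \<Longrightarrow> (\<Sum>y\<in>carrier G. \<epsilon> y * \<psi> y) = of_nat (m \<psi>)" by metis
  have "multiplicities G \<theta> \<psi> = m \<psi>"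
    by (rule multiplicities_eq[OF _ \<psi>]) (simp add: \<theta> ideal_char_decomposition m)
  then show ?thesis using m[OF \<psi>] by simp
qed

text \<open>Here \<open>\<epsilon>\<close> generates the module as a left ideal and \<open>F\<close> is the central idempotent of the two-sided ideal
  generated by its annihilator: \<open>1 - F\<close> is the sum of the central idempotents of those \<open>\<psi>\<close> that occur with
  full multiplicity.\<close>

lemma ideal_part_ideal_char:
  fixes \<epsilon> F :: "'g \<Rightarrow> 'K::{alg_closed_field, field_char_0}"
  assumes \<epsilon>: "\<epsilon> \<in> galg" "\<epsilon> \<star> \<epsilon> = \<epsilon>" and \<theta>: "\<And>g. g \<in> carrier G \<Longrightarrow> \<theta> g = ideal_char \<epsilon> g"
    and F: "F \<in> galg" "\<And>g. g \<in> carrier G \<Longrightarrow> point g \<star> F = F \<star> point g" "(point \<one> - \<epsilon>) \<star> F = point \<one> - \<epsilon>"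
    and rep: "\<And>n \<rho>. mat_representation G n \<rho> \<Longrightarrow> rep_alg n \<rho> \<epsilon> = 1\<^sub>m n \<Longrightarrow> rep_alg n \<rho> F = 0\<^sub>m n n"
    and g: "g \<in> carrier G"
  shows "ideal_part G \<theta> g = of_nat (card (carrier G)) * ((if g = \<one> then 1 else 0) - F (inv g))"
proof -
  let ?c = "of_nat (card (carrier G)) :: 'K"
  \<comment> \<open>The right-hand side is (1 - c)\<psi>(g), where c is the scalar by which F acts.
    What has to be shown is c = 0 for full multiplicity and c = 1 otherwise.\<close>
  have eval: "(if of_nat (multiplicities G \<theta> \<psi>) = \<psi> \<one> then \<psi> g else 0) = \<psi> g - (\<Sum>y\<in>carrier G. F y * \<psi> (y \<otimes> g))"
    if \<psi>: "\<psi> \<in> Irr G" for \<psi>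
  proof -
    obtain n \<rho> where \<rho>: "irreducible_mat_representation G n \<rho>" "mat_representation G n \<rho>" "n > 0"
      "\<And>g. g \<in> carrier G \<Longrightarrow> \<psi> g = mat_trace (\<rho> g)" "\<psi> \<one> = of_nat n" by (rule IrrE[OF \<psi>]) blast
    let ?R = "rep_alg n \<rho>"
    obtain c where c: "?R F = c \<cdot>\<^sub>m 1\<^sub>m n"
      by (rule central_scalar[OF \<rho>(1) F(2)])
    have trF: "(\<Sum>y\<in>carrier G. F y * \<psi> y) = of_nat n * c"
      using mat_trace_rep_alg[OF \<rho>(2), of F] by (simp add: \<rho>(4) c mat_trace_def)
    have R1: "?R (point \<one>) = 1\<^sub>m n"
      using rep_alg_point[OF \<rho>(2) one_closed] \<rho>(2) by (simp add: mat_representation_def)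
    \<comment> \<open>The trace of this idempotent is \<psi>(1) minus the multiplicity, so D
      vanishes exactly for full multiplicity.\<close>
    define D where "D = ?R (point \<one> - \<epsilon>)"
    have D: "D \<in> carrier_mat n n" by (simp add: D_def)
    have D_diff: "D = 1\<^sub>m n - ?R \<epsilon>" by (simp add: D_def rep_alg_diff R1)
    have D_idem: "D * D = D"
      using \<epsilon> by (simp add: D_def conv_diff_left conv_diff_right flip: rep_alg_conv[OF \<rho>(2)])
    \<comment> \<open>Multiplication by F fixes 1 - \<epsilon>, so c = 1 as soon as D has a nonzero
      entry.\<close>
    have D_F: "c \<cdot>\<^sub>m D = D"
      using arg_cong[OF F(3), of ?R] D
      by (simp add: rep_alg_conv[OF \<rho>(2)] c mult_smult_distrib[of _ n n _ n] flip: D_def)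
    have trD: "mat_trace D = of_nat n - of_nat (multiplicities G \<theta> \<psi>)"
    proof -
      have "mat_trace D = of_nat n - mat_trace (?R \<epsilon>)"
        unfolding D_diff mat_trace_def using carrier_matD[OF rep_alg_carrier[of n \<rho> \<epsilon>]] by (simp add: sum_subtractf)
      then show ?thesis
        by (simp add: multiplicities_ideal_char[OF \<epsilon>(2) \<theta> \<psi>] mat_trace_rep_alg[OF \<rho>(2)] \<rho>(4))
    qed
    have "c = (if of_nat (multiplicities G \<theta> \<psi>) = \<psi> \<one> then 0 else 1)"
    proof (cases "of_nat (multiplicities G \<theta> \<psi>) = \<psi> \<one>")
      case True
      then have "D = 0\<^sub>m n n"
        using mat_trace_idempotent(2)[OF D D_idem] trD \<rho>(5) by simp
      have "?R \<epsilon> $$ (i, j) = 1\<^sub>m n $$ (i, j)" if "i < n" "j < n" for i j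
        using arg_cong[OF \<open>D = 0\<^sub>m n n\<close>[unfolded D_diff], of "\<lambda>A. A $$ (i, j)"] that rep_alg_carrier[of n \<rho> \<epsilon>] by simp
      then have "?R \<epsilon> = 1\<^sub>m n"
        by (intro eq_matI) (auto simp: carrier_matD[OF rep_alg_carrier])
      from rep[OF \<rho>(2) this] have "(c \<cdot>\<^sub>m 1\<^sub>m n) $$ (0, 0) = 0\<^sub>m n n $$ (0, 0)" by (simp add: c)
      then show ?thesis using True \<rho>(3) by simp
    next
      case False
      then have "D \<noteq> 0\<^sub>m n n"
        using trD \<rho>(5) by (auto simp: mat_trace_def)
      have "\<exists>i<n. \<exists>j<n. D $$ (i, j) \<noteq> 0"
      proof (rule ccontr)
        assume "\<not> (\<exists>i<n. \<exists>j<n. D $$ (i, j) \<noteq> 0)"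
        then have "D = 0\<^sub>m n n" using D by (intro eq_matI) auto
        then show False using \<open>D \<noteq> 0\<^sub>m n n\<close> by simp
      qed
      then obtain i j where ij: "i < n" "j < n" "D $$ (i, j) \<noteq> 0" by blast
      then have "c * D $$ (i, j) = D $$ (i, j)"
        using arg_cong[OF D_F, of "\<lambda>A. A $$ (i, j)"] D by simp
      then show ?thesis using ij False by simp
    qed
    moreover have "(\<Sum>y\<in>carrier G. F y * \<psi> (y \<otimes> g)) = of_nat n * c / \<psi> \<one> * \<psi> g"
      using central_eval[where f = F, OF F(2) \<psi> g] unfolding trF .
    ultimately show ?thesis using \<rho>(3,5) by simp
  qed
  have "ideal_part G \<theta> g = (\<Sum>\<psi>\<in>Irr G. \<psi> \<one> * (if of_nat (multiplicities G \<theta> \<psi>) = \<psi> \<one> then \<psi> g else 0))"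
    unfolding ideal_part_def
    by (rule sum.mono_neutral_cong_left) (auto simp: finite_Irr)
  also have "\<dots> = (\<Sum>\<psi>\<in>Irr G. \<psi> \<one> * \<psi> g) - (\<Sum>\<psi>\<in>Irr G. \<psi> \<one> * (\<Sum>y\<in>carrier G. F y * \<psi> (y \<otimes> g)))"
    unfolding sum_subtractf[symmetric] by (intro sum.cong refl) (simp only: eval right_diff_distrib)
  also have "(\<Sum>\<psi>\<in>Irr G. \<psi> \<one> * (\<Sum>y\<in>carrier G. F y * \<psi> (y \<otimes> g))) = (\<Sum>y\<in>carrier G. F y * (\<Sum>\<psi>\<in>Irr G. \<psi> \<one> * \<psi> (y \<otimes> g)))"
    unfolding sum_distrib_left by (subst sum.swap) (simp add: mult_ac)
  also have "\<dots> = (\<Sum>y\<in>carrier G. F y * (if y = inv g then ?c else 0))"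
  proof (rule sum.cong[OF refl])
    fix y assume y: "y \<in> carrier G"
    have "y \<otimes> g = \<one> \<longleftrightarrow> y = inv g" using y g by (metis inv_equality l_inv)
    then show "F y * (\<Sum>\<psi>\<in>Irr G. \<psi> \<one> * \<psi> (y \<otimes> g)) = F y * (if y = inv g then ?c else 0)"
      using y g by (simp add: sum_Irr_regular)
  qed
  also have "\<dots> = ?c * F (inv g)"
    using g by (simp add: if_distrib[where f = "\<lambda>c. _ * c"] mult.commute cong: if_cong)
  finally show ?thesis
    using sum_Irr_regular[OF g, where 'K = 'K] by (simp add: right_diff_distrib)
qed

end

section \<open>Kernels of characters\<close>

lemma poly_of_rat_hom:
  fixes x :: "'b::field_char_0"
  shows "poly (map_poly of_rat (f + g)) x = poly (map_poly of_rat f) x + poly (map_poly of_rat g) x"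
    and "poly (map_poly of_rat (f * g)) x = poly (map_poly of_rat f) x * poly (map_poly of_rat g) x"
    and "poly (map_poly of_rat (f - g)) x = poly (map_poly of_rat f) x - poly (map_poly of_rat g) x"
    and "poly (map_poly of_rat (sum F S)) x = (\<Sum>i\<in>S. poly (map_poly of_rat (F i)) x)"
proof -
  interpret h: map_poly_comm_ring_hom "of_rat :: rat \<Rightarrow> 'b" ..
  show "poly (map_poly of_rat (f + g)) x = poly (map_poly of_rat f) x + poly (map_poly of_rat g) x"
    "poly (map_poly of_rat (f * g)) x = poly (map_poly of_rat f) x * poly (map_poly of_rat g) x"
    "poly (map_poly of_rat (f - g)) x = poly (map_poly of_rat f) x - poly (map_poly of_rat g) x"
    "poly (map_poly of_rat (sum F S)) x = (\<Sum>i\<in>S. poly (map_poly of_rat (F i)) x)"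
    by (simp_all add: h.hom_add h.hom_mult h.hom_minus h.hom_sum poly_sum)
qed

lemma rational_minpoly:
  fixes \<alpha> :: "'a::field_char_0" and q :: "rat poly"
  assumes q: "q \<noteq> 0" "poly (map_poly of_rat q) \<alpha> = 0"
  obtains p :: "rat poly" where "degree p > 0" "\<And>f. poly (map_poly of_rat f) \<alpha> = 0 \<longleftrightarrow> p dvd f"
proof -
  define I where "I f \<longleftrightarrow> poly (map_poly of_rat f) \<alpha> = 0" for f :: "rat poly"
  have "q \<noteq> 0 \<and> I q" using q by (simp add: I_def)
  from ex_has_least_nat[of "\<lambda>f. f \<noteq> 0 \<and> I f", OF this, of degree]
  obtain p where p: "p \<noteq> 0" "I p" and min: "\<And>f. f \<noteq> 0 \<Longrightarrow> I f \<Longrightarrow> degree p \<le> degree f" by blast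
  have dvd: "p dvd f" if f: "I f" for f
  proof -
    have "poly (map_poly of_rat (f div p * p + f mod p)) \<alpha> = 0" using f by (simp add: I_def)
    then have "I (f mod p)" using p(2) by (simp only: poly_of_rat_hom I_def) simp
    then have "f mod p = 0"
      using min[of "f mod p"] degree_mod_less[OF p(1), of f] by force
    then show "p dvd f" by (simp add: dvd_eq_mod_eq_0)
  qed
  have conv: "I f" if "p dvd f" for f
    using that p(2) by (auto simp: I_def poly_of_rat_hom elim!: dvdE)
  have iff: "poly (map_poly of_rat f) \<alpha> = 0 \<longleftrightarrow> p dvd f" for f
    unfolding I_def[symmetric] by (rule iffI[OF dvd conv])
  have "degree p > 0"
  proof (rule ccontr)
    assume "\<not> degree p > 0"
    then obtain c where "p = [:c:]" by (metis degree_eq_zeroE gr0I)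
    then show False using p by (simp add: I_def map_poly_pCons)
  qed
  then show thesis using iff by (rule that)
qed

text \<open>The minimal polynomial of \<alpha> is irreducible, so any of its roots in K has the same
  minimal polynomial. This avoids an embedding of the field of \<alpha> into K, which may fail to
  exist.\<close>

lemma rational_conjugate:
  fixes \<alpha> :: "'a::field_char_0" and q :: "rat poly"
  assumes q: "q \<noteq> 0" "poly (map_poly of_rat q) \<alpha> = 0"
  obtains \<zeta> :: "'K::{alg_closed_field, field_char_0}"
  where "\<And>f. poly (map_poly of_rat f) \<zeta> = 0 \<longleftrightarrow> poly (map_poly of_rat f) \<alpha> = 0"
proof -
  obtain p :: "rat poly" where p: "degree p > 0" "\<And>f. poly (map_poly of_rat f) \<alpha> = 0 \<longleftrightarrow> p dvd f"
    by (rule rational_minpoly[OF q]) blast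
  have "degree (map_poly of_rat p :: 'K poly) > 0"
    using p(1) by (subst degree_map_poly) auto
  then obtain \<zeta> :: 'K where \<zeta>: "poly (map_poly of_rat p) \<zeta> = 0"
    using alg_closed_imp_poly_has_root by blast
  have "p \<noteq> 0" using p(1) by auto
  then obtain p' :: "rat poly" where p': "degree p' > 0" "\<And>f. poly (map_poly of_rat f) \<zeta> = 0 \<longleftrightarrow> p' dvd f"
    by (rule rational_minpoly[OF _ \<zeta>]) blast
  obtain r where r: "p = p' * r" using p'(2)[of p] \<zeta> by (auto elim: dvdE)
  \<comment> \<open>As a root of \<open>p = p' * r\<close>, the element \<alpha> is a root of one of
    the factors; degrees then exclude r.\<close>
  have "p dvd p' \<or> p dvd r"
    using p(2)[of p] p(2)[of p'] p(2)[of r] by (simp add: poly_of_rat_hom r[symmetric]) (simp add: r poly_of_rat_hom)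
  moreover have "\<not> p dvd r"
  proof
    assume "p dvd r"
    have "r \<noteq> 0" "p' \<noteq> 0" using \<open>p \<noteq> 0\<close> r by auto
    then have "degree p = degree p' + degree r" using r degree_mult_eq by metis
    moreover have "degree p \<le> degree r" using \<open>p dvd r\<close> \<open>r \<noteq> 0\<close> by (rule dvd_imp_degree_le)
    ultimately show False using p'(1) by simp
  qed
  moreover have "p' dvd p" using r by simp
  ultimately have "p dvd f \<longleftrightarrow> p' dvd f" for f using dvd_trans by blast
  then show thesis using that[of \<zeta>] by (simp add: p(2) p'(2))
qed

text \<open>Here \<open>\<zeta>\<close> satisfies the same rational equations as \<open>exp(2\<pi>i/n)\<close>, which makes the equality case of the
  triangle inequality in \<open>\<complex>\<close> available in \<open>K\<close>.\<close>

lemma root_of_unity_rigid: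
  assumes n: "n > 0"
  obtains \<zeta> :: "'K::{alg_closed_field, field_char_0}"
  where "\<zeta> ^ n = 1" "\<And>i. 0 < i \<Longrightarrow> i < n \<Longrightarrow> \<zeta> ^ i \<noteq> 1"
    "\<And>a i. (\<Sum>i<n. of_nat (a i) * \<zeta> ^ i) = of_nat (\<Sum>i<n. a i) \<Longrightarrow> 0 < i \<Longrightarrow> i < n \<Longrightarrow> a i = 0"
proof -
  define \<omega> where "\<omega> = cis (2 * pi / real n)"
  have pow: "\<omega> ^ i = cis (2 * pi * real i / real n)" for i
    by (simp add: \<omega>_def DeMoivre mult_ac)
  have one: "\<omega> ^ n = 1" using n by (simp add: pow)
  have prim: "\<omega> ^ i \<noteq> 1" if "0 < i" "i < n" for i
  proof
    assume "\<omega> ^ i = 1"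
    then have "cis (2 * pi * real i / real n) = cis (2 * pi * real 0 / real n)" by (simp add: pow)
    then have "i = 0"
      using bij_betw_roots_unity[OF n] that by (auto simp: bij_betw_def inj_on_def)
    with that show False by simp
  qed
  define q :: "nat \<Rightarrow> rat poly" where "q i = Polynomial.monom 1 i - 1" for i
  have q: "poly (map_poly of_rat (q i)) x = x ^ i - 1" for i and x :: "'b::field_char_0"
    by (simp add: q_def poly_of_rat_hom map_poly_monom poly_monom)
  have "q n \<noteq> 0"
  proof -
    have "Polynomial.coeff (q n) n = 1" using n by (simp add: q_def)
    then show ?thesis by auto
  qed
  then obtain \<zeta> :: 'K where \<zeta>: "\<And>f. poly (map_poly of_rat f) \<zeta> = 0 \<longleftrightarrow> poly (map_poly of_rat f) \<omega> = 0"
    by (rule rational_conjugate[of "q n" \<omega>]) (auto simp: q one)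
  show thesis
  proof (rule that[of \<zeta>])
    show "\<zeta> ^ n = 1" using \<zeta>[of "q n"] one by (simp add: q)
    show "\<zeta> ^ i \<noteq> 1" if "0 < i" "i < n" for i using \<zeta>[of "q i"] prim[OF that] by (simp add: q)
    fix a i assume a: "(\<Sum>i<n. of_nat (a i) * \<zeta> ^ i) = of_nat (\<Sum>i<n. a i)" and i: "0 < i" "i < n"
    \<comment> \<open>That \<zeta> is a root of this rational polynomial is the assumed relation,
      which therefore also holds for \<omega>.\<close>
    define p :: "rat poly" where "p = (\<Sum>i<n. Polynomial.monom (of_nat (a i)) i) - Polynomial.monom (of_nat (\<Sum>i<n. a i)) 0"
    have p: "poly (map_poly of_rat p) x = (\<Sum>i<n. of_nat (a i) * x ^ i) - of_nat (\<Sum>i<n. a i)" for x :: "'b::field_char_0"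
      by (simp add: p_def poly_of_rat_hom map_poly_monom poly_monom del: of_nat_sum)
    have "(\<Sum>i<n. of_nat (a i) * \<omega> ^ i) = of_nat (\<Sum>i<n. a i)"
      using \<zeta>[of p] a by (simp add: p)
    \<comment> \<open>Every power of \<omega> has real part at most 1, so taking real parts turns
      the relation into a vanishing sum of nonnegative terms.\<close>
    then have "Re (\<Sum>i<n. of_nat (a i) * \<omega> ^ i) = Re (of_nat (\<Sum>i<n. a i))" by simp
    then have "(\<Sum>i<n. real (a i) * (1 - Re (\<omega> ^ i))) = 0"
      by (simp add: right_diff_distrib sum_subtractf)
    moreover have nonneg: "real (a i) * (1 - Re (\<omega> ^ i)) \<ge> 0" for i
      by (simp add: pow)
    ultimately have "real (a i) * (1 - Re (\<omega> ^ i)) = 0"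
      using i by (subst (asm) sum_nonneg_eq_0_iff) auto
    moreover have "Re (\<omega> ^ i) \<noteq> 1"
    proof
      assume "Re (\<omega> ^ i) = 1"
      moreover have "(Re (\<omega> ^ i))\<^sup>2 + (Im (\<omega> ^ i))\<^sup>2 = 1" by (simp add: pow)
      ultimately have "\<omega> ^ i = 1" by (simp add: complex_eq_iff)
      then show False using prim i by blast
    qed
    ultimately show "a i = 0" by simp
  qed
qed

section \<open>Elements acting trivially on a left ideal\<close>

context finite_group
begin

text \<open>On the left ideal generated by \<eta>, the eigenvalues of g are powers of a root of
  unity with multiplicities \<open>d i\<close>. Equality of the two character values makes the sum
  of these eigenvalues equal to their number, and \<open>root_of_unity_rigid\<close> leaves only the
  eigenvalue 1.\<close>

lemma ideal_char_kernel:
  fixes \<eta> :: "'g \<Rightarrow> 'K::{alg_closed_field, field_char_0}"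
  assumes \<eta>: "\<eta> \<star> \<eta> = \<eta>" and g: "g \<in> carrier G" and eq: "ideal_char \<eta> g = ideal_char \<eta> \<one>" and a: "a \<in> galg"
  shows "point g \<star> a \<star> \<eta> = a \<star> \<eta>"
proof -
  \<comment> \<open>The group order serves as exponent, since \<open>g [^] n = \<one>\<close> for
    every g.\<close>
  define n where "n = card (carrier G)"
  have n: "n > 0" by (simp add: n_def card_gt_0_iff)
  have gn: "g [^] n = \<one>" using pow_order_eq_1[OF g] by (simp add: n_def Coset.order_def)
  obtain \<zeta> :: 'K where \<zeta>: "\<zeta> ^ n = 1" "\<And>i. 0 < i \<Longrightarrow> i < n \<Longrightarrow> \<zeta> ^ i \<noteq> 1"
    "\<And>a i. (\<Sum>i<n. of_nat (a i) * \<zeta> ^ i) = of_nat (\<Sum>i<n. a i) \<Longrightarrow> 0 < i \<Longrightarrow> i < n \<Longrightarrow> a i = 0"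
    by (rule root_of_unity_rigid[OF n]) blast
  define \<xi> where "\<xi> = inverse \<zeta>"
  have \<zeta>0: "\<zeta> \<noteq> 0" using \<zeta>(1) n by (auto simp: power_0_left)
  have \<xi>\<zeta>: "\<xi> * \<zeta> = 1" using \<zeta>0 by (simp add: \<xi>_def)
  have \<xi>n: "\<xi> ^ n = 1" using \<zeta>(1) by (simp add: \<xi>_def power_inverse)
  txt \<open>The spectral idempotent of \<open>g\<close> for the eigenvalue \<open>\<zeta>\<^sup>i\<close>.\<close>
  define E where "E i = fscale (1 / of_nat n) (\<Sum>j<n. fscale (\<xi> ^ (i * j)) (point (g [^] j)))" for i
  have E_galg: "E i \<in> galg" for i
    unfolding E_def using g by (intro galg_scale galg_sum point_galg) simp
  \<comment> \<open>A cyclic shift of the index preserves the sum, because the terms for 0 and n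
    agree.\<close>
  have shift: "(\<Sum>j<n. fscale (\<xi> ^ (i * Suc j)) (point (g [^] Suc j))) = (\<Sum>j<n. fscale (\<xi> ^ (i * j)) (point (g [^] j)))" for i
  proof -
    let ?F = "\<lambda>j. fscale (\<xi> ^ (i * j)) (point (g [^] j))"
    have "?F n = ?F 0" using \<xi>n gn by (simp add: power_mult mult.commute[of i])
    moreover have "sum ?F {..<n} + ?F n = ?F 0 + (\<Sum>j<n. ?F (Suc j))"
      by (rule trans[OF sum.lessThan_Suc[symmetric] sum.lessThan_Suc_shift])
    ultimately have "?F 0 + (\<Sum>j<n. ?F (Suc j)) = ?F 0 + sum ?F {..<n}"
      by (simp only: add.commute)
    then show ?thesis by (rule add_left_imp_eq)
  qed
  have point_pow: "point g \<star> point (g [^] j) = (point (g [^] Suc j) :: 'g \<Rightarrow> 'K)" for j :: nat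
    unfolding nat_pow_Suc2[OF g] using g by (intro point_mult) auto
  have gE: "point g \<star> E i = fscale (\<zeta> ^ i) (E i)" for i
  proof -
    have "point g \<star> E i = fscale (1 / of_nat n) (\<Sum>j<n. fscale (\<xi> ^ (i * j)) (point (g [^] Suc j)))"
      by (simp only: E_def conv_scale_right conv_sum_right point_pow)
    also have "\<dots> = fscale (1 / of_nat n) (\<Sum>j<n. fscale (\<zeta> ^ i) (fscale (\<xi> ^ (i * Suc j)) (point (g [^] Suc j))))"
    proof (intro arg_cong[where f = "fscale _"] sum.cong refl)
      fix j
      have "\<zeta> ^ i * \<xi> ^ (i * Suc j) = (\<xi> * \<zeta>) ^ i * \<xi> ^ (i * j)"
        by (simp add: power_add power_mult_distrib mult_ac)
      then show "fscale (\<xi> ^ (i * j)) (point (g [^] Suc j)) = fscale (\<zeta> ^ i) (fscale (\<xi> ^ (i * Suc j)) (point (g [^] Suc j)))"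
        by (simp add: \<xi>\<zeta>)
    qed
    also have "\<dots> = fscale (\<zeta> ^ i) (E i)"
      unfolding E_def fs.scale_sum_right[symmetric] shift by (rule fs.scale_left_commute)
    finally show ?thesis .
  qed
  have gE_pow: "point (g [^] j) \<star> E i = fscale (\<zeta> ^ (i * j)) (E i)" for i j
  proof (induction j)
    case 0
    then show ?case using E_galg by simp
  next
    case (Suc j)
    have "point (g [^] Suc j) \<star> E i = point g \<star> (point (g [^] j) \<star> E i)"
      by (simp only: point_pow[symmetric] conv_assoc)
    also have "\<dots> = fscale (\<zeta> ^ (i * j)) (fscale (\<zeta> ^ i) (E i))"
      by (simp only: Suc.IH conv_scale_right gE)
    also have "\<dots> = fscale (\<zeta> ^ (i * Suc j)) (E i)"
      by (simp add: power_add mult.commute)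
    finally show ?case .
  qed
  have E_idem: "E i \<star> E i = E i" for i
  proof -
    have "E i \<star> E i = fscale (1 / of_nat n) (\<Sum>j<n. fscale (\<xi> ^ (i * j)) (point (g [^] j) \<star> E i))"
      unfolding E_def[of i] conv_scale_left conv_sum_left ..
    also have "\<dots> = fscale (1 / of_nat n) (\<Sum>j<n. E i)"
      by (intro arg_cong[where f = "fscale _"] sum.cong refl)
        (simp add: gE_pow \<xi>\<zeta> flip: power_mult_distrib)
    also have "\<dots> = E i"
      using n by (simp add: fun_eq_iff sum_fun_apply)
    finally show ?thesis .
  qed
  have E_sum: "(\<Sum>i<n. E i) = point \<one>"
  proof -
    have geo: "(\<Sum>i<n. \<xi> ^ (i * j)) = (if j = 0 then of_nat n else 0)" if "j < n" for j
    proof (cases "j = 0")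
      case False
      have "\<xi> ^ j \<noteq> 1"
      proof
        assume "\<xi> ^ j = 1"
        then have "\<zeta> ^ j = 1" by (simp add: \<xi>_def power_inverse)
        then show False using \<zeta>(2)[of j] False that by simp
      qed
      moreover have "(\<xi> ^ j) ^ n = (\<xi> ^ n) ^ j" by (simp only: power_mult[symmetric] mult.commute)
      then have "(\<xi> ^ j) ^ n = 1" by (simp add: \<xi>n)
      ultimately have "(\<Sum>i<n. (\<xi> ^ j) ^ i) = 0" by (simp add: geometric_sum)
      then show ?thesis using False by (simp add: mult.commute flip: power_mult)
    qed simp
    have "(\<Sum>i<n. E i) = (\<Sum>i<n. \<Sum>j<n. fscale (1 / of_nat n) (fscale (\<xi> ^ (i * j)) (point (g [^] j))))"
      by (simp only: E_def fs.scale_sum_right)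
    also have "\<dots> = (\<Sum>j<n. \<Sum>i<n. fscale (1 / of_nat n) (fscale (\<xi> ^ (i * j)) (point (g [^] j))))"
      by (rule sum.swap)
    also have "\<dots> = (\<Sum>j<n. fscale (1 / of_nat n * (\<Sum>i<n. \<xi> ^ (i * j))) (point (g [^] j)))"
      by (simp only: fs.scale_sum_left fs.scale_scale sum_distrib_left)
    also have "\<dots> = (\<Sum>j<n. if j = 0 then point \<one> else 0)"
      using n by (intro sum.cong refl) (simp add: geo)
    finally show ?thesis using n by simp
  qed
  \<comment> \<open>The trace of the operator sending a to ba\<eta>. For b = \<open>E i\<close> this
    operator is idempotent, and its trace \<open>d i\<close> is the dimension of an eigenspace of
    g.\<close>
  define tr where "tr b = (\<Sum>x\<in>carrier G. (b \<star> point x \<star> \<eta>) x)" for b :: "'g \<Rightarrow> 'K"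
  have tr_point: "tr (point h) = ideal_char \<eta> h" if "h \<in> carrier G" for h
    using that by (simp add: tr_def ideal_char_def point_mult point_conv inv_mult_group m_assoc)
  have tr_lin: "tr (\<Sum>i<n. fscale (c i) (E i)) = (\<Sum>i<n. c i * tr (E i))" for c
    unfolding tr_def conv_sum_left conv_scale_left sum_fun_apply fscale_apply sum_distrib_left by (rule sum.swap)
  have p_lin: "Vector_Spaces.linear fscale fscale (\<lambda>a. E i \<star> a \<star> \<eta>)" for i
    by unfold_locales (simp_all only: conv_add_left conv_add_right conv_scale_left conv_scale_right)
  have p_idem: "E i \<star> (E i \<star> a \<star> \<eta>) \<star> \<eta> = E i \<star> a \<star> \<eta>" for i a
  proof -
    have "E i \<star> (E i \<star> a \<star> \<eta>) \<star> \<eta> = (E i \<star> E i) \<star> a \<star> (\<eta> \<star> \<eta>)" by (simp only: conv_assoc)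
    then show ?thesis by (simp only: E_idem \<eta>)
  qed
  note p = trace_idempotent[where p = "\<lambda>a. E i \<star> a \<star> \<eta>" for i, OF p_lin p_idem finite_carrier galgD[OF conv_galg], folded tr_def]
  obtain d where d: "\<And>i. tr (E i) = of_nat (d i)"
    using p(1) by metis
  have "ideal_char \<eta> g = tr (\<Sum>i<n. fscale (\<zeta> ^ i) (E i))"
  proof -
    have "(\<Sum>i<n. fscale (\<zeta> ^ i) (E i)) = point g \<star> (\<Sum>i<n. E i)"
      by (simp only: conv_sum_right gE)
    then show ?thesis using g by (simp add: E_sum tr_point)
  qed
  then have "ideal_char \<eta> g = (\<Sum>i<n. of_nat (d i) * \<zeta> ^ i)"
    by (simp only: tr_lin d mult.commute)
  moreover have "ideal_char \<eta> \<one> = of_nat (\<Sum>i<n. d i)"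
  proof -
    have "tr (\<Sum>i<n. E i) = of_nat (\<Sum>i<n. d i)"
      using tr_lin[of "\<lambda>_. 1"] by (simp add: d)
    then show ?thesis by (simp add: E_sum tr_point)
  qed
  ultimately have "d i = 0" if "0 < i" "i < n" for i
    using \<zeta>(3)[of d i] that eq by simp
  then have zero: "E i \<star> a \<star> \<eta> = 0" if "0 < i" "i < n" for i
    using p(2)[of i a] that by (simp add: d)
  have "point g \<star> a \<star> \<eta> = (\<Sum>i<n. fscale (\<zeta> ^ i) (E i \<star> a \<star> \<eta>))"
  proof -
    have "point g = (\<Sum>i<n. fscale (\<zeta> ^ i) (E i))"
      using g by (simp only: E_sum conv_one point_galg flip: gE conv_sum_right)
    then show ?thesis by (simp only: conv_sum_left conv_scale_left)
  qed
  also have "\<dots> = (\<Sum>i<n. E i \<star> a \<star> \<eta>)"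
  proof (rule sum.cong[OF refl])
    fix i assume "i \<in> {..<n}"
    then show "fscale (\<zeta> ^ i) (E i \<star> a \<star> \<eta>) = E i \<star> a \<star> \<eta>"
      using zero[of i] by (cases "i = 0") simp_all
  qed
  also have "\<dots> = (\<Sum>i<n. E i) \<star> a \<star> \<eta>"
    by (simp only: conv_sum_left)
  finally show ?thesis using a by (simp add: E_sum)
qed

end

section \<open>The characterisation of the generic symmetries\<close>

context annihilator_idempotent
begin

definition f_kernel :: "'c set" where
  "f_kernel = {g \<in> carrier G. \<forall>u. act g (f \<rhd> u) = f \<rhd> u}"

lemma f_kernel_coset_iff:
  assumes x: "x \<in> carrier G" and y: "y \<in> carrier G"
  shows "y \<in> x <# f_kernel \<longleftrightarrow> (\<forall>u. act y (f \<rhd> u) = act x (f \<rhd> u))"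
proof
  assume "y \<in> x <# f_kernel"
  then obtain n where "n \<in> f_kernel" "y = x \<otimes> n" by (auto simp: l_coset_def)
  then show "\<forall>u. act y (f \<rhd> u) = act x (f \<rhd> u)"
    using x by (auto simp: f_kernel_def act_mult)
next
  assume *: "\<forall>u. act y (f \<rhd> u) = act x (f \<rhd> u)"
  have "inv x \<otimes> y \<in> f_kernel"
    using x y * by (simp add: f_kernel_def act_mult)
  moreover have "y = x \<otimes> (inv x \<otimes> y)"
    using x y by (simp add: m_assoc[symmetric])
  ultimately show "y \<in> x <# f_kernel"
    unfolding l_coset_def by blast
qed

lemma sym_cond_cosets_iff:
  assumes p: "\<pi> permutes carrier G"
  shows "(\<forall>g\<in>carrier G. \<forall>u. act (\<pi> g) (f \<rhd> u) = act (\<pi> \<one>) (act g (f \<rhd> u))) \<longleftrightarrow>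
    (\<forall>g\<in>carrier G. \<pi> ` (g <# f_kernel) = (\<pi> \<one> \<otimes> g) <# f_kernel)" (is "?L \<longleftrightarrow> ?R")
proof -
  have pG: "\<pi> g \<in> carrier G" if "g \<in> carrier G" for g
    using p that by (simp add: permutes_in_image)
  have sub: "x <# f_kernel \<subseteq> carrier G" if "x \<in> carrier G" for x
    using that by (auto simp: l_coset_def f_kernel_def)
  have card: "card (x <# f_kernel) = card f_kernel" if "x \<in> carrier G" for x
  proof -
    have "x <# f_kernel = (\<lambda>n. x \<otimes> n) ` f_kernel" by (auto simp: l_coset_def)
    moreover have "inj_on (\<lambda>n. x \<otimes> n) f_kernel"
      using that by (auto simp: inj_on_def f_kernel_def)
    ultimately show ?thesis by (simp add: card_image)
  qed
  show ?thesis
  proof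
    assume L: ?L
    show ?R
    proof
      fix g assume g: "g \<in> carrier G"
      have tg: "\<pi> \<one> \<otimes> g \<in> carrier G" using g pG by simp
      have "\<pi> ` (g <# f_kernel) \<subseteq> (\<pi> \<one> \<otimes> g) <# f_kernel"
      proof
        fix y assume "y \<in> \<pi> ` (g <# f_kernel)"
        then obtain x where x: "x \<in> g <# f_kernel" "y = \<pi> x" by blast
        then have xG: "x \<in> carrier G" using sub[OF g] by blast
        have "act (\<pi> x) (f \<rhd> u) = act (\<pi> \<one> \<otimes> g) (f \<rhd> u)" for u
          using L xG x(1) f_kernel_coset_iff[OF g xG] g pG by (simp add: act_mult)
        then show "y \<in> (\<pi> \<one> \<otimes> g) <# f_kernel"
          using f_kernel_coset_iff[OF tg pG[OF xG]] x(2) by simp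
      qed
      \<comment> \<open>The permutation is injective and all cosets have the same size, so the
        inclusion is an equality.\<close>
      moreover have "card (\<pi> ` (g <# f_kernel)) = card ((\<pi> \<one> \<otimes> g) <# f_kernel)"
        using card[OF g] card[OF tg] permutes_inj[OF p] by (simp add: card_image inj_on_def inj_def)
      ultimately show "\<pi> ` (g <# f_kernel) = (\<pi> \<one> \<otimes> g) <# f_kernel"
        using finite_subset[OF sub[OF tg] finite_carrier] by (intro card_subset_eq) auto
    qed
  next
    assume R: ?R
    show ?L
    proof (intro ballI allI)
      fix g u assume g: "g \<in> carrier G"
      have tg: "\<pi> \<one> \<otimes> g \<in> carrier G" using g pG by simp
      have "g \<in> g <# f_kernel" using f_kernel_coset_iff[OF g g] by simp
      then have "\<pi> g \<in> (\<pi> \<one> \<otimes> g) <# f_kernel" using R g by blast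
      then show "act (\<pi> g) (f \<rhd> u) = act (\<pi> \<one>) (act g (f \<rhd> u))"
        using f_kernel_coset_iff[OF tg pG[OF g]] g pG by (simp add: act_mult)
    qed
  qed
qed

end

theorem theorem2:
  fixes G :: "('g, 'm) monoid_scheme" (structure)
    and scale :: "'k::field_char_0 \<Rightarrow> 'v::ab_group_add \<Rightarrow> 'v"
    and act :: "'g \<Rightarrow> 'v \<Rightarrow> 'v"
    and emb :: "'k \<Rightarrow> 'K::{alg_closed_field, field_char_0}"
    and \<chi> \<chi>\<^sub>I :: "'g \<Rightarrow> 'K"
    and N :: "'g set"
    and \<pi> :: "'g \<Rightarrow> 'g"
  assumes "finite (carrier G)"
    and "group_representation scale G act"
    and "group_representation.cyclic scale G act"
    and "field_hom emb"
    and "\<chi> = (\<lambda>g. emb (group_representation.character scale act g))"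
    and "\<chi>\<^sub>I = ideal_part G \<chi>"
    and "N = char_Ker G (\<lambda>g. \<chi> g - \<chi>\<^sub>I g)"
    and "\<pi> permutes carrier G"
  shows "\<pi> \<in> group_representation.Sym_mod scale G act \<longleftrightarrow>
    (\<forall>g\<in>carrier G. \<forall>h\<in>carrier G. \<chi>\<^sub>I (inv (\<pi> g) \<otimes> \<pi> h) = \<chi>\<^sub>I (inv g \<otimes> h)) \<and>
    (\<forall>g\<in>carrier G. \<pi> ` (g <# N) = (\<pi> \<one> \<otimes> g) <# N)"
proof -
  interpret R: group_representation scale G act by fact
  interpret R: finite_group_representation scale G act
    by unfold_locales fact
  interpret emb: field_hom emb by fact
  obtain v0 where v0: "v0 \<in> R.Gens" using assms(3) by (auto simp: R.cyclic_def)
  obtain f where f: "f \<in> R.ann_ideal v0" "\<And>g. g \<in> carrier G \<Longrightarrow> R.conv (point g) f = R.conv f (point g)"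
    "\<And>a. a \<in> R.ann_ideal v0 \<Longrightarrow> R.conv a f = a"
    by (rule R.ann_ideal_central_idempotent) blast
  interpret A: annihilator_idempotent scale G act v0 f
    by unfold_locales (use v0 f in auto)
  obtain \<epsilon> where \<epsilon>: "\<epsilon> \<in> R.galg" "R.alg_act \<epsilon> v0 = v0" "\<And>a. a \<in> R.galg \<Longrightarrow> R.conv a \<epsilon> = 0 \<longleftrightarrow> a \<in> R.ann v0"
    by (rule R.generating_idempotent) blast
  note \<epsilon>\<epsilon> = R.generating_idempotent_idem[OF \<epsilon>]
  define c where "c = (of_nat (card (carrier G)) :: 'K)"
  have c: "c \<noteq> 0" by (simp add: c_def)
  \<comment> \<open>The elements \<epsilon> and f are transported along \<open>emb\<close>, so that
    representations over K can be applied to them while the module stays over k.\<close>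
  have emb_conv: "R.conv (\<lambda>x. emb (a x)) (\<lambda>x. emb (b x)) = (\<lambda>x. emb (R.conv a b x))" for a b
    by (simp add: R.conv_def fun_eq_iff emb.hom_sum emb.hom_mult)
  have emb_point: "(\<lambda>x. emb (point g x)) = point g" for g
    by (simp add: point_def fun_eq_iff)
  have emb_galg: "(\<lambda>x. emb (a x)) \<in> R.galg" if "a \<in> R.galg" for a
    using that by (simp add: R.galg_def)
  have emb_diff: "(\<lambda>x. emb ((a - b) x)) = (\<lambda>x. emb (a x)) - (\<lambda>x. emb (b x))" for a b
    by (simp add: fun_eq_iff emb.hom_minus)
  define \<epsilon>K where "\<epsilon>K = (\<lambda>x. emb (\<epsilon> x))"
  define fK where "fK = (\<lambda>x. emb (f x))"
  have \<chi>: "\<chi> g = R.ideal_char \<epsilon>K g" if "g \<in> carrier G" for g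
    using R.character_generating_idempotent[OF v0 \<epsilon>(1,3,2) that]
    by (simp add: assms(5) R.ideal_char_def \<epsilon>K_def emb.hom_sum)
  have compl: "R.conv (point \<one> - \<epsilon>) f = point \<one> - \<epsilon>"
  proof (rule f(3))
    have "point \<one> - \<epsilon> \<in> R.ann (act \<one> v0)"
      using \<epsilon> by (simp add: R.ann_def R.alg_diff_left)
    then show "point \<one> - \<epsilon> \<in> R.ann_ideal v0"
      using R.ann_subset_ann_ideal[OF R.one_closed] by blast
  qed
  \<comment> \<open>For a in \<open>ann (act h v0)\<close> the product ah\<epsilon> is zero, so a
    representation sending \<epsilon> to 1 satisfies \<rho>(a)\<rho>(h) = 0 and kills the whole
    ideal. The set \<open>?S\<close> is a subspace over k although the matrices have entries in
    K.\<close>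
  have rep: "R.rep_alg n \<rho> fK = 0\<^sub>m n n"
    if \<rho>: "mat_representation G n \<rho>" and id: "R.rep_alg n \<rho> \<epsilon>K = 1\<^sub>m n" for n \<rho>
  proof -
    let ?S = "{a. R.rep_alg n \<rho> (\<lambda>x. emb (a x)) = 0\<^sub>m n n}"
    have "fs.subspace ?S"
    proof (rule fs.subspaceI)
      show "0 \<in> ?S" by (auto simp: R.rep_alg_def)
    next
      fix a b assume "a \<in> ?S" "b \<in> ?S"
      then have "(\<Sum>g\<in>carrier G. emb (a g) * \<rho> g $$ (i, j)) = 0" "(\<Sum>g\<in>carrier G. emb (b g) * \<rho> g $$ (i, j)) = 0"
        if "i < n" "j < n" for i j
        using that by (auto simp: R.rep_alg_def mat_eq_iff)
      then show "a + b \<in> ?S"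
        by (auto simp: R.rep_alg_def emb.hom_add distrib_right sum.distrib)
    next
      fix r a assume "a \<in> ?S"
      then have "(\<Sum>g\<in>carrier G. emb (a g) * \<rho> g $$ (i, j)) = 0" if "i < n" "j < n" for i j
        using that by (auto simp: R.rep_alg_def mat_eq_iff)
      then show "fscale r a \<in> ?S"
        by (auto simp: R.rep_alg_def emb.hom_mult mult.assoc simp flip: sum_distrib_left)
    qed
    moreover have "a \<in> ?S" if h: "h \<in> carrier G" and a: "a \<in> R.ann (act h v0)" for a h
    proof -
      let ?R = "R.rep_alg n \<rho>" and ?a = "\<lambda>x. emb (a x)"
      have "R.conv a (point h) \<in> R.ann v0"
        using R.ann_translate[OF a h h] h by simp
      then have "R.conv (R.conv a (point h)) \<epsilon> = 0"
        using \<epsilon>(3)[OF R.conv_galg] by blast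
      then have "R.conv (R.conv ?a (point h)) \<epsilon>K = 0"
        unfolding \<epsilon>K_def emb_point[of h, symmetric] emb_conv by (simp add: fun_eq_iff)
      then have "?R (R.conv (R.conv ?a (point h)) \<epsilon>K) = 0\<^sub>m n n"
        by (auto simp: R.rep_alg_def)
      then have "?R ?a * \<rho> h = 0\<^sub>m n n"
        using R.rep_alg_carrier[of n \<rho>] R.mat_representation_carrier[OF \<rho> h]
        by (simp add: R.rep_alg_conv[OF \<rho>] R.rep_alg_point[OF \<rho> h] id)
      then have "?R ?a * \<rho> h * \<rho> (inv h) = 0\<^sub>m n n"
        using R.mat_representation_carrier[OF \<rho>, of "inv h"] h by simp
      moreover have "\<rho> h * \<rho> (inv h) = 1\<^sub>m n"
      proof -
        have "\<rho> h * \<rho> (inv h) = \<rho> (h \<otimes> inv h)"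
          using \<rho> R.inv_closed[OF h] h unfolding mat_representation_def by metis
        then show ?thesis using \<rho> h by (simp add: mat_representation_def)
      qed
      ultimately show ?thesis
        using R.mat_representation_carrier[OF \<rho>, of "inv h"] R.mat_representation_carrier[OF \<rho> h] h
          R.rep_alg_carrier[of n \<rho> ?a]
        by (simp add: assoc_mult_mat[of _ n n _ n _ n])
    qed
    ultimately have "f \<in> ?S"
      using R.ann_ideal_mapI[OF fs.linear_id _ _ f(1), of ?S] by simp
    then show ?thesis by (simp add: fK_def)
  qed
  have \<chi>\<^sub>I: "\<chi>\<^sub>I g = c * ((if g = \<one> then 1 else 0) - emb (f (inv g)))" if g: "g \<in> carrier G" for g
  proof -
    have "ideal_part G \<chi> g = c * ((if g = \<one> then 1 else 0) - fK (inv g))"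
      unfolding c_def
    proof (rule R.ideal_part_ideal_char[where \<epsilon> = \<epsilon>K, OF _ _ \<chi> _ _ _ rep g])
      show "\<epsilon>K \<in> R.galg" "fK \<in> R.galg" by (simp_all add: \<epsilon>K_def fK_def emb_galg \<epsilon>(1))
      show "R.conv \<epsilon>K \<epsilon>K = \<epsilon>K" by (simp add: \<epsilon>K_def emb_conv \<epsilon>\<epsilon>)
      show "R.conv (point g) fK = R.conv fK (point g)" if "g \<in> carrier G" for g
        unfolding fK_def emb_point[of g, symmetric] emb_conv f(2)[OF that] ..
      show "R.conv (point \<one> - \<epsilon>K) fK = point \<one> - \<epsilon>K"
        unfolding fK_def \<epsilon>K_def emb_point[of \<one>, symmetric] emb_diff[symmetric] emb_conv compl ..
    qed
    then show ?thesis by (simp add: assms(6) fK_def)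
  qed
  have pG: "\<pi> g \<in> carrier G" if "g \<in> carrier G" for g
    using assms(8) that by (simp add: permutes_in_image)
  \<comment> \<open>The formula for \<open>\<chi>\<^sub>I\<close> evaluates f at the inverse, which
    exchanges g and h. The identity terms agree on both sides because \<pi> is injective.\<close>
  have first: "\<chi>\<^sub>I (inv (\<pi> g) \<otimes> \<pi> h) = \<chi>\<^sub>I (inv g \<otimes> h) \<longleftrightarrow> f (inv (\<pi> h) \<otimes> \<pi> g) = f (inv h \<otimes> g)"
    if g: "g \<in> carrier G" and h: "h \<in> carrier G" for g h
  proof -
    have one: "inv x \<otimes> y = \<one> \<longleftrightarrow> x = y" if "x \<in> carrier G" "y \<in> carrier G" for x y
      using that by (metis R.inv_closed R.inv_inv R.inv_equality R.l_inv)
    have "\<pi> g = \<pi> h \<longleftrightarrow> g = h"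
      using permutes_inj[OF assms(8)] by (auto dest: injD)
    then show ?thesis
      using g h pG c by (simp add: \<chi>\<^sub>I one R.inv_mult_group)
  qed
  \<comment> \<open>This idempotent corresponds to fV: \<epsilon> is the sum of \<eta> and 1 - f,
    and 1 - f has character \<open>\<chi>\<^sub>I\<close>, so \<eta> has the character whose kernel
    is N.\<close>
  define \<eta> where "\<eta> = R.conv \<epsilon> f"
  define \<eta>K where "\<eta>K = (\<lambda>x. emb (\<eta> x))"
  have \<eta>\<epsilon>: "\<eta> = R.conv f \<epsilon>" using A.f_commute[OF \<epsilon>(1)] by (simp add: \<eta>_def)
  have ff: "R.conv f f = f" by (rule f(3)[OF f(1)])
  have \<eta>\<eta>: "R.conv \<eta> \<eta> = \<eta>"
  proof -
    have "R.conv \<eta> \<eta> = R.conv f (R.conv (R.conv \<epsilon> \<epsilon>) f)"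
      by (subst (1) \<eta>\<epsilon>) (simp only: \<eta>_def R.conv_assoc)
    also have "\<dots> = R.conv (R.conv f f) \<epsilon>"
      using A.f_commute[OF \<epsilon>(1)] by (simp only: \<epsilon>\<epsilon> R.conv_assoc)
    finally show ?thesis by (simp only: ff \<eta>\<epsilon>)
  qed
  have \<epsilon>_split: "\<epsilon> = \<eta> + (point \<one> - f)"
    using compl A.f_galg by (simp add: \<eta>_def R.conv_diff_left algebra_simps)
  have diff: "\<chi> g - \<chi>\<^sub>I g = R.ideal_char \<eta>K g" if g: "g \<in> carrier G" for g
  proof -
    \<comment> \<open>A central element is constant on conjugacy classes, so the sum over x
      multiplies its value by |G|.\<close>
    have "f (inv x \<otimes> inv g \<otimes> x) = f (inv g)" if x: "x \<in> carrier G" for x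
    proof -
      have "f (inv x \<otimes> (inv g \<otimes> x)) = f ((inv g \<otimes> x) \<otimes> inv x)"
        using fun_cong[OF f(2)[OF x], of "inv g \<otimes> x"] x g by (simp add: R.point_conv R.conv_point)
      then show ?thesis using x g by (simp add: R.m_assoc)
    qed
    moreover have "inv x \<otimes> inv g \<otimes> x = \<one> \<longleftrightarrow> g = \<one>" if x: "x \<in> carrier G" for x
    proof
      assume "inv x \<otimes> inv g \<otimes> x = \<one>"
      then have "x \<otimes> (inv x \<otimes> inv g \<otimes> x) \<otimes> inv x = \<one>" using x by simp
      then have "inv g = \<one>" using x g by (simp add: R.m_assoc) (simp add: R.m_assoc[symmetric])
      then show "g = \<one>" using g by (simp add: R.inv_eq_1_iff)
    qed (use x in simp)
    ultimately have "emb (\<epsilon> (inv x \<otimes> inv g \<otimes> x)) = emb (\<eta> (inv x \<otimes> inv g \<otimes> x)) + ((if g = \<one> then 1 else 0) - emb (f (inv g)))"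
      if "x \<in> carrier G" for x
      by (subst \<epsilon>_split) (simp add: that point_def emb.hom_add emb.hom_minus)
    then have "R.ideal_char \<epsilon>K g = R.ideal_char \<eta>K g + c * ((if g = \<one> then 1 else 0) - emb (f (inv g)))"
      by (simp add: R.ideal_char_def \<epsilon>K_def \<eta>K_def sum.distrib c_def)
    then show ?thesis using \<chi>[OF g] \<chi>\<^sub>I[OF g] by simp
  qed
  have \<eta>v: "R.alg_act \<eta> v0 = R.alg_act f v0"
    by (simp add: \<eta>\<epsilon> R.alg_conv \<epsilon>(2))
  have N_eq: "N = A.f_kernel"
  proof (intro Set.equalityI subsetI)
    fix g assume "g \<in> N"
    then have g: "g \<in> carrier G" and eq: "R.ideal_char \<eta>K g = R.ideal_char \<eta>K \<one>"
      by (auto simp: assms(7) char_Ker_def diff)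
    have \<eta>K: "R.conv \<eta>K \<eta>K = \<eta>K" by (simp add: \<eta>K_def emb_conv \<eta>\<eta>)
    have "act g (R.alg_act f u) = R.alg_act f u" for u
    proof -
      obtain b where b: "b \<in> R.galg" "R.alg_act b v0 = u" using v0 unfolding R.Gens_iff by blast
      have "(\<lambda>x. emb (R.conv (R.conv (point g) b) \<eta> x)) = (\<lambda>x. emb (R.conv b \<eta> x))"
        using R.ideal_char_kernel[OF \<eta>K g eq emb_galg[OF b(1)]]
        unfolding \<eta>K_def emb_point[of g, symmetric] emb_conv .
      then have "R.conv (R.conv (point g) b) \<eta> = R.conv b \<eta>" by (simp add: fun_eq_iff)
      then have "R.alg_act (R.conv (R.conv (point g) b) \<eta>) v0 = R.alg_act (R.conv b \<eta>) v0" by simp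
      moreover have "R.alg_act b (R.alg_act f v0) = R.alg_act f u"
        using A.f_commute[OF b(1)] by (simp add: b(2)[symmetric] flip: R.alg_conv)
      ultimately show ?thesis using g by (simp add: R.alg_conv \<eta>v)
    qed
    then show "g \<in> A.f_kernel" using g by (simp add: A.f_kernel_def)
  next
    fix g assume "g \<in> A.f_kernel"
    then have g: "g \<in> carrier G" and triv: "\<And>u. act g (R.alg_act f u) = R.alg_act f u"
      by (auto simp: A.f_kernel_def)
    have "\<eta> (inv x \<otimes> inv g \<otimes> x) = \<eta> \<one>" if x: "x \<in> carrier G" for x
    proof -
      \<comment> \<open>This element annihilates \<open>v0\<close>, so its product with \<epsilon>
        is zero; the product is the element itself because \<eta>\<epsilon> = \<eta>. The
        coefficient at x then compares \<eta> at a conjugate of \<open>inv g\<close> with \<eta> at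
        the identity.\<close>
      let ?d = "R.conv (point g) (R.conv (point x) \<eta>) - R.conv (point x) \<eta>"
      have "act x (R.alg_act f v0) = R.alg_act f (act x v0)"
        using f(2)[OF x] x by (metis R.alg_conv R.alg_point)
      then have "?d \<in> R.ann v0"
        using g x triv by (simp add: R.ann_def R.alg_diff_left R.alg_conv \<eta>v)
      then have "R.conv ?d \<epsilon> = 0" using \<epsilon>(3)[of ?d] by simp
      moreover have "R.conv \<eta> \<epsilon> = \<eta>" by (simp add: \<eta>\<epsilon> R.conv_assoc \<epsilon>\<epsilon>)
      ultimately have "?d = 0" by (simp add: R.conv_diff_left R.conv_assoc)
      then have "R.conv (point g) (R.conv (point x) \<eta>) x = R.conv (point x) \<eta> x" by (simp add: fun_eq_iff)
      then show ?thesis using g x by (simp add: R.point_conv R.m_assoc)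
    qed
    then have "R.ideal_char \<eta>K g = R.ideal_char \<eta>K \<one>"
      by (simp add: R.ideal_char_def \<eta>K_def)
    then show "g \<in> N" using g by (simp add: assms(7) char_Ker_def diff)
  qed
  have "\<pi> \<in> R.Sym_mod \<longleftrightarrow> (\<forall>g\<in>carrier G. \<forall>h\<in>carrier G. f (inv (\<pi> g) \<otimes> \<pi> h) = f (inv g \<otimes> h)) \<and>
      (\<forall>g\<in>carrier G. \<pi> ` (g <# N) = (\<pi> \<one> \<otimes> g) <# N)"
    unfolding A.Sym_mod_iff[OF assms(8)] A.sym_cond_def A.sym_cond_cosets_iff[OF assms(8)] N_eq ..
  also have "(\<forall>g\<in>carrier G. \<forall>h\<in>carrier G. f (inv (\<pi> g) \<otimes> \<pi> h) = f (inv g \<otimes> h)) \<longleftrightarrow>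
      (\<forall>g\<in>carrier G. \<forall>h\<in>carrier G. \<chi>\<^sub>I (inv (\<pi> g) \<otimes> \<pi> h) = \<chi>\<^sub>I (inv g \<otimes> h))"
    using first by blast
  finally show ?thesis .
qed

end
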